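(* Let $(V,\omega)$ be a complex symplectic vector space of dimension $m$, let $\tau>0$, $\gamma\in\mathcal P_\tau(V)$, and set $M:=\gamma(\tau)$. Then for any positive integers $k_1,k_2$, $$\nu_1(M^{k_1})+\nu_1(M^{k_2})-\nu_1(M^{(k_1,k_2)})-\frac{e(M)+m}{2}\ \le\ i_1(\gamma,k_1+k_2)-i_1(\gamma,k_1)-i_1(\gamma,k_2)\ \le\ \nu_1(M^{(k_1,k_2)})-\nu_1(M^{k_1+k_2})+\frac{e(M)-m}{2},$$ where $(k_1,k_2)$ in the exponent denotes the greatest common divisor of $k_1$ and $k_2$.
   Context: A symplectic form on a finite-dimensional complex vector space $V$ is a non-degenerate skew-Hermitian (sesquilinear, linear in the first variable) form $\omega$; $\mathrm{Sp}(V)$ is the group of invertible linear maps preserving $\omega$. A subspace $\lambda$ is Lagrangian if it equals its $\omega$-annihilator. $\mathcal P_\tau(V):=\{\gamma\in C([0,\tau],\mathrm{Sp}(V)):\gamma(0)=I_V\}$. For $M\in \mathrm{Sp}(V)$: $\nu_1(M):=\dim\ker(M-I_V)$, and the elliptic height $e(M)$ is the total algebraic multiplicity of all eigenvalues of $M$ on the unit circle. Iteration. For $\gamma\in\mathcal P_\tau(V)$ with $M=\gamma(\tau)$ and a positive integer $k$, the $k$-th iteration $(\gamma,k)\in\mathcal P_{k\tau}(V)$ is $(\gamma,k)(t)=\gamma(t-(l-1)\tau)M^{l-1}$ for $(l-1)\tau\le t\le l\tau$, $l=1,\dots,k$. $i_1(\gamma,k)$ means $i_1$ of the path $(\gamma,k)$.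 Maslov index. Let $(X,\Omega)$ be a complex symplectic vector space of dimension $2N$ possessing Lagrangian subspaces. Choose an inner product (linear in the first variable) and $J\in \mathrm{GL}(X)$ with $\Omega(x,y)=\langle Jx,y\rangle$; $iJ$ is self-adjoint. Let $X^-$ (resp. $X^+$) be the span of eigenvectors of $iJ$ with positive (resp. negative) eigenvalues. For a continuous path $(\lambda(s),\mu(s))$, $s\in[a,b]$, of pairs of Lagrangian subspaces, write them as graphs of $U_\lambda(s),U_\mu(s):X^-\to X^+$; the operators $U_\lambda(s)U_\mu(s)^{-1}$ are unitary on $(X^+,-i\Omega|_{X^+})$ with eigenvalues $e^{i\theta_j(s)}$, $\theta_j$ continuous real, $j=1,\dots,N$. With $E(x)$ the smallest integer $\ge x$, $\mathrm{Mas}\{\lambda,\mu\}:=\sum_j\big(E(\theta_j(b)/2\pi)-E(\theta_j(a)/2\pi)\big)$ (independent of choices). A single Lagrangian in place of a path means the constant path. Maslov-type index. $V\oplus V$ carries the symplectic form $(-\omega)\oplus\omega$; for $A\in \mathrm{Sp}(V)$ the graph $\mathrm{Gr}(A)=\{(x,Ax)\}$ is Lagrangian. For a path $\gamma$ in $\mathrm{Sp}(V)$, $i_1(\gamma):=\mathrm{Mas}\{\mathrm{Gr}\circ\gamma,\mathrm{Gr}(I_V)\}$. *)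

theory Defs
  imports "HOL-Analysis.Analysis"
begin

text \<open>
  A complex vector space is a type equipped with a scalar multiplication
  \<open>s :: complex \<Rightarrow> 'v \<Rightarrow> 'v\<close> satisfying the locale predicate \<open>vector_space s\<close>;
  dimension zero is allowed.
\<close>

section \<open>Forms and the symplectic group\<close>

definition sesquilinear ::
  "(complex \<Rightarrow> 'v::ab_group_add \<Rightarrow> 'v) \<Rightarrow> ('v \<Rightarrow> 'v \<Rightarrow> complex) \<Rightarrow> bool"
  where "sesquilinear s B \<longleftrightarrow>
    (\<forall>y. Vector_Spaces.linear s (*) (\<lambda>x. B x y)) \<and>
    (\<forall>x. Vector_Spaces.linear s (*) (\<lambda>y. cnj (B x y)))"

definition symplectic_form ::
  "(complex \<Rightarrow> 'v::ab_group_add \<Rightarrow> 'v) \<Rightarrow> ('v \<Rightarrow> 'v \<Rightarrow> complex) \<Rightarrow> bool"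
  where "symplectic_form s \<omega> \<longleftrightarrow>
    sesquilinear s \<omega> \<and>
    (\<forall>x y. \<omega> x y = - cnj (\<omega> y x)) \<and>
    (\<forall>x. (\<forall>y. \<omega> x y = 0) \<longrightarrow> x = 0)"

definition inner_product ::
  "(complex \<Rightarrow> 'v::ab_group_add \<Rightarrow> 'v) \<Rightarrow> ('v \<Rightarrow> 'v \<Rightarrow> complex) \<Rightarrow> bool"
  where "inner_product s g \<longleftrightarrow>
    sesquilinear s g \<and>
    (\<forall>x y. g x y = cnj (g y x)) \<and>
    (\<forall>x. x \<noteq> 0 \<longrightarrow> 0 < Re (g x x))"

locale complex_symplectic_space = vector_space scale
  for scale :: "complex \<Rightarrow> 'v::ab_group_add \<Rightarrow> 'v" +
  fixes \<omega> :: "'v \<Rightarrow> 'v \<Rightarrow> complex"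
  assumes finite_dim: "\<exists>B. finite B \<and> span B = UNIV"
    and symplectic: "symplectic_form scale \<omega>"

definition Sp ::
  "(complex \<Rightarrow> 'v::ab_group_add \<Rightarrow> 'v) \<Rightarrow> ('v \<Rightarrow> 'v \<Rightarrow> complex) \<Rightarrow> ('v \<Rightarrow> 'v) set"
  where "Sp s \<omega> =
    {A. Vector_Spaces.linear s s A \<and> bij A \<and> (\<forall>x y. \<omega> (A x) (A y) = \<omega> x y)}"

section \<open>Eigenvalue counts\<close>

text \<open>
  Algebraic multiplicity of \<open>z\<close> as an eigenvalue of an operator \<open>T\<close> on the subspace \<open>Y\<close>:
  the dimension of the generalized eigenspace. It is \<open>0\<close> if \<open>z\<close> is not an eigenvalue.
\<close>

definition alg_mult ::
  "(complex \<Rightarrow> 'v::ab_group_add \<Rightarrow> 'v) \<Rightarrow> 'v set \<Rightarrow> ('v \<Rightarrow> 'v) \<Rightarrow> complex \<Rightarrow> nat"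
  where "alg_mult s Y T z =
    vector_space.dim s {y \<in> Y. \<exists>n. ((\<lambda>x. T x - s z x) ^^ n) y = 0}"

definition nu1 :: "(complex \<Rightarrow> 'v::ab_group_add \<Rightarrow> 'v) \<Rightarrow> ('v \<Rightarrow> 'v) \<Rightarrow> nat"
  where "nu1 s M = vector_space.dim s {v. M v - v = 0}"

definition elliptic_height ::
  "(complex \<Rightarrow> 'v::ab_group_add \<Rightarrow> 'v) \<Rightarrow> ('v \<Rightarrow> 'v) \<Rightarrow> nat"
  where "elliptic_height s M =
    (\<Sum>z | cmod z = 1 \<and> (\<exists>v. v \<noteq> 0 \<and> M v = s z v). alg_mult s UNIV M z)"

section \<open>Symplectic paths and their iterations\<close>

text \<open>
  Continuity refers to the canonical topology of the finite-dimensional space of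
  endomorphisms: all matrix coefficients \<open>t \<mapsto> f (\<gamma> t v)\<close>, with \<open>f\<close> a linear functional,
  are continuous. Values of \<open>\<gamma>\<close> outside \<open>{0..\<tau>}\<close> are irrelevant.
\<close>

definition sp_paths ::
  "(complex \<Rightarrow> 'v::ab_group_add \<Rightarrow> 'v) \<Rightarrow> ('v \<Rightarrow> 'v \<Rightarrow> complex) \<Rightarrow> real \<Rightarrow> (real \<Rightarrow> 'v \<Rightarrow> 'v) set"
  where "sp_paths s \<omega> \<tau> = {\<gamma>.
    (\<forall>t\<in>{0..\<tau>}. \<gamma> t \<in> Sp s \<omega>) \<and>
    (\<forall>v f. Vector_Spaces.linear s (*) f \<longrightarrow> continuous_on {0..\<tau>} (\<lambda>t. f (\<gamma> t v))) \<and>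
    \<gamma> 0 = id}"

text \<open>
  At the common endpoint of two consecutive segments both admissible values of \<open>l\<close> give the
  same map (see \<open>path_iterate_eq\<close> below), so taking the least one is harmless.
\<close>

definition path_iterate :: "real \<Rightarrow> (real \<Rightarrow> 'v \<Rightarrow> 'v) \<Rightarrow> nat \<Rightarrow> real \<Rightarrow> 'v \<Rightarrow> 'v"
  where "path_iterate \<tau> \<gamma> k t =
    (let l = (LEAST l. 1 \<le> l \<and> l \<le> k \<and> (real l - 1) * \<tau> \<le> t \<and> t \<le> real l * \<tau>)
     in \<gamma> (t - (real l - 1) * \<tau>) \<circ> (\<gamma> \<tau> ^^ (l - 1)))"

lemma path_iterate_eq:
  assumes "0 < \<tau>" "\<gamma> 0 = id" "1 \<le> l" "l \<le> k" "(real l - 1) * \<tau> \<le> t" "t \<le> real l * \<tau>"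
  shows "path_iterate \<tau> \<gamma> k t = \<gamma> (t - (real l - 1) * \<tau>) \<circ> (\<gamma> \<tau> ^^ (l - 1))"
proof -
  let ?P = "\<lambda>l. 1 \<le> l \<and> l \<le> k \<and> (real l - 1) * \<tau> \<le> t \<and> t \<le> real l * \<tau>"
  define q where "q = (LEAST l. ?P l)"
  have l: "?P l" using assms by simp
  have q: "?P q" unfolding q_def by (rule LeastI[of ?P, OF l])
  have le: "q \<le> l" unfolding q_def by (rule Least_le[of ?P, OF l])
  have "(real l - 1) * \<tau> \<le> real q * \<tau>" using l q by linarith
  hence "l \<le> q + 1" using assms(1) by (simp add: mult_le_cancel_right)
  then consider "l = q" | "l = q + 1" using le by linarith
  hence "\<gamma> (t - (real q - 1) * \<tau>) \<circ> (\<gamma> \<tau> ^^ (q - 1)) =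
      \<gamma> (t - (real l - 1) * \<tau>) \<circ> (\<gamma> \<tau> ^^ (l - 1))"
  proof cases
    case 2
    hence t: "t = real q * \<tau>" using l q by simp
    obtain r where r: "q = Suc r" using q by (cases q) auto
    show ?thesis using 2 t r assms(2) by (simp add: algebra_simps)
  qed simp
  thus ?thesis unfolding path_iterate_def Let_def q_def .
qed

section \<open>The Maslov index\<close>

definition annihilator :: "('x \<Rightarrow> 'x \<Rightarrow> complex) \<Rightarrow> 'x set \<Rightarrow> 'x set"
  where "annihilator \<Omega> S = {x. \<forall>y\<in>S. \<Omega> x y = 0}"

definition lagrangian ::
  "(complex \<Rightarrow> 'x::ab_group_add \<Rightarrow> 'x) \<Rightarrow> ('x \<Rightarrow> 'x \<Rightarrow> complex) \<Rightarrow> 'x set \<Rightarrow> bool"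
  where "lagrangian s \<Omega> L \<longleftrightarrow> module.subspace s L \<and> L = annihilator \<Omega> L"

definition chosen_inner ::
  "(complex \<Rightarrow> 'x::ab_group_add \<Rightarrow> 'x) \<Rightarrow> 'x \<Rightarrow> 'x \<Rightarrow> complex"
  where "chosen_inner s = (SOME g. inner_product s g)"

definition chosen_J ::
  "(complex \<Rightarrow> 'x::ab_group_add \<Rightarrow> 'x) \<Rightarrow> ('x \<Rightarrow> 'x \<Rightarrow> complex) \<Rightarrow> 'x \<Rightarrow> 'x"
  where "chosen_J s \<Omega> = (SOME J. Vector_Spaces.linear s s J \<and> bij J \<and>
    (\<forall>x y. \<Omega> x y = chosen_inner s (J x) y))"

text \<open>Note the sign convention: \<open>X_minus\<close> belongs to the \<^emph>\<open>positive\<close> eigenvalues of \<open>iJ\<close>.\<close>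

definition X_minus ::
  "(complex \<Rightarrow> 'x::ab_group_add \<Rightarrow> 'x) \<Rightarrow> ('x \<Rightarrow> 'x \<Rightarrow> complex) \<Rightarrow> 'x set"
  where "X_minus s \<Omega> =
    module.span s {x. \<exists>a::real. a > 0 \<and> s \<i> (chosen_J s \<Omega> x) = s (complex_of_real a) x}"

definition X_plus ::
  "(complex \<Rightarrow> 'x::ab_group_add \<Rightarrow> 'x) \<Rightarrow> ('x \<Rightarrow> 'x \<Rightarrow> complex) \<Rightarrow> 'x set"
  where "X_plus s \<Omega> =
    module.span s {x. \<exists>a::real. a < 0 \<and> s \<i> (chosen_J s \<Omega> x) = s (complex_of_real a) x}"

text \<open>
  For a Lagrangian \<open>L\<close>, \<open>graph_map s \<Omega> L\<close> is the operator \<open>U\<close> from \<open>X_minus s \<Omega>\<close> to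
  \<open>X_plus s \<Omega>\<close> with \<open>L = {x + U x | x. x \<in> X_minus s \<Omega>}\<close>; only its values on \<open>X_minus s \<Omega>\<close>
  are meaningful. Likewise \<open>relative_map s \<Omega> L K\<close> is \<open>U_L (U_K)\<^sup>-\<^sup>1\<close> on \<open>X_plus s \<Omega>\<close>.
\<close>

definition graph_map ::
  "(complex \<Rightarrow> 'x::ab_group_add \<Rightarrow> 'x) \<Rightarrow> ('x \<Rightarrow> 'x \<Rightarrow> complex) \<Rightarrow> 'x set \<Rightarrow> 'x \<Rightarrow> 'x"
  where "graph_map s \<Omega> L x = (THE y. y \<in> X_plus s \<Omega> \<and> x + y \<in> L)"

definition relative_map ::
  "(complex \<Rightarrow> 'x::ab_group_add \<Rightarrow> 'x) \<Rightarrow> ('x \<Rightarrow> 'x \<Rightarrow> complex) \<Rightarrow> 'x set \<Rightarrow> 'x set \<Rightarrow> 'x \<Rightarrow> 'x"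
  where "relative_map s \<Omega> L K y =
    graph_map s \<Omega> L (inv_into (X_minus s \<Omega>) (graph_map s \<Omega> K) y)"

definition half_dim :: "(complex \<Rightarrow> 'x::ab_group_add \<Rightarrow> 'x) \<Rightarrow> nat"
  where "half_dim s = vector_space.dim s UNIV div 2"

text \<open>
  The continuous functions \<open>\<theta> 0, \<dots>, \<theta> (N - 1)\<close> are arguments of the eigenvalues,
  listed with multiplicity.
\<close>

definition eigen_angles ::
  "(complex \<Rightarrow> 'x::ab_group_add \<Rightarrow> 'x) \<Rightarrow> ('x \<Rightarrow> 'x \<Rightarrow> complex) \<Rightarrow> real \<Rightarrow> real \<Rightarrow>
   (real \<Rightarrow> 'x set) \<Rightarrow> (real \<Rightarrow> 'x set) \<Rightarrow> (nat \<Rightarrow> real \<Rightarrow> real) \<Rightarrow> bool"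
  where "eigen_angles s \<Omega> a b L K \<theta> \<longleftrightarrow>
    (\<forall>j<half_dim s. continuous_on {a..b} (\<theta> j)) \<and>
    (\<forall>t\<in>{a..b}. \<forall>z. card {j. j < half_dim s \<and> exp (\<i> * complex_of_real (\<theta> j t)) = z} =
       alg_mult s (X_plus s \<Omega>) (relative_map s \<Omega> (L t) (K t)) z)"

text \<open>Meaningful for a continuous path of pairs of Lagrangian subspaces.\<close>

definition Mas ::
  "(complex \<Rightarrow> 'x::ab_group_add \<Rightarrow> 'x) \<Rightarrow> ('x \<Rightarrow> 'x \<Rightarrow> complex) \<Rightarrow> real \<Rightarrow> real \<Rightarrow>
   (real \<Rightarrow> 'x set) \<Rightarrow> (real \<Rightarrow> 'x set) \<Rightarrow> int"
  where "Mas s \<Omega> a b L K =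
    (let \<theta> = (SOME \<theta>. eigen_angles s \<Omega> a b L K \<theta>)
     in \<Sum>j<half_dim s. \<lceil>\<theta> j b / (2 * pi)\<rceil> - \<lceil>\<theta> j a / (2 * pi)\<rceil>)"

section \<open>The Maslov-type index of a symplectic path\<close>

definition double_form ::
  "('v \<Rightarrow> 'v \<Rightarrow> complex) \<Rightarrow> 'v \<times> 'v \<Rightarrow> 'v \<times> 'v \<Rightarrow> complex"
  where "double_form \<omega> p q = - \<omega> (fst p) (fst q) + \<omega> (snd p) (snd q)"

definition Gr :: "('v \<Rightarrow> 'v) \<Rightarrow> ('v \<times> 'v) set"
  where "Gr A = {(x, A x) | x. True}"

text \<open>Sanity check: the paths entering \<open>i1\<close> are indeed paths of Lagrangian subspaces.\<close>

lemma lagrangian_Gr: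
  assumes "complex_symplectic_space s \<omega>" and A: "A \<in> Sp s \<omega>"
  shows "lagrangian (module_prod.scale s s) (double_form \<omega>) (Gr A)"
proof -
  interpret complex_symplectic_space s \<omega> by fact
  interpret vector_space_prod s s by unfold_locales
  from A interpret A: Vector_Spaces.linear s s A by (simp add: Sp_def)
  have pres: "\<omega> (A x) (A y) = \<omega> x y" and surj: "surj A" for x y
    using A by (auto simp: Sp_def bij_def)
  have nondeg: "x = 0" if "\<And>y. \<omega> x y = 0" for x
    using symplectic that unfolding symplectic_form_def by blast
  have diff: "\<omega> (x - x') y = \<omega> x y - \<omega> x' y" for x x' y
  proof -
    interpret l: Vector_Spaces.linear s "(*)" "\<lambda>x. \<omega> x y"
      using symplectic unfolding symplectic_form_def sesquilinear_def by blast
    show ?thesis by (rule l.diff)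
  qed
  have "p.subspace (Gr A)"
    unfolding p.subspace_def Gr_def
    by (auto simp: zero_prod_def scale_prod A.zero A.add A.scale)
  moreover have "Gr A = annihilator (double_form \<omega>) (Gr A)"
  proof (intro equalityI subsetI)
    fix p assume "p \<in> Gr A"
    thus "p \<in> annihilator (double_form \<omega>) (Gr A)"
      by (auto simp: Gr_def annihilator_def double_form_def pres)
  next
    fix p assume p: "p \<in> annihilator (double_form \<omega>) (Gr A)"
    have eq: "\<omega> (snd p) (A a) = \<omega> (A (fst p)) (A a)" for a
      using p by (force simp: Gr_def annihilator_def double_form_def pres)
    have "\<omega> (snd p - A (fst p)) y = 0" for y
    proof -
      obtain a where "y = A a" using surj by (metis surjD)
      thus ?thesis using eq[of a] by (simp add: diff)
    qed
    hence "snd p = A (fst p)" using nondeg[of "snd p - A (fst p)"] by simp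
    thus "p \<in> Gr A" by (cases p) (auto simp: Gr_def)
  qed
  ultimately show ?thesis unfolding lagrangian_def by blast
qed

definition i1 ::
  "(complex \<Rightarrow> 'v::ab_group_add \<Rightarrow> 'v) \<Rightarrow> ('v \<Rightarrow> 'v \<Rightarrow> complex) \<Rightarrow> real \<Rightarrow> (real \<Rightarrow> 'v \<Rightarrow> 'v) \<Rightarrow> int"
  where "i1 s \<omega> \<tau> \<gamma> =
    Mas (module_prod.scale s s) (double_form \<omega>) 0 \<tau> (\<lambda>t. Gr (\<gamma> t)) (\<lambda>_. Gr id)"

end

(* The defect E(theta/2pi) - theta/2pi depends only on e^(i theta). For
   a path of unitary operators, the sum of the jumps of E(theta_j/2pi) is the change of arg det / 2pi
   plus the change of the total defect F of the operator. As arg det is additive, the index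
   difference of the theorem becomes -T, where T = F(P) + F(Q) - F(PQ) is the triple defect of the
   three graphs of M^(k1+k2), M^k2 and I, with P and Q the relative unitary operators of the first and
   the last two. The triple defect is at least the dimension of any space on which the Kashiwara-type
   form of the three Lagrangians is semidefinite without degenerating: interpolate linearly between
   two of them and count the eigenvalues that leave 1 in the positive direction.
   Such a space is V x K, where V is the larger of the sums of the generalized eigenspaces of M for
   eigenvalues inside and outside the unit circle (isotropic, of dimension at least (m - e(M))/2), and
   K is a complement of ker(M^gcd - I) in ker(M^(k1+k2) - I). This gives the upper bound. The
   lower bound is the same estimate for the reversed triple, because F(P) + F(P^-1) is the number of
   eigenvalues of P different from 1. *)
theory Submission
  imports Defs "Jordan_Normal_Form.Determinant" "HOL-Computational_Algebra.Fundamental_Theorem_Algebra"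
begin

section \<open>Operators on finite-dimensional complex spaces\<close>

text \<open>The defect jumps when an eigenvalue passes 1, and one principle controls this: along a
  path of unitaries whose eigenspace for 1 has constant dimension there is no net crossing, so the
  change of arg det is exactly the loss of total defect. The reduction of the index to
  \<open>T\<close> and the estimate of \<open>T\<close> both rest on finding such paths. In the
  reduction it is the pair of Gr(\<open>\<beta> A\<close>) and Gr(\<open>\<beta>\<close>), where
  \<open>\<beta>\<close> is the iteration of order \<open>k2\<close> and \<open>A\<close> is the
  power \<open>k1\<close> of the end map: they meet in a space isomorphic to
  ker(\<open>A - I\<close>) at every time. The linear interpolation needs two of the Lagrangians to
  be transversal to the third, which graphs of powers need not be, and it needs a strictly positive
  form, while the form vanishes identically on the space used here. A small rotation of the third
  Lagrangian removes both obstacles at once: it gives transversality, keeps the triple defect, and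
  supplies the missing positivity. The two definite parts of the doubled space have the dimension of
  the base space, so every unitary operator is transported to the base space with one fixed inner
  product.\<close>

context finite_dimensional_vector_space begin

lemma dim_UN_le:
  assumes "finite I"
  shows "dim (\<Union>i\<in>I. A i) \<le> (\<Sum>i\<in>I. dim (A i))"
proof -
  have "\<exists>B. B \<subseteq> A i \<and> independent B \<and> A i \<subseteq> span B \<and> card B = dim (A i)" for i
    using basis_exists[of "A i"] by metis
  then obtain B where B: "\<And>i. A i \<subseteq> span (B i)" "\<And>i. independent (B i)" "\<And>i. card (B i) = dim (A i)"
    by metis
  have "(\<Union>i\<in>I. A i) \<subseteq> span (\<Union>i\<in>I. B i)"
    using B(1) span_mono[of "B _" "\<Union>i\<in>I. B i"] by blast
  hence "dim (\<Union>i\<in>I. A i) \<le> card (\<Union>i\<in>I. B i)"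
    using assms B(2) finiteI_independent by (intro dim_le_card) auto
  also have "\<dots> \<le> (\<Sum>i\<in>I. card (B i))" by (rule card_UN_le[OF assms])
  finally show ?thesis using B(3) by simp
qed

lemma dim_Un_le: "dim (A \<union> B) \<le> dim A + dim B"
  using dim_UN_le[of "{True, False}" "\<lambda>b. if b then A else B"] by (simp add: Un_commute)

lemma inj_on_subspace_imp_surj:
  assumes f: "Vector_Spaces.linear scale scale f" and Y: "subspace Y" "f ` Y \<subseteq> Y"
    and inj: "\<And>x. x \<in> Y \<Longrightarrow> f x = 0 \<Longrightarrow> x = 0"
  shows "f ` Y = Y"
proof -
  interpret f: Vector_Spaces.linear scale scale f by fact
  interpret pr: finite_dimensional_vector_space_pair_1 scale Basis scale by unfold_locales
  have "inj_on f (span Y)"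
    using f.inj_on_iff_eq_0[of "span Y"] inj Y(1) by (simp add: span_eq_iff[THEN iffD2])
  hence "dim (f ` Y) = dim Y" by (rule pr.dim_image_eq[OF f])
  thus ?thesis using subspace_dim_equal[of "f ` Y" Y] f.subspace_image[OF Y(1)] Y by simp
qed

end

section \<open>Generalized eigenspaces of one operator\<close>

locale complex_endo = finite_dimensional_vector_space scale Basis
  for scale :: "complex \<Rightarrow> 'v::ab_group_add \<Rightarrow> 'v" and Basis :: "'v set" +
  fixes T :: "'v \<Rightarrow> 'v"
  assumes linear_T: "Vector_Spaces.linear scale scale T"
begin

sublocale T: Vector_Spaces.linear scale scale T by (rule linear_T)

definition shift :: "complex \<Rightarrow> 'v \<Rightarrow> 'v" where "shift w x = T x - scale w x"

text \<open>\<open>kill ws\<close> is the product of the factors \<open>T - w\<close> over the list.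
  A list of roots stands for a polynomial; over the complex numbers nothing is lost by this, and
  statements about annihilating polynomials become inductions over one factor at a time.\<close>

primrec kill :: "complex list \<Rightarrow> 'v \<Rightarrow> 'v" where
  "kill [] x = x"
| "kill (w # ws) x = kill ws (shift w x)"

text \<open>The sum of the generalized eigenspaces over the eigenvalues with property
  \<open>C\<close>, described by annihilating lists so that no direct sum has to be formed. It
  serves both for a single eigenvalue and for the inside and the outside of the unit circle.\<close>

definition gen_eig :: "(complex \<Rightarrow> bool) \<Rightarrow> 'v set" where
  "gen_eig C = {x. \<exists>ws. (\<forall>w\<in>set ws. C w) \<and> kill ws x = 0}"

lemma linear_shift: "Vector_Spaces.linear scale scale (shift w)"
  unfolding Vector_Spaces.linear_iff shift_def using vector_space_axioms
  by (auto simp: T.add T.scale algebra_simps)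

sublocale shift: Vector_Spaces.linear scale scale "shift w" for w by (rule linear_shift)

lemma shift_commute: "shift a (shift b x) = shift b (shift a x)"
  unfolding shift_def by (simp add: T.diff T.scale algebra_simps)

lemma shift_T: "shift a (T x) = T (shift a x)"
  unfolding shift_def by (simp add: T.diff T.scale algebra_simps)

lemma kill_shift: "kill ws (shift a x) = shift a (kill ws x)"
  by (induction ws arbitrary: x) (simp, metis kill.simps(2) shift_commute)

lemma kill_T: "kill ws (T x) = T (kill ws x)"
  by (induction ws arbitrary: x) (simp_all add: shift_T)

lemma kill_0 [simp]: "kill ws 0 = 0"
  by (induction ws) (simp_all add: shift.zero)

lemma kill_add: "kill ws (x + y) = kill ws x + kill ws y"
  by (induction ws arbitrary: x y) (simp_all add: shift.add)

lemma kill_scale: "kill ws (scale c x) = scale c (kill ws x)"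
  by (induction ws arbitrary: x) (simp_all add: shift.scale)

lemma kill_append: "kill (ws @ vs) x = kill vs (kill ws x)"
  by (induction ws arbitrary: x) simp_all

lemma kill_commute: "kill ws (kill vs x) = kill vs (kill ws x)"
  by (induction vs arbitrary: x) (simp_all add: kill_shift)

lemma kill_replicate: "kill (replicate n w) x = (shift w ^^ n) x"
  by (induction n arbitrary: x) (simp_all add: funpow_swap1)

lemma kill_eigen: "T e = scale z e \<Longrightarrow> kill ws e = scale (\<Prod>w\<leftarrow>ws. z - w) e"
proof (induction ws)
  case (Cons w ws)
  have "shift w e = scale (z - w) e" using Cons.prems by (simp add: shift_def algebra_simps)
  thus ?case using Cons by (simp add: kill_scale)
qed simp

lemma gen_eig_subspace: "subspace (gen_eig C)"
proof (rule subspaceI)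
  show "0 \<in> gen_eig C" unfolding gen_eig_def by (auto intro: exI[of _ "[]"])
  fix x y assume "x \<in> gen_eig C" "y \<in> gen_eig C"
  then obtain ws vs where h: "\<forall>w\<in>set ws. C w" "\<forall>w\<in>set vs. C w" "kill ws x = 0" "kill vs y = 0"
    by (auto simp: gen_eig_def)
  hence "kill (ws @ vs) (x + y) = 0" by (simp add: kill_append kill_add kill_commute[of vs ws])
  thus "x + y \<in> gen_eig C" using h by (auto simp: gen_eig_def intro!: exI[of _ "ws @ vs"])
next
  fix c x assume "x \<in> gen_eig C"
  then obtain ws where "\<forall>w\<in>set ws. C w" "kill ws x = 0" by (auto simp: gen_eig_def)
  hence "(\<forall>w\<in>set ws. C w) \<and> kill ws (scale c x) = 0" by (simp add: kill_scale)
  thus "scale c x \<in> gen_eig C" unfolding gen_eig_def by blast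
qed

lemma gen_eig_T: "x \<in> gen_eig C \<Longrightarrow> T x \<in> gen_eig C"
  unfolding gen_eig_def mem_Collect_eq kill_T by (metis T.zero)

lemma gen_eig_funpow: "x \<in> gen_eig C \<Longrightarrow> (T ^^ k) x \<in> gen_eig C"
  by (induction k) (auto intro: gen_eig_T)

lemma gen_eig_shiftD: "shift w x \<in> gen_eig C \<Longrightarrow> C w \<Longrightarrow> x \<in> gen_eig C"
proof -
  assume "shift w x \<in> gen_eig C" "C w"
  then obtain ws where "\<forall>w\<in>set ws. C w" "kill (w # ws) x = 0" by (auto simp: gen_eig_def)
  thus "x \<in> gen_eig C" using \<open>C w\<close> unfolding gen_eig_def by (auto intro!: exI[of _ "w # ws"])
qed

lemma gen_eig_mono: "(\<And>z. C z \<Longrightarrow> D z) \<Longrightarrow> gen_eig C \<subseteq> gen_eig D"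
  unfolding gen_eig_def by blast

text \<open>On an eigenvector \<open>kill ws\<close> is multiplication by the product of the numbers
  \<open>z - w\<close>, so it vanishes only if \<open>z\<close> occurs in the list.\<close>

lemma gen_eig_eigen:
  assumes "e \<noteq> 0" "T e = scale z e" "e \<in> gen_eig C"
  shows "C z"
proof -
  obtain ws where "\<forall>w\<in>set ws. C w" "kill ws e = 0" using assms(3) by (auto simp: gen_eig_def)
  moreover from this have "(\<Prod>w\<leftarrow>ws. z - w) = 0" using assms by (simp add: kill_eigen)
  ultimately show ?thesis by (auto simp: prod_list_zero_iff)
qed

section \<open>Polynomials in the operator and the existence of eigenvectors\<close>

definition opoly :: "complex poly \<Rightarrow> 'v \<Rightarrow> 'v" where
  "opoly p x = (\<Sum>i\<le>degree p. scale (coeff p i) ((T ^^ i) x))"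

lemma opoly_eq: "degree p \<le> N \<Longrightarrow> opoly p x = (\<Sum>i\<le>N. scale (coeff p i) ((T ^^ i) x))"
  unfolding opoly_def by (rule sum.mono_neutral_left) (auto simp: coeff_eq_0)

lemma opoly_add: "opoly (p + q) x = opoly p x + opoly q x"
proof -
  let ?N = "max (degree p) (degree q)"
  show ?thesis using degree_add_le_max[of p q]
    by (simp add: opoly_eq[of _ ?N] scale_left_distrib sum.distrib)
qed

lemma opoly_smult: "opoly (Polynomial.smult c p) x = scale c (opoly p x)"
  using degree_smult_le[of c p] by (simp add: opoly_eq[of _ "degree p"] scale_sum_right)

lemma funpow_T_linear:
  "(T ^^ i) (x + y) = (T ^^ i) x + (T ^^ i) y" "(T ^^ i) (scale c x) = scale c ((T ^^ i) x)"
  "(T ^^ i) (x - y) = (T ^^ i) x - (T ^^ i) y"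
  by (induction i) (simp_all add: T.add T.scale T.diff)

lemma opoly_monom: "opoly (monom 1 n) x = (T ^^ n) x"
proof -
  have "opoly (monom 1 n) x = (\<Sum>k\<le>n. if k = n then (T ^^ n) x else 0)"
    unfolding opoly_def by (intro sum.cong) (auto simp: degree_monom_eq coeff_monom)
  thus ?thesis by simp
qed

lemma opoly_linear_factor: "opoly ([:- z, 1:] * q) x = opoly q (shift z x)"
proof -
  have e: "[:- z, 1:] * q = Polynomial.smult (- z) q + pCons 0 q" by simp
  have "opoly (pCons 0 q) x = (\<Sum>i\<le>Suc (degree q). scale (coeff (pCons 0 q) i) ((T ^^ i) x))"
    by (rule opoly_eq) (simp add: degree_pCons_le)
  also have "\<dots> = (\<Sum>i\<le>degree q. scale (coeff q i) ((T ^^ i) (T x)))"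
    by (subst sum.atMost_Suc_shift) (simp add: funpow_swap1)
  finally have "opoly (pCons 0 q) x = (\<Sum>i\<le>degree q. scale (coeff q i) ((T ^^ i) (T x)))" .
  thus ?thesis unfolding e opoly_add opoly_smult
    by (simp add: opoly_def shift_def funpow_T_linear scale_right_diff_distrib sum_subtractf
        scale_sum_right scale_left_commute sum_negf mult.commute)
qed

text \<open>The fundamental theorem of algebra splits off one root at a time and turns a polynomial
  relation into a list of factors.\<close>

lemma kill_of_opoly:
  assumes "p \<noteq> 0" "opoly p x = 0" shows "\<exists>ws. kill ws x = 0"
  using assms
proof (induction "degree p" arbitrary: p x)
  case 0
  then obtain c where "p = [:c:]" using degree_eq_zeroE by metis
  thus ?case using 0 by (intro exI[of _ "[]"]) (simp add: opoly_def)
next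
  case (Suc n)
  then obtain z where "poly p z = 0"
    using fundamental_theorem_of_algebra[of p] constant_degree[of p] by auto
  then obtain q where p: "p = [:- z, 1:] * q" by (auto simp: poly_eq_0_iff_dvd elim: dvdE)
  have q: "q \<noteq> 0" using Suc p by auto
  hence "degree p = Suc (degree q)" unfolding p by (subst degree_mult_eq) auto
  then obtain ws where "kill ws (shift z x) = 0"
    using Suc.hyps(1)[of q "shift z x"] Suc.hyps(2) Suc.prems q
    by (metis Suc_inject opoly_linear_factor p)
  thus ?case by (intro exI[of _ "z # ws"]) simp
qed

text \<open>The vanishing of the coefficients from \<open>n\<close> on is what later keeps
  \<open>monom 1 n\<close> minus \<open>p\<close> different from zero.\<close>

lemma orbit_span_opoly:
  assumes "y \<in> span ((\<lambda>i. (T ^^ i) x) ` {..<n})"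
  shows "\<exists>p. y = opoly p x \<and> (\<forall>i\<ge>n. coeff p i = 0)"
proof -
  let ?S = "{opoly p x | p. \<forall>i\<ge>n. coeff p i = 0}"
  have "subspace ?S"
  proof (rule subspaceI)
    have "opoly 0 x = 0" by (simp add: opoly_def)
    thus "0 \<in> ?S" by force
    fix u v assume "u \<in> ?S" "v \<in> ?S"
    then obtain p q where "u = opoly p x" "v = opoly q x" "\<forall>i\<ge>n. coeff p i = 0" "\<forall>i\<ge>n. coeff q i = 0"
      by auto
    thus "u + v \<in> ?S" by (auto simp: opoly_add intro!: exI[of _ "p + q"])
  next
    fix c u assume "u \<in> ?S"
    then obtain p where "u = opoly p x" "\<forall>i\<ge>n. coeff p i = 0" by auto
    thus "scale c u \<in> ?S" by (auto simp: opoly_smult intro!: exI[of _ "Polynomial.smult c p"])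
  qed
  moreover have "(\<lambda>i. (T ^^ i) x) ` {..<n} \<subseteq> ?S"
  proof clarify
    fix i assume "i < n"
    thus "\<exists>p. (T ^^ i) x = opoly p x \<and> (\<forall>i\<ge>n. coeff p i = 0)"
      using \<open>i < n\<close> by (intro exI[of _ "monom 1 i"] conjI allI impI) (simp_all add: opoly_monom)
  qed
  ultimately have "span ((\<lambda>i. (T ^^ i) x) ` {..<n}) \<subseteq> ?S" by (rule span_minimal[rotated])
  thus ?thesis using assms by auto
qed

text \<open>An orbit cannot stay linearly independent beyond the dimension, and a dependence of
  \<open>(T ^^ n) x\<close> on its predecessors is a monic polynomial relation.\<close>

lemma ex_kill: "\<exists>ws. kill ws x = 0"
proof -
  let ?O = "\<lambda>n. (\<lambda>i. (T ^^ i) x) ` {..<n}"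
  have "\<exists>n. (T ^^ n) x \<in> span (?O n)"
  proof (rule ccontr)
    assume "\<nexists>n. (T ^^ n) x \<in> span (?O n)"
    hence h: "(T ^^ n) x \<notin> span (?O n)" for n by blast
    have O: "independent (?O n) \<and> card (?O n) = n" for n
    proof (induction n)
      case 0
      show ?case by (simp add: independent_empty)
    next
      case (Suc n)
      have e: "?O (Suc n) = insert ((T ^^ n) x) (?O n)" by (simp add: lessThan_Suc)
      have "(T ^^ n) x \<notin> ?O n" using h[of n] by (rule contrapos_nn) (rule span_base)
      hence "card (insert ((T ^^ n) x) (?O n)) = Suc (card (?O n))"
        by (rule card_insert_disjoint[rotated]) simp
      moreover have "independent (insert ((T ^^ n) x) (?O n))"
        by (rule independent_insertI[OF h conjunct1[OF Suc.IH]])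
      ultimately show ?case unfolding e using Suc.IH by simp
    qed
    have "card (?O (Suc (dim UNIV))) \<le> dim (UNIV::'v set)"
      by (rule independent_card_le_dim[OF subset_UNIV conjunct1[OF O]])
    hence "Suc (dim (UNIV::'v set)) \<le> dim (UNIV::'v set)" unfolding conjunct2[OF O] .
    thus False by (rule Suc_n_not_le_n[THEN notE])
  qed
  then obtain n where "(T ^^ n) x \<in> span (?O n)" by blast
  then obtain p where p: "(T ^^ n) x = opoly p x" "\<forall>i\<ge>n. coeff p i = 0" using orbit_span_opoly by blast
  have "opoly (monom 1 n + Polynomial.smult (-1) p) x = 0" unfolding opoly_add opoly_smult opoly_monom p(1) by simp
  moreover have "coeff (monom 1 n + Polynomial.smult (-1) p) n = 1" using p(2) by simp
  hence "monom 1 n + Polynomial.smult (-1) p \<noteq> 0" by (metis coeff_0 zero_neq_one)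
  ultimately show ?thesis using kill_of_opoly by blast
qed

text \<open>Apply the factors of an annihilating list one by one: the last nonzero vector obtained
  is an eigenvector, and it stays in the invariant subspace.\<close>

lemma ex_eigenvector:
  assumes Y: "subspace Y" "T ` Y \<subseteq> Y" and x: "x \<in> Y" "x \<noteq> 0"
  shows "\<exists>e\<in>Y. \<exists>z. e \<noteq> 0 \<and> T e = scale z e"
proof -
  obtain ws where "kill ws x = 0" using ex_kill by blast
  thus ?thesis using x
  proof (induction ws arbitrary: x)
    case (Cons w ws)
    show ?case
    proof (cases "shift w x = 0")
      case True
      hence "T x = scale w x" by (simp add: shift_def)
      thus ?thesis using Cons.prems(2,3) by blast
    next
      case False
      have "shift w x \<in> Y" unfolding shift_def using Cons.prems(2) Y
        by (auto intro!: subspace_diff subspace_scale)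
      moreover have "kill ws (shift w x) = 0" using Cons.prems(1) by simp
      ultimately show ?thesis using Cons.IH False by blast
    qed
  qed simp
qed

section \<open>The generalized eigenspaces span the whole space\<close>

lemma shift_surj_on:
  assumes Y: "subspace Y" "T ` Y \<subseteq> Y" and ne: "\<And>e. e \<in> Y \<Longrightarrow> T e = scale w e \<Longrightarrow> e = 0"
  shows "shift w ` Y = Y"
proof (rule inj_on_subspace_imp_surj[OF linear_shift Y(1)])
  show "shift w ` Y \<subseteq> Y" unfolding shift_def using Y by (auto intro!: subspace_diff subspace_scale)
  fix x assume "x \<in> Y" "shift w x = 0"
  thus "x = 0" using ne[of x] by (simp add: shift_def)
qed

text \<open>The equation \<open>shift w y = v\<close> can be solved inside the span up to an error
  in the generalized eigenspace of \<open>w\<close>: on the generalized eigenspace of another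
  \<open>z\<close> the shift is onto, and on that of \<open>w\<close> one takes
  \<open>y = 0\<close>. For \<open>v = shift w x\<close> the difference \<open>x - y\<close> is then
  killed by one more factor, so it belongs to the generalized eigenspace of
  \<open>w\<close>.\<close>

lemma span_gen_eig_shiftD:
  assumes "w \<in> W" "shift w x \<in> span (\<Union>z\<in>W. gen_eig (\<lambda>u. u = z))" (is "_ \<in> ?S")
  shows "x \<in> ?S"
proof -
  have "\<exists>y\<in>?S. v - shift w y \<in> gen_eig (\<lambda>u. u = w)" if "v \<in> ?S" for v
    using that
  proof (induction rule: span_induct_alt)
    case base
    show ?case by (rule bexI[of _ 0]) (auto simp: shift.zero subspace_0[OF gen_eig_subspace] span_zero)
  next
    case (step c g v)
    then obtain y where y: "y \<in> ?S" "v - shift w y \<in> gen_eig (\<lambda>u. u = w)" by blast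
    from step obtain z where z: "z \<in> W" "g \<in> gen_eig (\<lambda>u. u = z)" by blast
    have "\<exists>h\<in>?S. g - shift w h \<in> gen_eig (\<lambda>u. u = w)"
    proof (cases "z = w")
      case True
      thus ?thesis using z by (intro bexI[of _ 0]) (auto simp: shift.zero span_zero)
    next
      case False
      have "shift w ` gen_eig (\<lambda>u. u = z) = gen_eig (\<lambda>u. u = z)"
        using False gen_eig_eigen[of _ w "\<lambda>u. u = z"]
        by (intro shift_surj_on gen_eig_subspace) (auto intro: gen_eig_T)
      then obtain h where "h \<in> gen_eig (\<lambda>u. u = z)" "g = shift w h" using z by blast
      thus ?thesis using z
        by (intro bexI[of _ h]) (auto simp: subspace_0[OF gen_eig_subspace] intro!: span_base)
    qed
    then obtain h where h: "h \<in> ?S" "g - shift w h \<in> gen_eig (\<lambda>u. u = w)" by blast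
    have "scale c g + v - shift w (scale c h + y)
        = scale c (g - shift w h) + (v - shift w y)"
      by (simp add: shift.add shift.scale scale_right_diff_distrib)
    moreover have "scale c (g - shift w h) + (v - shift w y) \<in> gen_eig (\<lambda>u. u = w)"
      by (intro subspace_add[OF gen_eig_subspace] subspace_scale[OF gen_eig_subspace] h y)
    moreover have "scale c h + y \<in> ?S" by (intro span_add span_scale h y)
    ultimately show ?case by metis
  qed
  then obtain y where y: "y \<in> ?S" "shift w x - shift w y \<in> gen_eig (\<lambda>u. u = w)" using assms by blast
  hence "shift w (x - y) \<in> gen_eig (\<lambda>u. u = w)" by (simp add: shift.diff)
  hence "x - y \<in> gen_eig (\<lambda>u. u = w)" by (rule gen_eig_shiftD) simp
  hence "x - y \<in> ?S" using assms(1) by (intro span_base) blast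
  from span_add[OF this y(1)] show ?thesis by simp
qed

lemma kill_span: "kill ws x = 0 \<Longrightarrow> set ws \<subseteq> W \<Longrightarrow> x \<in> span (\<Union>z\<in>W. gen_eig (\<lambda>u. u = z))"
  by (induction ws arbitrary: x) (auto simp: span_zero intro: span_gen_eig_shiftD)

text \<open>Lists annihilating the finitely many basis vectors can be concatenated because the
  factors commute.\<close>

lemma ex_kill_all: "\<exists>ws. \<forall>x. kill ws x = 0"
proof -
  have "\<exists>ws. \<forall>x\<in>B. kill ws x = 0" if "finite B" for B
    using that
  proof (induction B)
    case (insert b B)
    then obtain ws where ws: "\<forall>x\<in>B. kill ws x = 0" by blast
    obtain vs where "kill vs b = 0" using ex_kill by blast
    moreover have "kill ws (kill vs x) = 0" if "x \<in> B" for x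
      using ws that by (subst kill_commute) simp
    ultimately show ?case using ws
      by (intro exI[of _ "vs @ ws"]) (auto simp: kill_append)
  qed simp
  then obtain ws where ws: "\<forall>x\<in>Basis. kill ws x = 0" using finite_Basis by blast
  have "kill ws x = 0" if "x \<in> span Basis" for x
    using that ws by (induction rule: span_induct_alt) (auto simp: kill_add kill_scale)
  thus ?thesis using span_Basis by auto
qed

lemma finite_eigenvalues: "finite {z. \<exists>v. v \<noteq> 0 \<and> T v = scale z v}"
proof -
  obtain ws where ws: "\<And>x. kill ws x = 0" using ex_kill_all by blast
  have "{z. \<exists>v. v \<noteq> 0 \<and> T v = scale z v} \<subseteq> set ws"
  proof clarify
    fix z v assume v: "v \<noteq> 0" "T v = scale z v"
    have "scale (\<Prod>w\<leftarrow>ws. z - w) v = 0" using kill_eigen[OF v(2), of ws] ws by simp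
    thus "z \<in> set ws" using v by (auto simp: prod_list_zero_iff)
  qed
  thus ?thesis by (rule finite_subset) simp
qed

lemma gen_eig_single: "gen_eig (\<lambda>u. u = z) = {y. \<exists>n. (shift z ^^ n) y = 0}"
proof -
  have "kill ws x = (shift z ^^ length ws) x" if "\<forall>w\<in>set ws. w = z" for ws x
    using that kill_replicate[of "length ws" z x] by (metis replicate_length_same)
  hence "x \<in> gen_eig (\<lambda>u. u = z) \<longleftrightarrow> (\<exists>n. (shift z ^^ n) x = 0)" for x
    unfolding gen_eig_def mem_Collect_eq by (metis kill_replicate in_set_replicate)
  thus ?thesis by blast
qed

lemma dim_UNIV_le_gen_eig:
  "dim (UNIV::'v set) \<le> dim (gen_eig (\<lambda>z. cmod z < 1)) + dim (gen_eig (\<lambda>z. cmod z > 1))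
     + elliptic_height scale T"
proof -
  let ?E = "{z. cmod z = 1 \<and> (\<exists>v. v \<noteq> 0 \<and> T v = scale z v)}"
  let ?U = "gen_eig (\<lambda>z. cmod z < 1) \<union> gen_eig (\<lambda>z. cmod z > 1) \<union> (\<Union>z\<in>?E. gen_eig (\<lambda>u. u = z))"
  have fin: "finite ?E" by (rule finite_subset[OF _ finite_eigenvalues]) auto
  obtain ws where ws: "\<And>x. kill ws x = 0" using ex_kill_all by blast
  have alg: "alg_mult scale UNIV T z = dim (gen_eig (\<lambda>u. u = z))" for z
    unfolding alg_mult_def gen_eig_single shift_def[abs_def] by simp
  have sub: "gen_eig (\<lambda>u. u = z) \<subseteq> ?U" for z
  proof (cases "cmod z = 1 \<and> z \<notin> ?E")
    \<comment> \<open>A point of the circle that is no eigenvalue has zero generalized eigenspace: a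
      nonzero invariant subspace contains an eigenvector, whose eigenvalue could only be
      \<open>z\<close>.\<close>
    case True
    have "x = 0" if x: "x \<in> gen_eig (\<lambda>u. u = z)" for x
    proof (rule ccontr)
      assume "x \<noteq> 0"
      moreover have "T ` gen_eig (\<lambda>u. u = z) \<subseteq> gen_eig (\<lambda>u. u = z)" using gen_eig_T by blast
      ultimately obtain e v where e: "e \<in> gen_eig (\<lambda>u. u = z)" "e \<noteq> 0" "T e = scale v e"
        using ex_eigenvector[OF gen_eig_subspace _ x] by blast
      have "v = z" by (rule gen_eig_eigen[OF e(2,3,1)])
      thus False using True e(2,3) by blast
    qed
    hence "gen_eig (\<lambda>u. u = z) \<subseteq> gen_eig (\<lambda>z. cmod z < 1)"
      using subspace_0[OF gen_eig_subspace] by (intro subsetI) metis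
    thus ?thesis by (intro le_supI1)
  next
    case False
    have "cmod z < 1 \<or> cmod z > 1 \<or> z \<in> ?E"
    proof (cases "cmod z = 1")
      case True with False show ?thesis by blast
    qed linarith
    then consider "cmod z < 1" | "cmod z > 1" | "z \<in> ?E" by blast
    thus ?thesis
    proof cases
      case 1
      hence "gen_eig (\<lambda>u. u = z) \<subseteq> gen_eig (\<lambda>z. cmod z < 1)" by (intro gen_eig_mono) simp
      thus ?thesis by (intro le_supI1)
    next
      case 2
      hence "gen_eig (\<lambda>u. u = z) \<subseteq> gen_eig (\<lambda>z. cmod z > 1)" by (intro gen_eig_mono) simp
      thus ?thesis by (intro le_supI1 le_supI2[of _ "gen_eig (\<lambda>z. cmod z > 1)"])
    next
      case 3
      thus ?thesis by (intro le_supI2 UN_upper)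
    qed
  qed
  have "(\<Union>z\<in>set ws. gen_eig (\<lambda>u. u = z)) \<subseteq> ?U" by (rule UN_least) (rule sub)
  hence "span (\<Union>z\<in>set ws. gen_eig (\<lambda>u. u = z)) \<subseteq> span ?U" by (rule span_mono)
  hence "UNIV \<subseteq> span ?U" using kill_span[OF ws order_refl] by (intro subsetI) (rule subsetD)
  hence "dim (UNIV::'v set) \<le> dim ?U" by (rule dim_mono)
  also have "\<dots> \<le> dim (gen_eig (\<lambda>z. cmod z < 1)) + dim (gen_eig (\<lambda>z. cmod z > 1))
      + dim (\<Union>z\<in>?E. gen_eig (\<lambda>u. u = z))"
    by (rule order_trans[OF dim_Un_le add_mono[OF dim_Un_le order_refl]])
  also have "dim (\<Union>z\<in>?E. gen_eig (\<lambda>u. u = z)) \<le> (\<Sum>z\<in>?E. dim (gen_eig (\<lambda>u. u = z)))"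
    by (rule dim_UN_le[OF fin])
  also have "\<dots> = elliptic_height scale T" unfolding elliptic_height_def alg ..
  finally show ?thesis by simp
qed

end

section \<open>Continuous angles of a moving multiset on the unit circle\<close>

lemma cis_eq_cis_iff: "cis a = cis b \<longleftrightarrow> (\<exists>n::int. a = b + 2 * pi * n)"
  using sin_cos_eq_iff[of a b] by (auto simp: complex_eq_iff)

text \<open>A monic polynomial is determined by its values and determines its roots with
  multiplicity. Through this lemma, continuity of a characteristic polynomial replaces continuity of
  individual eigenvalues, which have no canonical order.\<close>

lemma image_mset_eq_of_prod_eq:
  fixes a b :: "nat \<Rightarrow> complex"
  assumes "\<And>z. (\<Prod>j<m. z - a j) = (\<Prod>j<m. z - b j)"
  shows "image_mset a (mset_set {..<m}) = image_mset b (mset_set {..<m})"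
proof -
  have roots: "proots (\<Prod>j<m. [:- c j, 1:]) = image_mset c (mset_set {..<m})" for c :: "nat \<Rightarrow> complex"
    by (subst proots_prod) (auto simp: sum_unfold_sum_mset)
  have "poly (\<Prod>j<m. [:- a j, 1:]) z = poly (\<Prod>j<m. [:- b j, 1:]) z" for z
    using assms[of z] by (simp add: poly_prod)
  hence "(\<Prod>j<m. [:- a j, 1:]) = (\<Prod>j<m. [:- b j, 1:])" by (intro poly_ext) blast
  thus ?thesis using roots by metis
qed

lemma finite_family_convergent_subseq:
  fixes X :: "nat \<Rightarrow> nat \<Rightarrow> real"
  assumes "\<And>n j. j < m \<Longrightarrow> X n j \<in> {lo..hi}"
  shows "\<exists>r::nat \<Rightarrow> nat. strict_mono r \<and> (\<forall>j<m. \<exists>l. (\<lambda>n. X (r n) j) \<longlonglongrightarrow> l)"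
  using assms
proof (induction m)
  case 0
  show ?case by (intro exI[of _ id]) (simp add: strict_mono_def)
next
  case (Suc m)
  then obtain r :: "nat \<Rightarrow> nat" where r: "strict_mono r" "\<forall>j<m. \<exists>l. (\<lambda>n. X (r n) j) \<longlonglongrightarrow> l"
    by (meson less_SucI)
  have "\<forall>n. X (r n) m \<in> {lo..hi}" using Suc.prems by simp
  then obtain l and q :: "nat \<Rightarrow> nat" where q: "strict_mono q" "((\<lambda>n. X (r n) m) \<circ> q) \<longlonglongrightarrow> l"
    using compact_Icc[of lo hi] unfolding compact_def by metis
  have "\<exists>l. (\<lambda>n. X (r (q n)) j) \<longlonglongrightarrow> l" if "j < Suc m" for j
  proof (cases "j = m")
    case True
    thus ?thesis using q(2) by (auto simp: o_def)
  next
    case False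
    with that r(2) obtain l where "(\<lambda>n. X (r n) j) \<longlonglongrightarrow> l" by (metis less_SucE)
    from LIMSEQ_subseq_LIMSEQ[OF this q(1)] show ?thesis by (auto simp: o_def)
  qed
  thus ?case using strict_mono_o[OF r(1) q(1)] by (intro exI[of _ "r \<circ> q"]) (simp add: o_def)
qed

lemma tendsto_of_subseq_limits:
  fixes f :: "nat \<Rightarrow> 'a::metric_space"
  assumes "\<And>r::nat \<Rightarrow> nat. strict_mono r \<Longrightarrow> \<exists>q::nat \<Rightarrow> nat. strict_mono q \<and> (\<lambda>n. f (r (q n))) \<longlonglongrightarrow> l"
  shows "f \<longlonglongrightarrow> l"
proof (rule ccontr)
  assume "\<not> f \<longlonglongrightarrow> l"
  then obtain e where e: "e > 0" "\<And>N. \<exists>n\<ge>N. dist (f n) l \<ge> e"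
    unfolding lim_sequentially by (meson not_less)
  have "infinite {n. dist (f n) l \<ge> e}"
    unfolding infinite_nat_iff_unbounded_le using e(2) by blast
  then obtain r :: "nat \<Rightarrow> nat" where r: "strict_mono r" "\<And>n. dist (f (r n)) l \<ge> e"
    using infinite_enumerate by blast
  obtain q where "(\<lambda>n. f (r (q n))) \<longlonglongrightarrow> l" using assms[OF r(1)] by blast
  then obtain n where "dist (f (r (q n))) l < e" using e(1) unfolding lim_sequentially by blast
  thus False using r(2)[of "q n"] by simp
qed

section \<open>Sorted arguments in a window of length 2 pi\<close>

definition angle_from :: "real \<Rightarrow> complex \<Rightarrow> real" where
  "angle_from \<alpha> z = \<alpha> + Arg2pi (z / cis \<alpha>)"

lemma angle_from_bounds: "\<alpha> \<le> angle_from \<alpha> z" "angle_from \<alpha> z < \<alpha> + 2 * pi"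
  unfolding angle_from_def using Arg2pi_ge_0 Arg2pi_lt_2pi by auto

lemma cis_angle_from:
  assumes "cmod z = 1" shows "cis (angle_from \<alpha> z) = z"
proof -
  have "cmod (z / cis \<alpha>) = 1" using assms by (simp add: norm_divide)
  hence "cis (Arg2pi (z / cis \<alpha>)) = z / cis \<alpha>" by (simp add: complex_norm_eq_1_exp cis_conv_exp)
  thus ?thesis unfolding angle_from_def by (simp add: cis_mult[symmetric])
qed

lemma angle_from_cis:
  assumes "\<alpha> \<le> x" "x < \<alpha> + 2 * pi" shows "angle_from \<alpha> (cis x) = x"
proof -
  have "Arg2pi (cis x / cis \<alpha>) = x - \<alpha>"
  proof (rule Arg2pi_unique[of 1])
    show "complex_of_real 1 * exp (\<i> * complex_of_real (x - \<alpha>)) = cis x / cis \<alpha>"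
      by (simp only: of_real_1 mult_1 cis_conv_exp[symmetric] cis_divide)
  qed (use assms in auto)
  thus ?thesis by (simp add: angle_from_def)
qed

text \<open>Sorting selects one ordered vector for an unordered configuration. It depends
  continuously on the configuration as long as no point reaches \<open>cis \<alpha>\<close>, where
  the window is cut.\<close>

definition sorted_angles :: "nat \<Rightarrow> real \<Rightarrow> (nat \<Rightarrow> complex) \<Rightarrow> real list" where
  "sorted_angles m \<alpha> c = sort (map (\<lambda>j. angle_from \<alpha> (c j)) [0..<m])"

lemma sorted_angles_basic:
  "length (sorted_angles m \<alpha> c) = m" "sorted (sorted_angles m \<alpha> c)"
  "mset (sorted_angles m \<alpha> c) = image_mset (\<lambda>j. angle_from \<alpha> (c j)) (mset_set {..<m})"
  by (simp_all add: sorted_angles_def lessThan_atLeast0)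

lemma image_mset_nth: "length L = m \<Longrightarrow> image_mset ((!) L) (mset_set {..<m}) = mset L"
  by (metis lessThan_atLeast0 map_nth mset_map mset_upt)

lemma sorted_angles_range:
  assumes "j < m" shows "sorted_angles m \<alpha> c ! j \<in> {\<alpha>..\<alpha> + 2 * pi}"
proof -
  have "sorted_angles m \<alpha> c ! j \<in> set (sorted_angles m \<alpha> c)"
    using assms by (simp add: sorted_angles_basic)
  also have "\<dots> = (\<lambda>j. angle_from \<alpha> (c j)) ` {..<m}"
    by (auto simp: sorted_angles_def)
  finally show ?thesis using angle_from_bounds by (auto intro: less_imp_le)
qed

lemma image_mset_cis_sorted_angles:
  assumes "\<And>j. j < m \<Longrightarrow> cmod (c j) = 1"
  shows "image_mset (\<lambda>j. cis (sorted_angles m \<alpha> c ! j)) (mset_set {..<m}) = image_mset c (mset_set {..<m})"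
proof -
  have "image_mset (\<lambda>j. cis (sorted_angles m \<alpha> c ! j)) (mset_set {..<m})
      = image_mset cis (image_mset ((!) (sorted_angles m \<alpha> c)) (mset_set {..<m}))"
    by (simp add: image_mset.compositionality o_def)
  also have "\<dots> = image_mset (\<lambda>j. cis (angle_from \<alpha> (c j))) (mset_set {..<m})"
    by (simp add: image_mset_nth sorted_angles_basic image_mset.compositionality o_def)
  also have "\<dots> = image_mset c (mset_set {..<m})"
    using assms by (intro image_mset_cong) (auto simp: cis_angle_from)
  finally show ?thesis .
qed

lemma prod_cong_image_mset:
  assumes "image_mset a (mset_set {..<m}) = image_mset b (mset_set {..<m::nat})"
  shows "(\<Prod>j<m. f (a j)) = (\<Prod>j<m. f (b j) :: complex)"
proof -
  have "(\<Prod>j<m. f (c j)) = prod_mset (image_mset f (image_mset c (mset_set {..<m})))" for c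
    by (simp add: prod_unfold_prod_mset image_mset.compositionality o_def)
  thus ?thesis using assms by metis
qed

text \<open>A limit of sorted angle vectors solves the same equations as the angles of the limit
  configuration, and the gap at \<open>cis \<alpha>\<close> keeps it from leaving the half-open window.\<close>

lemma sorted_angles_tendsto:
  fixes w :: "real \<Rightarrow> nat \<Rightarrow> complex"
  assumes unit: "\<And>t j. j < m \<Longrightarrow> cmod (w t j) = 1"
    and cont: "\<And>z. continuous_on UNIV (\<lambda>t. \<Prod>j<m. z - w t j)"
    and x: "x \<longlonglongrightarrow> t" and gap: "\<And>j. j < m \<Longrightarrow> w t j \<noteq> cis \<alpha>" and "j < m"
  shows "(\<lambda>n. sorted_angles m \<alpha> (w (x n)) ! j) \<longlonglongrightarrow> sorted_angles m \<alpha> (w t) ! j"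
proof (rule tendsto_of_subseq_limits)
  fix r :: "nat \<Rightarrow> nat" assume r: "strict_mono r"
  let ?\<theta> = "\<lambda>t j. sorted_angles m \<alpha> (w t) ! j"
  obtain q :: "nat \<Rightarrow> nat" where q: "strict_mono q" "\<forall>j<m. \<exists>l. (\<lambda>n. ?\<theta> (x (r (q n))) j) \<longlonglongrightarrow> l"
    using finite_family_convergent_subseq[of m "\<lambda>n. ?\<theta> (x (r n))" \<alpha> "\<alpha> + 2 * pi"]
      sorted_angles_range by blast
  then obtain l where l: "\<And>j. j < m \<Longrightarrow> (\<lambda>n. ?\<theta> (x (r (q n))) j) \<longlonglongrightarrow> l j" by metis
  have xs: "(\<lambda>n. x (r (q n))) \<longlonglongrightarrow> t"
    using LIMSEQ_subseq_LIMSEQ[OF x strict_mono_o[OF r q(1)]] by (simp add: o_def)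
  \<comment> \<open>Both sides are limits of the same sequence: one by convergence of the sorted
    angles along the subsequence, the other by continuity of the product in
    \<open>t\<close>.\<close>
  have "(\<Prod>j<m. z - cis (l j)) = (\<Prod>j<m. z - w t j)" for z
  proof (rule LIMSEQ_unique)
    show "(\<lambda>n. \<Prod>j<m. z - cis (?\<theta> (x (r (q n))) j)) \<longlonglongrightarrow> (\<Prod>j<m. z - cis (l j))"
      using l by (intro tendsto_prod tendsto_intros) auto
    have "(\<Prod>j<m. z - cis (?\<theta> s j)) = (\<Prod>j<m. z - w s j)" for s
      using prod_cong_image_mset[where f = "\<lambda>u. z - u", OF image_mset_cis_sorted_angles[OF unit]] by simp
    moreover have "(\<lambda>n. \<Prod>j<m. z - w (x (r (q n))) j) \<longlonglongrightarrow> (\<Prod>j<m. z - w t j)"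
      using cont[of z] xs by (auto simp: continuous_on_sequentially o_def)
    ultimately show "(\<lambda>n. \<Prod>j<m. z - cis (?\<theta> (x (r (q n))) j)) \<longlonglongrightarrow> (\<Prod>j<m. z - w t j)"
      by simp
  qed
  hence ms: "image_mset (\<lambda>j. cis (l j)) (mset_set {..<m}) = image_mset (w t) (mset_set {..<m})"
    by (rule image_mset_eq_of_prod_eq)
  have ang: "angle_from \<alpha> (cis (l j)) = l j" if j: "j < m" for j
  proof (rule angle_from_cis)
    show "\<alpha> \<le> l j"
      by (rule LIMSEQ_le_const[OF l[OF j]]) (use sorted_angles_range[OF j] in force)
    have "l j \<le> \<alpha> + 2 * pi"
      by (rule LIMSEQ_le_const2[OF l[OF j]]) (use sorted_angles_range[OF j] in force)
    moreover have "l j \<noteq> \<alpha> + 2 * pi"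
    proof
      assume "l j = \<alpha> + 2 * pi"
      hence "cis (l j) = cis \<alpha>" by (simp add: cis_mult[symmetric])
      moreover have "cis (l j) \<in># image_mset (w t) (mset_set {..<m})"
        unfolding ms[symmetric] using j by auto
      ultimately show False using gap by (metis (no_types, lifting) finite_set_mset_mset_set finite_lessThan image_iff lessThan_iff set_image_mset)
    qed
    ultimately show "l j < \<alpha> + 2 * pi" by simp
  qed
  have "sorted_angles m \<alpha> (w t) = map l [0..<m]"
    unfolding sorted_angles_def
  proof (rule properties_for_sort)
    have "image_mset l (mset_set {..<m}) = image_mset (angle_from \<alpha>) (image_mset (\<lambda>j. cis (l j)) (mset_set {..<m}))"
      unfolding image_mset.compositionality o_def
      by (rule image_mset_cong) (simp add: ang)
    thus "mset (map l [0..<m]) = mset (map (\<lambda>j. angle_from \<alpha> (w t j)) [0..<m])"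
      unfolding ms by (simp add: lessThan_atLeast0 image_mset.compositionality o_def)
    show "sorted (map l [0..<m])"
    proof (subst sorted_iff_nth_mono, intro allI impI)
      fix i k assume ik: "i \<le> k" "k < length (map l [0..<m])"
      hence "?\<theta> s i \<le> ?\<theta> s k" for s
        by (intro sorted_nth_mono) (simp_all add: sorted_angles_basic)
      thus "map l [0..<m] ! i \<le> map l [0..<m] ! k"
        using ik LIMSEQ_le[OF l l, of i k] by auto
    qed
  qed
  hence "sorted_angles m \<alpha> (w t) ! j = l j" using \<open>j < m\<close> by simp
  thus "\<exists>q::nat \<Rightarrow> nat. strict_mono q \<and> (\<lambda>n. ?\<theta> (x (r (q n))) j) \<longlonglongrightarrow> ?\<theta> t j"
    using q(1) l \<open>j < m\<close> by metis
qed

section \<open>Continuous lifts: gluing, local existence and extension to an interval\<close>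

definition angle_lift :: "nat \<Rightarrow> real \<Rightarrow> real \<Rightarrow> (real \<Rightarrow> complex multiset) \<Rightarrow> (nat \<Rightarrow> real \<Rightarrow> real) \<Rightarrow> bool" where
  "angle_lift m a b E \<theta> \<longleftrightarrow> (\<forall>j<m. continuous_on {a..b} (\<theta> j)) \<and>
     (\<forall>t\<in>{a..b}. image_mset (\<lambda>j. cis (\<theta> j t)) (mset_set {..<m}) = E t)"

lemma angle_lift_subinterval:
  "angle_lift m a b E \<theta> \<Longrightarrow> a \<le> c \<Longrightarrow> d \<le> b \<Longrightarrow> angle_lift m c d E \<theta>"
  unfolding angle_lift_def by (auto intro: continuous_on_subset[of "{a..b}"])

text \<open>At the junction both lifts represent the same multiset, so after a permutation of the
  indices the angles agree up to multiples of 2 pi; the second lift is continued with these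
  corrections.\<close>

lemma angle_lift_glue:
  assumes 1: "angle_lift m a b E \<theta>" and 2: "angle_lift m b c E \<phi>" and "a \<le> b" "b \<le> c"
  shows "\<exists>\<psi>. angle_lift m a c E \<psi>"
proof -
  have "image_mset (\<lambda>j. cis (\<theta> j b)) (mset_set {..<m}) = image_mset (\<lambda>j. cis (\<phi> j b)) (mset_set {..<m})"
    using assms by (simp add: angle_lift_def)
  then obtain p where p: "p permutes {..<m}" "\<forall>j\<in>{..<m}. cis (\<theta> j b) = cis (\<phi> (p j) b)"
    using image_mset_eq_implies_permutes[OF finite_lessThan] by (metis (no_types, lifting))
  then have "\<forall>j\<in>{..<m}. \<exists>n::int. \<theta> j b = \<phi> (p j) b + 2 * pi * n" by (simp add: cis_eq_cis_iff)
  then obtain n :: "nat \<Rightarrow> int" where n: "\<And>j. j < m \<Longrightarrow> \<theta> j b = \<phi> (p j) b + 2 * pi * n j"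
    by (metis lessThan_iff)
  define \<psi> where "\<psi> j t = (if t \<le> b then \<theta> j t else \<phi> (p j) t + 2 * pi * n j)" for j t
  have pm: "p j < m" if "j < m" for j using permutes_in_image[OF p(1)] that by auto
  have "continuous_on {a..c} (\<psi> j)" if j: "j < m" for j
  proof -
    have "continuous_on ({a..b} \<union> {b..c}) (\<lambda>t. if t \<le> b then \<theta> j t else \<phi> (p j) t + 2 * pi * n j)"
      using 1 2 j pm[OF j] n[OF j] unfolding angle_lift_def
      by (intro continuous_on_If continuous_intros) auto
    moreover have "{a..b} \<union> {b..c} = {a..c}" using assms by auto
    ultimately show ?thesis unfolding \<psi>_def by simp
  qed
  moreover have "image_mset (\<lambda>j. cis (\<psi> j t)) (mset_set {..<m}) = E t" if t: "t \<in> {a..c}" for t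
  proof (cases "t \<le> b")
    case True
    thus ?thesis using 1 t by (simp add: \<psi>_def angle_lift_def)
  next
    case False
    have "cis (\<psi> j t) = cis (\<phi> (p j) t)" for j
      using False by (simp add: \<psi>_def cis_mult[symmetric])
    hence "image_mset (\<lambda>j. cis (\<psi> j t)) (mset_set {..<m})
        = image_mset (\<lambda>j. cis (\<phi> j t)) (image_mset p (mset_set {..<m}))"
      by (simp add: image_mset.compositionality o_def)
    thus ?thesis using False 2 t permutes_image_mset[OF p(1)] by (simp add: angle_lift_def)
  qed
  ultimately show ?thesis unfolding angle_lift_def by blast
qed

text \<open>Near each parameter some direction \<open>cis \<alpha>\<close> stays off the finite
  configuration, and there the sorted angles form a lift. Bisection and gluing carry local lifts to
  the whole interval.\<close>

lemma ex_angle_lift_UNIV: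
  fixes w :: "real \<Rightarrow> nat \<Rightarrow> complex"
  assumes unit: "\<And>t j. j < m \<Longrightarrow> cmod (w t j) = 1"
    and cont: "\<And>z. continuous_on UNIV (\<lambda>t. \<Prod>j<m. z - w t j)" and "a \<le> b"
  shows "\<exists>\<theta>. angle_lift m a b (\<lambda>t. image_mset (w t) (mset_set {..<m})) \<theta>"
proof (rule Bolzano[OF \<open>a \<le> b\<close>])
  fix t
  have "infinite (cis ` {0..<2 * pi})"
  proof -
    have "inj_on cis {0..<2 * pi}"
      by (rule inj_on_inverseI[where g = "angle_from 0"]) (simp add: angle_from_cis)
    thus ?thesis by (subst finite_image_iff) (auto simp: infinite_Ico)
  qed
  hence "\<not> cis ` {0..<2 * pi} \<subseteq> w t ` {..<m}" by (meson finite_imageI finite_lessThan finite_subset)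
  then obtain \<alpha> where \<alpha>: "\<And>j. j < m \<Longrightarrow> w t j \<noteq> cis \<alpha>" by (metis image_eqI image_subsetI lessThan_iff)
  \<comment> \<open>The single continuous function \<open>g\<close> vanishes exactly when some point
    sits at \<open>cis \<alpha>\<close>. So the gap is an open condition, although the individual
    points \<open>w s j\<close> need not move continuously.\<close>
  define g where "g s = (\<Prod>j<m. cis \<alpha> - w s j)" for s
  have "continuous_on UNIV g" unfolding g_def[abs_def] by (rule cont)
  hence "open (g -` (- {0}))" by (intro open_vimage) auto
  moreover have "t \<in> g -` (- {0})" using \<alpha>[symmetric] by (simp add: g_def prod_zero_iff)
  ultimately have "\<exists>d>0. \<forall>s. dist s t < d \<longrightarrow> s \<in> g -` (- {0})"
    by (rule open_dist[THEN iffD1, THEN bspec])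
  then obtain d where "d > 0" "\<forall>s. dist s t < d \<longrightarrow> s \<in> g -` (- {0})" by blast
  hence d: "d > 0" "\<And>s. dist s t < d \<Longrightarrow> g s \<noteq> 0" by simp_all
  have gap: "w s j \<noteq> cis \<alpha>" if "dist s t < d" "j < m" for s j
    using d(2)[OF that(1)] that(2) by (force simp: prod_zero_iff g_def)
  show "\<exists>d>0. \<forall>a b. a \<le> t \<and> t \<le> b \<and> b - a < d \<longrightarrow>
      (\<exists>\<theta>. angle_lift m a b (\<lambda>t. image_mset (w t) (mset_set {..<m})) \<theta>)"
  proof (intro exI[of _ d] conjI allI impI d(1))
    fix a b assume ab: "a \<le> t \<and> t \<le> b \<and> b - a < d"
    hence near: "dist s t < d" if "s \<in> {a..b}" for s using that by (auto simp: dist_real_def)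
    have "continuous_on {a..b} (\<lambda>s. sorted_angles m \<alpha> (w s) ! j)" if "j < m" for j
      unfolding continuous_on_sequentially o_def
      using sorted_angles_tendsto[OF unit cont _ gap that] near that by blast
    thus "\<exists>\<theta>. angle_lift m a b (\<lambda>t. image_mset (w t) (mset_set {..<m})) \<theta>"
      unfolding angle_lift_def using image_mset_cis_sorted_angles[OF unit]
      by (intro exI[of _ "\<lambda>j s. sorted_angles m \<alpha> (w s) ! j"]) auto
  qed
qed (use angle_lift_glue in blast)

lemma ex_angle_lift:
  fixes w :: "real \<Rightarrow> nat \<Rightarrow> complex"
  assumes unit: "\<And>t j. t \<in> {a..b} \<Longrightarrow> j < m \<Longrightarrow> cmod (w t j) = 1"
    and cont: "\<And>z. continuous_on {a..b} (\<lambda>t. \<Prod>j<m. z - w t j)" and "a \<le> b"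
  shows "\<exists>\<theta>. angle_lift m a b (\<lambda>t. image_mset (w t) (mset_set {..<m})) \<theta>"
proof -
  \<comment> \<open>Clamping the parameter makes the family continuous on the whole line and leaves
    it unchanged on the interval.\<close>
  define c where "c t = max a (min b t)" for t
  have c: "c t \<in> {a..b}" for t using \<open>a \<le> b\<close> by (auto simp: c_def)
  have "continuous_on UNIV (\<lambda>t. \<Prod>j<m. z - w (c t) j)" for z
    by (rule continuous_on_compose2[OF cont[of z]]) (use c in \<open>auto simp: c_def[abs_def] intro!: continuous_intros\<close>)
  then obtain \<theta> where "angle_lift m a b (\<lambda>t. image_mset (w (c t)) (mset_set {..<m})) \<theta>"
    using ex_angle_lift_UNIV[of m "\<lambda>t. w (c t)"] unit c \<open>a \<le> b\<close> by blast
  moreover have "c t = t" if "t \<in> {a..b}" for t using that by (auto simp: c_def)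
  ultimately show ?thesis unfolding angle_lift_def by (intro exI[of _ \<theta>]) simp
qed

section \<open>Counting crossings of the angle zero\<close>

definition defect :: "complex \<Rightarrow> real" where
  "defect z = of_int \<lceil>Arg z / (2 * pi)\<rceil> - Arg z / (2 * pi)"

definition total_defect :: "complex multiset \<Rightarrow> real" where
  "total_defect E = (\<Sum>z\<in>#E. defect z)"

definition crossings :: "nat \<Rightarrow> (nat \<Rightarrow> real \<Rightarrow> real) \<Rightarrow> real \<Rightarrow> real \<Rightarrow> int" where
  "crossings m \<theta> a b = (\<Sum>j<m. \<lceil>\<theta> j b / (2 * pi)\<rceil> - \<lceil>\<theta> j a / (2 * pi)\<rceil>)"

lemma defect_cis: "defect (cis x) = of_int \<lceil>x / (2 * pi)\<rceil> - x / (2 * pi)"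
proof -
  have "cis (Arg (cis x)) = cis x" by (simp add: cis_Arg)
  then obtain n :: int where "Arg (cis x) = x + 2 * pi * n" using cis_eq_cis_iff by blast
  hence "Arg (cis x) / (2 * pi) = x / (2 * pi) + n" by (simp add: field_simps)
  thus ?thesis by (simp add: defect_def)
qed

lemma crossings_trans: "crossings m \<theta> a b + crossings m \<theta> b c = crossings m \<theta> a c"
  by (simp add: crossings_def sum.distrib[symmetric])

lemma total_defect_image: "total_defect (image_mset f (mset_set A)) = (\<Sum>j\<in>A. defect (f j))"
  by (simp add: total_defect_def image_mset.compositionality o_def sum_unfold_sum_mset)

lemma crossings_eq:
  assumes "angle_lift m a b E \<theta>" "a \<le> b"
  shows "of_int (crossings m \<theta> a b) = ((\<Sum>j<m. \<theta> j b) - (\<Sum>j<m. \<theta> j a)) / (2 * pi)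
     + total_defect (E b) - total_defect (E a)"
proof -
  have E: "total_defect (E t) = (\<Sum>j<m. of_int \<lceil>\<theta> j t / (2 * pi)\<rceil>) - (\<Sum>j<m. \<theta> j t) / (2 * pi)"
    if "t \<in> {a..b}" for t
  proof -
    have "E t = image_mset (\<lambda>j. cis (\<theta> j t)) (mset_set {..<m})"
      using assms(1) that by (simp add: angle_lift_def)
    thus ?thesis by (simp add: total_defect_image defect_cis sum_subtractf sum_divide_distrib)
  qed
  show ?thesis using assms(2)
    by (simp add: E crossings_def sum_subtractf diff_divide_distrib)
qed

lemma constant_on_interval_if_locally:
  fixes f :: "real \<Rightarrow> 'a"
  assumes "a \<le> b" "\<And>t. t \<in> {a..b} \<Longrightarrow> \<exists>d>0. \<forall>s\<in>{a..b}. \<bar>s - t\<bar> < d \<longrightarrow> f s = f t"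
  shows "f a = f b"
proof -
  have "a \<in> {a..b} \<longrightarrow> b \<in> {a..b} \<longrightarrow> f a = f b"
  proof (rule Bolzano[where P = "\<lambda>x y. x \<in> {a..b} \<longrightarrow> y \<in> {a..b} \<longrightarrow> f x = f y", OF assms(1)])
    fix t assume "a \<le> t" "t \<le> b"
    then obtain d where d: "d > 0" "\<forall>s\<in>{a..b}. \<bar>s - t\<bar> < d \<longrightarrow> f s = f t" using assms(2)[of t] by auto
    have "f x = f y" if "x \<le> t \<and> t \<le> y \<and> y - x < d" "x \<in> {a..b}" "y \<in> {a..b}" for x y
    proof -
      have "f x = f t" "f y = f t" using that by (intro d(2)[rule_format]; auto)+
      thus ?thesis by simp
    qed
    thus "\<exists>d>0. \<forall>x y. x \<le> t \<and> t \<le> y \<and> y - x < d \<longrightarrow> x \<in> {a..b} \<longrightarrow> y \<in> {a..b} \<longrightarrow> f x = f y"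
      using d(1) by blast
  qed auto
  thus ?thesis using assms(1) by simp
qed

text \<open>The combination \<open>g\<close> of the three angle sums is continuous and, by the
  product relation, takes values in the multiples of 2 pi, so it is constant. This is the additivity
  of arg det, for arbitrary lifts.\<close>

lemma angle_sum_additive:
  assumes 1: "angle_lift m a b E1 \<theta>" and 2: "angle_lift m a b E2 \<phi>" and 3: "angle_lift m a b E3 \<psi>"
    and prod: "\<And>t. t \<in> {a..b} \<Longrightarrow> prod_mset (E1 t) * prod_mset (E2 t) = prod_mset (E3 t)" and "a \<le> b"
  shows "(\<Sum>j<m. \<theta> j b) - (\<Sum>j<m. \<theta> j a) + ((\<Sum>j<m. \<phi> j b) - (\<Sum>j<m. \<phi> j a))
     = (\<Sum>j<m. \<psi> j b) - (\<Sum>j<m. \<psi> j a)"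
proof -
  define g where "g t = (\<Sum>j<m. \<theta> j t) + (\<Sum>j<m. \<phi> j t) - (\<Sum>j<m. \<psi> j t)" for t
  have cis_sum: "cis (\<Sum>j<m. f j) = (\<Prod>j<m. cis (f j))" for f :: "nat \<Rightarrow> real"
    by (induction m) (simp_all add: cis_mult[symmetric])
  have pr: "prod_mset (E t) = cis (\<Sum>j<m. \<eta> j t)" if "angle_lift m a b E \<eta>" "t \<in> {a..b}" for E \<eta> t
  proof -
    have "E t = image_mset (\<lambda>j. cis (\<eta> j t)) (mset_set {..<m})" using that by (simp add: angle_lift_def)
    thus ?thesis by (simp add: cis_sum prod_unfold_prod_mset)
  qed
  have g1: "cis (g t) = 1" if "t \<in> {a..b}" for t
    using prod[OF that] unfolding pr[OF 1 that] pr[OF 2 that] pr[OF 3 that]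
    by (simp add: g_def cis_divide[symmetric] cis_mult[symmetric])
  have cont: "continuous_on {a..b} g"
    unfolding g_def[abs_def] using 1 2 3 by (intro continuous_intros) (auto simp: angle_lift_def)
  have "g a = g b"
  proof (rule constant_on_interval_if_locally[OF \<open>a \<le> b\<close>])
    fix t assume t: "t \<in> {a..b}"
    obtain d where d: "d > 0" "\<And>s. s \<in> {a..b} \<Longrightarrow> dist s t < d \<Longrightarrow> dist (g s) (g t) < 2 * pi"
      using cont t pi_gt_zero unfolding continuous_on_iff by (metis mult_pos_pos zero_less_numeral)
    have "g s = g t" if "s \<in> {a..b}" "\<bar>s - t\<bar> < d" for s
    proof -
      have "cis (g s) = cis (g t)" using g1 that t by simp
      then obtain n :: int where n: "g s = g t + 2 * pi * n" using cis_eq_cis_iff by blast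
      have "\<bar>2 * pi * n\<bar> < 2 * pi" using d(2)[of s] that n by (simp add: dist_real_def)
      hence "\<bar>real_of_int n\<bar> < 1" by (simp add: abs_mult)
      hence "n = 0" by linarith
      thus ?thesis using n by simp
    qed
    thus "\<exists>d>0. \<forall>s\<in>{a..b}. \<bar>s - t\<bar> < d \<longrightarrow> g s = g t" using d(1) by blast
  qed
  thus ?thesis by (simp add: g_def)
qed

lemma count_image_mset_set:
  "finite A \<Longrightarrow> count (image_mset f (mset_set A)) b = card {j \<in> A. f j = b}"
proof (induction A rule: finite_induct)
  case (insert x A)
  have "{j \<in> insert x A. f j = b} = (if f x = b then insert x {j \<in> A. f j = b} else {j \<in> A. f j = b})"
    by auto
  thus ?case using insert by simp
qed simp

text \<open>A ceiling changes only when its angle enters or leaves a multiple of 2 pi. An angle away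
  from these multiples stays away for nearby parameters, so the set of indices with value 1 can only
  shrink nearby. Its constant cardinality keeps it fixed, and an angle that remains a multiple of 2
  pi is locally constant.\<close>

lemma ceiling_angle_constant:
  assumes lift: "angle_lift m a b E \<theta>" and cnt: "\<And>t. t \<in> {a..b} \<Longrightarrow> count (E t) 1 = k"
    and "a \<le> b" "j < m"
  shows "\<lceil>\<theta> j a / (2 * pi)\<rceil> = \<lceil>\<theta> j b / (2 * pi)\<rceil>"
proof (rule constant_on_interval_if_locally[OF \<open>a \<le> b\<close>])
  fix t assume t: "t \<in> {a..b}"
  let ?Z = "\<lambda>t. {j. j < m \<and> cis (\<theta> j t) = 1}"
  have card: "card (?Z t) = k" if "t \<in> {a..b}" for t
  proof -
    have "E t = image_mset (\<lambda>j. cis (\<theta> j t)) (mset_set {..<m})" using lift that by (simp add: angle_lift_def)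
    thus ?thesis using cnt[OF that] by (simp add: count_image_mset_set)
  qed
  have cont: "continuous_on {a..b} (\<theta> j)" if "j < m" for j using lift that by (simp add: angle_lift_def)
  have ev: "eventually (\<lambda>s. i \<in> ?Z s \<longrightarrow> i \<in> ?Z t) (at t within {a..b})" if "i < m" for i
  proof (cases "i \<in> ?Z t")
    case False
    have "((\<lambda>s. cis (\<theta> i s)) \<longlongrightarrow> cis (\<theta> i t)) (at t within {a..b})"
      using cont[OF that] t by (intro tendsto_intros) (auto simp: continuous_on_def)
    moreover have "cis (\<theta> i t) \<noteq> 1" using False that by simp
    ultimately have "eventually (\<lambda>s. cis (\<theta> i s) \<noteq> 1) (at t within {a..b})"
      by (rule tendsto_imp_eventually_ne)
    thus ?thesis by eventually_elim simp
  qed simp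
  have "eventually (\<lambda>s. \<forall>i\<in>{..<m}. i \<in> ?Z s \<longrightarrow> i \<in> ?Z t) (at t within {a..b})"
    by (subst eventually_ball_finite_distrib) (use ev in auto)
  hence evZ: "eventually (\<lambda>s. s \<in> {a..b} \<longrightarrow> ?Z s = ?Z t) (at t within {a..b})"
  proof eventually_elim
    case (elim s)
    show ?case
    proof
      assume "s \<in> {a..b}"
      moreover have "?Z s \<subseteq> ?Z t" using elim by auto
      ultimately show "?Z s = ?Z t" using card t by (intro card_subset_eq) auto
    qed
  qed
  have evd: "eventually (\<lambda>s. dist (\<theta> j s) (\<theta> j t) < e) (at t within {a..b})" if "e > 0" for e
    using cont[OF \<open>j < m\<close>] t that by (auto simp: continuous_on_def dest: tendstoD)
  \<comment> \<open>A radius within which the angle stays strictly between two neighbouring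
    multiples of 2 pi. If the angle is itself such a multiple, the last condition is void and
    \<open>2 * pi\<close> serves as a default.\<close>
  obtain e where e: "e > 0" "e \<le> 2 * pi"
     "cis (\<theta> j t) \<noteq> 1 \<Longrightarrow> \<bar>x - \<theta> j t\<bar> < e \<Longrightarrow> \<lceil>x / (2 * pi)\<rceil> = \<lceil>\<theta> j t / (2 * pi)\<rceil>" for x
  proof (cases "cis (\<theta> j t) = 1")
    case True thus ?thesis using that[of "2 * pi"] by simp
  next
    case False
    define n where "n = \<lceil>\<theta> j t / (2 * pi)\<rceil>"
    have n: "of_int n - 1 < \<theta> j t / (2 * pi)" "\<theta> j t / (2 * pi) \<le> of_int n"
      unfolding n_def by linarith+
    have "\<theta> j t / (2 * pi) \<noteq> of_int n"
    proof
      assume "\<theta> j t / (2 * pi) = of_int n"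
      hence "\<theta> j t = 0 + 2 * pi * n" by (simp add: field_simps)
      thus False using False cis_eq_cis_iff[of "\<theta> j t" 0] by auto
    qed
    hence n': "\<theta> j t / (2 * pi) < of_int n" using n by simp
    have b: "2 * pi * (of_int n - 1) < \<theta> j t" "\<theta> j t < 2 * pi * of_int n"
      using n(1) n' by (simp_all add: field_simps)
    define e where "e = min (2 * pi) (min (\<theta> j t - 2 * pi * (of_int n - 1)) (2 * pi * of_int n - \<theta> j t))"
    have ce: "\<lceil>x / (2 * pi)\<rceil> = n" if "\<bar>x - \<theta> j t\<bar> < e" for x
    proof (rule ceiling_unique)
      have "2 * pi * (of_int n - 1) < x" "x \<le> 2 * pi * of_int n" using that b by (auto simp: e_def)
      thus "of_int n - 1 < x / (2 * pi)" "x / (2 * pi) \<le> of_int n" by (simp_all add: field_simps)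
    qed
    have e: "e > 0" "e \<le> 2 * pi" using b by (auto simp: e_def)
    show ?thesis by (rule that[OF e ce[unfolded n_def]])
  qed
  have "eventually (\<lambda>s. (s \<in> {a..b} \<longrightarrow> ?Z s = ?Z t) \<and> dist (\<theta> j s) (\<theta> j t) < e) (at t within {a..b})"
    by (rule eventually_conj[OF evZ evd[OF e(1)]])
  then obtain d where d: "d > 0" "\<And>s. s \<in> {a..b} \<Longrightarrow> s \<noteq> t \<Longrightarrow> dist s t < d \<Longrightarrow> ?Z s = ?Z t \<and> dist (\<theta> j s) (\<theta> j t) < e"
    unfolding eventually_at by blast
  have "\<lceil>\<theta> j s / (2 * pi)\<rceil> = \<lceil>\<theta> j t / (2 * pi)\<rceil>" if s: "s \<in> {a..b}" "\<bar>s - t\<bar> < d" for s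
  proof (cases "s = t \<or> cis (\<theta> j t) \<noteq> 1")
    case True
    thus ?thesis using d(2)[of s] s e(3)[of "\<theta> j s"] by (auto simp: dist_real_def)
  next
    case False
    hence Z: "?Z s = ?Z t" "dist (\<theta> j s) (\<theta> j t) < 2 * pi" using d(2)[of s] s e(2) by (auto simp: dist_real_def)
    have "j \<in> ?Z s" unfolding Z(1) using False \<open>j < m\<close> by simp
    hence "cis (\<theta> j s) = cis (\<theta> j t)" using False by simp
    then obtain n :: int where n: "\<theta> j s = \<theta> j t + 2 * pi * n" using cis_eq_cis_iff by blast
    have "\<bar>2 * pi * n\<bar> < 2 * pi" using Z(2) n by (simp add: dist_real_def)
    hence "\<bar>real_of_int n\<bar> < 1" by (simp add: abs_mult)
    hence "n = 0" by linarith
    thus ?thesis using n by simp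
  qed
  thus "\<exists>d>0. \<forall>s\<in>{a..b}. \<bar>s - t\<bar> < d \<longrightarrow> \<lceil>\<theta> j s / (2 * pi)\<rceil> = \<lceil>\<theta> j t / (2 * pi)\<rceil>" using d(1) by blast
qed

section \<open>Hermitian spaces\<close>

lemma inner_productD:
  assumes "inner_product s g"
  shows "g (x + y) z = g x z + g y z" "g (s c x) z = c * g x z"
    and "g z x = cnj (g x z)" and "x \<noteq> 0 \<Longrightarrow> 0 < Re (g x x)"
  using assms unfolding inner_product_def sesquilinear_def Vector_Spaces.linear_iff by blast+

locale hermitian_space = finite_dimensional_vector_space scale Basis
  for scale :: "complex \<Rightarrow> 'v::ab_group_add \<Rightarrow> 'v" and Basis :: "'v set" +
  fixes ip :: "'v \<Rightarrow> 'v \<Rightarrow> complex"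
  assumes inner: "inner_product scale ip"
begin

abbreviation N :: nat where "N \<equiv> card Basis"

lemma ip_cnj: "cnj (ip x y) = ip y x"
  using inner_productD(3)[OF inner, of y x] by simp

lemma ip_add_left: "ip (x + y) z = ip x z + ip y z"
  and ip_scale_left: "ip (scale c x) z = c * ip x z"
  using inner_productD(1,2)[OF inner] by blast+

lemma ip_add_right: "ip z (x + y) = ip z x + ip z y"
  by (metis complex_cnj_add ip_add_left ip_cnj)

lemma ip_scale_right: "ip z (scale c x) = cnj c * ip z x"
  by (metis complex_cnj_mult ip_scale_left ip_cnj)

lemma ip_0_left [simp]: "ip 0 x = 0" and ip_0_right [simp]: "ip x 0 = 0"
  using ip_scale_left[of 0 0 x] ip_scale_right[of x 0 0] by simp_all

lemma ip_diff_left: "ip (x - y) z = ip x z - ip y z"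
  by (metis add_diff_cancel_right' diff_add_cancel ip_add_left)

lemma ip_diff_right: "ip z (x - y) = ip z x - ip z y"
  by (metis add_diff_cancel_right' diff_add_cancel ip_add_right)

lemma ip_sum_left: "ip (\<Sum>i\<in>A. f i) z = (\<Sum>i\<in>A. ip (f i) z)"
  by (induction A rule: infinite_finite_induct) (simp_all add: ip_add_left)

lemmas ip_simps = ip_add_left ip_add_right ip_scale_left ip_scale_right ip_diff_left ip_diff_right

lemma ip_self_real: "ip x x = complex_of_real (Re (ip x x))"
  using ip_cnj[of x x] by (simp add: complex_eq_iff)

lemma ip_self_pos: "x \<noteq> 0 \<Longrightarrow> 0 < Re (ip x x)"
  using inner_productD(4)[OF inner] by blast

lemma ip_self_eq_0: "ip x x = 0 \<longleftrightarrow> x = 0"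
  using ip_self_pos[of x] by force

lemma ip_self_nonneg: "0 \<le> Re (ip x x)"
  using ip_self_pos[of x] by (cases "x = 0") auto

section \<open>Orthonormal bases and the spectral theorem\<close>

definition onb :: "nat \<Rightarrow> 'v set \<Rightarrow> (nat \<Rightarrow> 'v) \<Rightarrow> bool" where
  "onb n Y e \<longleftrightarrow> (\<forall>i<n. e i \<in> Y) \<and> (\<forall>i<n. \<forall>j<n. ip (e i) (e j) = (if i = j then 1 else 0)) \<and>
     (\<forall>x\<in>Y. x = (\<Sum>i<n. scale (ip x (e i)) (e i)))"

lemma onb_ip: "onb n Y e \<Longrightarrow> i < n \<Longrightarrow> j < n \<Longrightarrow> ip (e i) (e j) = (if i = j then 1 else 0)"
  by (simp add: onb_def)

lemma onb_expand: "onb n Y e \<Longrightarrow> x \<in> Y \<Longrightarrow> (\<Sum>i<n. scale (ip x (e i)) (e i)) = x"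
  by (metis onb_def)

lemma onb_ip_expand:
  assumes "onb n Y e" "x \<in> Y"
  shows "ip x y = (\<Sum>i<n. ip x (e i) * ip (e i) y)"
  by (subst onb_expand[OF assms, symmetric]) (simp add: ip_sum_left ip_scale_left)

text \<open>The hypothesis \<open>adj\<close> asks only that the orthogonal complement of each
  eigenvector in \<open>Y\<close> be invariant. Self-adjoint and unitary operators both satisfy it,
  and so does the identity, which yields orthonormal bases.\<close>

theorem spectral:
  assumes T: "Vector_Spaces.linear scale scale T"
    and Y: "subspace Y" "T ` Y \<subseteq> Y"
    and adj: "\<And>e z x. e \<in> Y \<Longrightarrow> e \<noteq> 0 \<Longrightarrow> T e = scale z e \<Longrightarrow> x \<in> Y \<Longrightarrow> ip x e = 0 \<Longrightarrow> ip (T x) e = 0"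
  shows "\<exists>e w. onb (dim Y) Y e \<and> (\<forall>i<dim Y. T (e i) = scale (w i) (e i))"
  using Y adj
proof (induction "dim Y" arbitrary: Y)
  case 0
  hence "Y \<subseteq> {0}" by simp
  hence "onb 0 Y (\<lambda>_. 0)" by (auto simp: onb_def)
  thus ?case using 0 by (metis not_less_zero)
next
  case (Suc n)
  interpret complex_endo scale Basis T
    by (intro complex_endo.intro complex_endo_axioms.intro finite_dimensional_vector_space_axioms T)
  from Suc.hyps(2) have "\<not> Y \<subseteq> {0}" by (metis dim_eq_0 nat.distinct(1))
  then obtain x where "x \<in> Y" "x \<noteq> 0" by blast
  then obtain v z where v: "v \<in> Y" "v \<noteq> 0" "T v = scale z v"
    using ex_eigenvector[OF Suc.prems(1,2)] by blast
  define u where "u = scale (1 / complex_of_real (sqrt (Re (ip v v)))) v"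
  have u: "u \<in> Y" "u \<noteq> 0" "T u = scale z u"
    using v ip_self_pos[OF v(2)] subspace_scale[OF Suc.prems(1)]
    by (auto simp: u_def T.scale scale_left_commute)
  have uu: "ip u u = 1"
    using ip_self_real[of v] ip_self_pos[OF v(2)]
    by (simp add: u_def ip_simps) (metis ip_self_nonneg nonzero_eq_divide_eq of_real_0 of_real_eq_iff of_real_mult real_sqrt_mult_self abs_of_nonneg less_irrefl)
  define Y' where "Y' = {y \<in> Y. ip y u = 0}"
  have Y': "subspace Y'"
    using Suc.prems(1) unfolding Y'_def subspace_def by (auto simp: ip_simps)
  have TY': "T ` Y' \<subseteq> Y'" unfolding Y'_def using Suc.prems(2) Suc.prems(3)[OF u] by auto
  have decomp: "x - scale (ip x u) u \<in> Y'" if "x \<in> Y" for x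
    unfolding Y'_def using that Suc.prems(1) u(1) uu
    by (auto simp: ip_simps intro: subspace_diff subspace_scale)
  have "Y \<subseteq> span (insert u Y')"
  proof
    fix x assume "x \<in> Y"
    hence "(x - scale (ip x u) u) + scale (ip x u) u \<in> span (insert u Y')"
      using decomp by (intro span_add span_scale) (auto intro: span_base)
    thus "x \<in> span (insert u Y')" by simp
  qed
  moreover have "insert u Y' \<subseteq> Y" using u Y'_def by auto
  ultimately have "dim Y = dim (insert u Y')" by (metis dim_mono dim_subset order_antisym)
  moreover have "u \<notin> span Y'" using Y' uu by (simp add: span_eq_iff[THEN iffD2] Y'_def)
  ultimately have dY': "n = dim Y'" using Suc.hyps(2) by (simp add: dim_insert)
  obtain e w where e: "onb n Y' e" "\<And>i. i < n \<Longrightarrow> T (e i) = scale (w i) (e i)"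
    using Suc.hyps(1)[OF dY' Y' TY'] Suc.prems(3) dY' unfolding Y'_def by blast
  define e' where "e' i = (if i < n then e i else u)" for i
  define w' where "w' i = (if i < n then w i else z)" for i
  have eu: "ip (e i) u = 0" "ip u (e i) = 0" "e i \<in> Y" if "i < n" for i
    using e(1) that ip_cnj[of "e i" u] by (auto simp: onb_def Y'_def)
  have "onb (Suc n) Y e'"
    unfolding onb_def
  proof (intro conjI allI impI ballI)
    show "e' i \<in> Y" for i using eu u by (simp add: e'_def)
    fix i j assume "i < Suc n" "j < Suc n"
    thus "ip (e' i) (e' j) = (if i = j then 1 else 0)"
      using eu uu onb_ip[OF e(1)] by (auto simp: e'_def less_Suc_eq)
  next
    fix x assume x: "x \<in> Y"
    let ?y = "x - scale (ip x u) u"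
    have "?y = (\<Sum>i<n. scale (ip ?y (e i)) (e i))" using onb_expand[OF e(1) decomp[OF x]] by simp
    also have "\<dots> = (\<Sum>i<n. scale (ip x (e i)) (e i))"
      by (intro sum.cong) (auto simp: ip_simps eu)
    finally have "x = (\<Sum>i<n. scale (ip x (e i)) (e i)) + scale (ip x u) u"
      by (metis diff_add_cancel)
    thus "x = (\<Sum>i<Suc n. scale (ip x (e' i)) (e' i))"
      by (simp add: e'_def)
  qed
  moreover have "T (e' i) = scale (w' i) (e' i)" for i
    using e(2) u(3) by (simp add: e'_def w'_def)
  ultimately show ?case using Suc.hyps(2) by metis
qed

lemma ex_onb: "subspace Y \<Longrightarrow> \<exists>e. onb (dim Y) Y e"
  using spectral[of "\<lambda>x. x" Y] linear_id by (auto simp: id_def)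

definition bas :: "nat \<Rightarrow> 'v" where "bas = (SOME e. onb N UNIV e)"

lemma onb_bas: "onb N UNIV bas"
  unfolding bas_def using ex_onb[OF subspace_UNIV] by (simp add: someI_ex)

section \<open>The norm of the inner product\<close>

definition nrm :: "'v \<Rightarrow> real" where "nrm x = sqrt (Re (ip x x))"

lemma nrm_L2: assumes "onb N UNIV e" shows "nrm x = L2_set (\<lambda>j. cmod (ip x (e j))) {..<N}"
proof -
  have "ip x x = (\<Sum>j<N. complex_of_real ((cmod (ip x (e j)))\<^sup>2))"
    unfolding onb_ip_expand[OF assms UNIV_I, of x x]
    by (intro sum.cong refl) (simp only: complex_norm_square ip_cnj)
  thus ?thesis unfolding nrm_def L2_set_def by simp
qed

lemma nrm_triangle: "nrm (x + y) \<le> nrm x + nrm y"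
proof -
  have "nrm (x + y) \<le> L2_set (\<lambda>j. cmod (ip x (bas j)) + cmod (ip y (bas j))) {..<N}"
    unfolding nrm_L2[OF onb_bas] by (intro L2_set_mono) (auto simp: ip_add_left norm_triangle_ineq)
  also have "\<dots> \<le> nrm x + nrm y" unfolding nrm_L2[OF onb_bas] by (rule L2_set_triangle_ineq)
  finally show ?thesis .
qed

lemma nrm_nonneg: "0 \<le> nrm x" unfolding nrm_def using ip_self_nonneg by simp

lemma norm_ip_commute: "cmod (ip x y) = cmod (ip y x)"
  by (metis complex_mod_cnj ip_cnj)

lemma cauchy_schwarz: "cmod (ip x y) \<le> nrm x * nrm y"
proof -
  have "cmod (ip x y) = cmod (\<Sum>j<N. ip x (bas j) * ip (bas j) y)"
    by (subst onb_ip_expand[OF onb_bas UNIV_I, of x y]) (rule refl)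
  also have "\<dots> \<le> (\<Sum>j<N. \<bar>cmod (ip x (bas j))\<bar> * \<bar>cmod (ip y (bas j))\<bar>)"
    by (rule order_trans[OF norm_sum]) (simp add: norm_mult norm_ip_commute[of "bas _" y])
  also have "\<dots> \<le> nrm x * nrm y" unfolding nrm_L2[OF onb_bas] by (rule L2_set_mult_ineq)
  finally show ?thesis .
qed

text \<open>In an orthonormal basis the norm involves finitely many coordinates, so weak convergence
  is norm convergence.\<close>

lemma nrm_tendsto_0:
  assumes "\<And>y. ((\<lambda>t. ip (p t) y) \<longlongrightarrow> ip x y) F"
  shows "((\<lambda>t. nrm (p t - x)) \<longlongrightarrow> 0) F"
proof -
  have "((\<lambda>t. sqrt (\<Sum>j<N. (cmod (ip (p t) (bas j) - ip x (bas j)))\<^sup>2)) \<longlongrightarrow> sqrt (\<Sum>j<N. (cmod (ip x (bas j) - ip x (bas j)))\<^sup>2)) F"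
    by (intro tendsto_intros assms)
  thus ?thesis by (simp add: nrm_L2[OF onb_bas] L2_set_def ip_diff_left)
qed

subsection \<open>Determinants\<close>

definition mat_of :: "('v \<Rightarrow> 'v) \<Rightarrow> complex mat" where
  "mat_of T = Matrix.mat N N (\<lambda>(i, j). ip (T (bas j)) (bas i))"

text \<open>The determinant in the fixed basis \<open>bas\<close>. It serves to show that the
  product of the eigenvalues is multiplicative and that the characteristic polynomial varies
  continuously with the operator.\<close>

definition opdet :: "('v \<Rightarrow> 'v) \<Rightarrow> complex" where "opdet T = Determinant.det (mat_of T)"

lemma mat_of_carrier [simp]: "mat_of T \<in> carrier_mat N N"
  by (simp add: mat_of_def)

lemma opdet_comp:
  assumes S: "Vector_Spaces.linear scale scale S"
  shows "opdet (\<lambda>x. S (T x)) = opdet S * opdet T"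
proof -
  interpret S: Vector_Spaces.linear scale scale S by fact
  have "mat_of (\<lambda>x. S (T x)) = mat_of S * mat_of T"
  proof (rule eq_matI)
    fix i j assume "i < dim_row (mat_of S * mat_of T)" "j < dim_col (mat_of S * mat_of T)"
    hence ij: "i < N" "j < N" by (simp_all add: mat_of_def)
    have "ip (S (T (bas j))) (bas i) = ip (S (\<Sum>k<N. scale (ip (T (bas j)) (bas k)) (bas k))) (bas i)"
      using onb_expand[OF onb_bas] by simp
    also have "\<dots> = (\<Sum>k<N. ip (T (bas j)) (bas k) * ip (S (bas k)) (bas i))"
      by (simp add: S.sum S.scale ip_sum_left ip_scale_left)
    finally show "mat_of (\<lambda>x. S (T x)) $$ (i, j) = (mat_of S * mat_of T) $$ (i, j)"
      using ij by (simp add: mat_of_def scalar_prod_def lessThan_atLeast0 mult.commute)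
  qed (simp_all add: mat_of_def)
  thus ?thesis unfolding opdet_def using det_mult[OF mat_of_carrier mat_of_carrier] by metis
qed

lemma opdet_id: "opdet (\<lambda>x. x) = 1"
proof -
  have "mat_of (\<lambda>x. x) = 1\<^sub>m N"
    by (rule eq_matI) (auto simp: mat_of_def onb_ip[OF onb_bas])
  thus ?thesis by (simp add: opdet_def)
qed

lemma linear_comb: "Vector_Spaces.linear scale scale (\<lambda>x. \<Sum>j<n. scale (ip x (e j)) (v j))"
  unfolding Vector_Spaces.linear_iff using vector_space_axioms
  by (simp add: ip_simps scale_left_distrib sum.distrib scale_sum_right)

lemma comb_onb:
  assumes "onb n Y e" "j < n" shows "(\<Sum>i<n. scale (ip (e j) (e i)) (v i)) = v j"
proof -
  have "(\<Sum>i<n. scale (ip (e j) (e i)) (v i)) = (\<Sum>i<n. if i = j then v i else 0)"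
    using assms by (intro sum.cong) (auto simp: onb_ip)
  thus ?thesis using assms(2) by simp
qed

lemma opdet_cong: "(\<And>j. j < N \<Longrightarrow> S (bas j) = T (bas j)) \<Longrightarrow> opdet S = opdet T"
  unfolding opdet_def mat_of_def by (intro arg_cong[of _ _ Determinant.det] cong_mat) auto

text \<open>Independence of the basis: \<open>P\<close> carries \<open>bas\<close> to the eigenbasis
  \<open>f\<close>, \<open>D\<close> is the diagonal operator on \<open>bas\<close>, and
  \<open>T P = P D\<close> on basis vectors. The determinant of \<open>P\<close> cancels because
  \<open>P'\<close> is a right inverse of \<open>P\<close>.\<close>

lemma opdet_diag:
  assumes T: "Vector_Spaces.linear scale scale T" and f: "onb N UNIV f"
    and eig: "\<And>j. j < N \<Longrightarrow> T (f j) = scale (w j) (f j)"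
  shows "opdet T = (\<Prod>j<N. w j)"
proof -
  interpret T: Vector_Spaces.linear scale scale T by fact
  define P where "P x = (\<Sum>j<N. scale (ip x (bas j)) (f j))" for x
  define P' where "P' x = (\<Sum>j<N. scale (ip x (f j)) (bas j))" for x
  define D where "D x = (\<Sum>j<N. scale (ip x (bas j)) (scale (w j) (bas j)))" for x
  have lin: "Vector_Spaces.linear scale scale P" "Vector_Spaces.linear scale scale P'"
    unfolding P_def P'_def by (rule linear_comb)+
  interpret P: Vector_Spaces.linear scale scale P by fact
  have Pb: "P (bas j) = f j" "P' (f j) = bas j" "D (bas j) = scale (w j) (bas j)" if "j < N" for j
    unfolding P_def P'_def D_def by (rule comb_onb[OF onb_bas that] comb_onb[OF f that])+
  have "P (P' x) = x" for x
    unfolding P'_def by (simp add: P.sum P.scale Pb onb_expand[OF f])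
  hence "opdet (\<lambda>x. P (P' x)) = 1" using opdet_id by simp
  hence PP: "opdet P * opdet P' = 1" unfolding opdet_comp[OF lin(1), of P'] .
  have "opdet (\<lambda>x. T (P x)) = opdet (\<lambda>x. P (D x))"
    by (rule opdet_cong) (simp add: Pb eig P.scale)
  hence "opdet T * opdet P = opdet P * opdet D"
    unfolding opdet_comp[OF T, of P] opdet_comp[OF lin(1), of D] .
  hence TD: "opdet T = opdet D" using PP by (metis mult.commute mult_cancel_left mult_zero_left zero_neq_one)
  have Dij: "mat_of D $$ (i, j) = (if i = j then w i else 0)" if "i < N" "j < N" for i j
    using that by (simp add: mat_of_def Pb ip_scale_left onb_ip[OF onb_bas])
  have "upper_triangular (mat_of D)"
    unfolding upper_triangular_def using Dij by (auto simp: mat_of_def)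
  hence "opdet D = prod_list (diag_mat (mat_of D))"
    unfolding opdet_def by (rule det_upper_triangular[OF _ mat_of_carrier])
  also have "diag_mat (mat_of D) = map w [0..<N]"
    unfolding diag_mat_def using Dij by (intro nth_equalityI) (auto simp: mat_of_def)
  also have "prod_list \<dots> = (\<Prod>j<N. w j)"
    by (simp add: prod.distinct_set_conv_list[symmetric] lessThan_atLeast0)
  finally show ?thesis using TD by simp
qed

lemma linear_resolvent:
  assumes "Vector_Spaces.linear scale scale T"
  shows "Vector_Spaces.linear scale scale (\<lambda>x. scale z x - T x)"
proof -
  interpret T: Vector_Spaces.linear scale scale T by fact
  show ?thesis unfolding Vector_Spaces.linear_iff using vector_space_axioms
    by (simp add: T.add T.scale algebra_simps scale_left_commute)
qed

lemma opdet_resolvent: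
  assumes "Vector_Spaces.linear scale scale T" "onb N UNIV f"
    and "\<And>j. j < N \<Longrightarrow> T (f j) = scale (w j) (f j)"
  shows "opdet (\<lambda>x. scale z x - T x) = (\<Prod>j<N. z - w j)"
  by (rule opdet_diag[OF linear_resolvent assms(2)]) (simp_all add: assms scale_left_diff_distrib)

text \<open>The Leibniz expansion makes the determinant a polynomial in the matrix
  coefficients.\<close>

lemma continuous_on_opdet_resolvent:
  assumes "\<And>x y. continuous_on S (\<lambda>t. ip (W t x) y)"
  shows "continuous_on S (\<lambda>t. opdet (\<lambda>x. scale z x - W t x))"
proof -
  have "opdet (\<lambda>x. scale z x - W t x) = (\<Sum>p | p permutes {0..<N}. signof p *
      (\<Prod>i = 0..<N. z * ip (bas (p i)) (bas i) - ip (W t (bas (p i))) (bas i)))" for t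
    unfolding opdet_def det_def'[OF mat_of_carrier]
  proof (intro sum.cong refl arg_cong2[of _ _ _ _ "(*)"] prod.cong)
    fix p i assume "p \<in> {p. p permutes {0..<N}}" "i \<in> {0..<N}"
    hence "i < N" "p i < N" using permutes_in_image[of p "{0..<N}" i] by auto
    thus "mat_of (\<lambda>x. scale z x - W t x) $$ (i, p i) = z * ip (bas (p i)) (bas i) - ip (W t (bas (p i))) (bas i)"
      by (simp add: mat_of_def ip_simps)
  qed
  thus ?thesis by (simp add: continuous_intros assms)
qed

subsection \<open>Eigenvalues with multiplicity\<close>

definition diagonalized :: "('v \<Rightarrow> 'v) \<Rightarrow> (nat \<Rightarrow> 'v) \<Rightarrow> (nat \<Rightarrow> complex) \<Rightarrow> bool" where
  "diagonalized T f w \<longleftrightarrow> Vector_Spaces.linear scale scale T \<and> onb N UNIV f \<and>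
     (\<forall>j<N. T (f j) = scale (w j) (f j))"

definition eigs :: "('v \<Rightarrow> 'v) \<Rightarrow> complex multiset" where
  "eigs T = (SOME E. \<exists>f w. diagonalized T f w \<and> E = image_mset w (mset_set {..<N}))"

text \<open>This makes the choice in \<open>eigs\<close> immaterial: every diagonalization has the
  same characteristic product, the determinant of \<open>scale z x - T x\<close>, and that product
  determines the multiset.\<close>

lemma eigs_eq:
  assumes "diagonalized T f w" shows "eigs T = image_mset w (mset_set {..<N})"
proof -
  have "\<exists>E f w. diagonalized T f w \<and> E = image_mset w (mset_set {..<N})" using assms by blast
  hence "\<exists>f w. diagonalized T f w \<and> eigs T = image_mset w (mset_set {..<N})"
    unfolding eigs_def by (rule someI_ex)
  then obtain f' w' where f': "diagonalized T f' w'" "eigs T = image_mset w' (mset_set {..<N})" by blast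
  have "(\<Prod>j<N. z - w' j) = (\<Prod>j<N. z - w j)" for z
    using opdet_resolvent[of T f w z] opdet_resolvent[of T f' w' z] assms f'(1) by (simp add: diagonalized_def)
  hence "image_mset w' (mset_set {..<N}) = image_mset w (mset_set {..<N})" by (rule image_mset_eq_of_prod_eq)
  thus ?thesis using f'(2) by simp
qed

lemma dim_span_onb:
  assumes f: "onb n Y f" and J: "J \<subseteq> {..<n}" shows "dim (span (f ` J)) = card J"
proof -
  have inj: "inj_on f {..<n}"
    by (rule inj_onI) (metis lessThan_iff onb_ip[OF f] zero_neq_one)
  have fin: "finite J" using J finite_subset by blast
  have "independent (f ` J)"
  proof (rule independent_if_scalars_zero)
    fix c x assume s: "(\<Sum>x\<in>f ` J. scale (c x) x) = 0" and "x \<in> f ` J"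
    then obtain j where j: "j \<in> J" "x = f j" by blast
    have "0 = ip (\<Sum>i\<in>J. scale (c (f i)) (f i)) (f j)"
      using s inj J by (subst (asm) sum.reindex) (auto intro: inj_on_subset)
    also have "\<dots> = (\<Sum>i\<in>J. if i = j then c (f i) else 0)"
      unfolding ip_sum_left using j J by (intro sum.cong) (auto simp: ip_scale_left onb_ip[OF f] subset_iff)
    also have "\<dots> = c x" using j fin by simp
    finally show "c x = 0" by simp
  qed (use fin in simp)
  thus ?thesis using inj J by (simp add: dim_eq_card_independent card_image inj_on_subset)
qed

lemma diagonalized_coord:
  assumes d: "diagonalized T f w" and j: "j < N"
  shows "ip (T x) (f j) = w j * ip x (f j)"
proof -
  interpret T: Vector_Spaces.linear scale scale T using d by (simp add: diagonalized_def)
  have f: "onb N UNIV f" and e: "\<And>j. j < N \<Longrightarrow> T (f j) = scale (w j) (f j)"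
    using d by (auto simp: diagonalized_def)
  have "ip (T x) (f j) = ip (T (\<Sum>i<N. scale (ip x (f i)) (f i))) (f j)"
    using onb_expand[OF f] by simp
  also have "\<dots> = (\<Sum>i<N. ip x (f i) * (w i * ip (f i) (f j)))"
    by (simp add: T.sum T.scale ip_sum_left ip_scale_left e mult.assoc)
  also have "\<dots> = (\<Sum>i<N. if i = j then w j * ip x (f j) else 0)"
    using j by (intro sum.cong) (auto simp: onb_ip[OF f])
  finally show ?thesis using j by simp
qed

text \<open>Three nested spaces coincide: the span of the basis vectors with eigenvalue
  \<open>z\<close>, the eigenspace, and the generalized eigenspace. The second formula has the shape
  in which \<open>alg_mult\<close> counts.\<close>

lemma count_eigs:
  assumes d: "diagonalized T f w"
  shows "count (eigs T) z = dim {x. T x = scale z x}"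
    and "count (eigs T) z = dim {x. \<exists>n. ((\<lambda>x. T x - scale z x) ^^ n) x = 0}"
proof -
  have f: "onb N UNIV f" and e: "\<And>j. j < N \<Longrightarrow> T (f j) = scale (w j) (f j)"
    using d by (auto simp: diagonalized_def)
  let ?J = "{j. j < N \<and> w j = z}"
  interpret T: Vector_Spaces.linear scale scale T using d by (simp add: diagonalized_def)
  have c: "count (eigs T) z = dim (span (f ` ?J))"
    by (subst dim_span_onb[OF f]) (auto simp: eigs_eq[OF d] count_image_mset_set)
  have sub: "span (f ` ?J) \<subseteq> {x. T x = scale z x}"
  proof (rule span_minimal)
    show "subspace {x. T x = scale z x}"
      unfolding subspace_def by (auto simp: T.zero T.add T.scale scale_right_distrib scale_left_commute)
  qed (auto simp: e)
  have sub2: "{x. T x = scale z x} \<subseteq> {x. \<exists>n. ((\<lambda>x. T x - scale z x) ^^ n) x = 0}"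
    by (auto intro!: exI[of _ 1])
  have sub3: "{x. \<exists>n. ((\<lambda>x. T x - scale z x) ^^ n) x = 0} \<subseteq> span (f ` ?J)"
  proof clarify
    fix x n assume x: "((\<lambda>x. T x - scale z x) ^^ n) x = 0"
    \<comment> \<open>Powers of \<open>T - z\<close> act on the coordinate along \<open>f j\<close>
      by powers of \<open>w j - z\<close>, which forces the coordinates with
      \<open>w j \<noteq> z\<close> to vanish.\<close>
    have "ip (((\<lambda>x. T x - scale z x) ^^ n) y) (f j) = (w j - z) ^ n * ip y (f j)" if "j < N" for j y n
      by (induction n) (simp_all add: ip_diff_left ip_scale_left diagonalized_coord[OF d that] algebra_simps)
    hence "(w j - z) ^ n * ip x (f j) = 0" if "j < N" for j using that x by (metis ip_0_left)
    hence "ip x (f j) = 0" if "j < N" "w j \<noteq> z" for j using that by auto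
    hence "scale (ip x (f j)) (f j) \<in> span (f ` ?J)" if "j < N" for j
      using that by (cases "w j = z") (auto intro: span_scale span_base span_zero)
    hence "(\<Sum>j<N. scale (ip x (f j)) (f j)) \<in> span (f ` ?J)" by (intro span_sum) auto
    thus "x \<in> span (f ` ?J)" using onb_expand[OF f] by simp
  qed
  show "count (eigs T) z = dim {x. T x = scale z x}"
    "count (eigs T) z = dim {x. \<exists>n. ((\<lambda>x. T x - scale z x) ^^ n) x = 0}"
    unfolding c by (rule arg_cong[of _ _ dim], use sub sub2 sub3 in blast)+
qed

section \<open>Unitary operators and their continuous families\<close>

definition unitary :: "('v \<Rightarrow> 'v) \<Rightarrow> bool" where
  "unitary W \<longleftrightarrow> Vector_Spaces.linear scale scale W \<and> (\<forall>x y. ip (W x) (W y) = ip x y)"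

lemma unitary_inj: assumes "unitary W" shows "inj W"
proof (rule injI)
  fix x y assume "W x = W y"
  moreover have "ip (x - y) (x - y) = ip (W x - W y) (W x - W y)"
    using assms by (simp add: unitary_def ip_diff_left ip_diff_right)
  ultimately show "x = y" using ip_self_eq_0[of "x - y"] by simp
qed

lemma unitary_bij: assumes "unitary W" shows "bij W"
  using unitary_inj[OF assms] linear_inj_imp_surj[of W] assms by (simp add: unitary_def bij_def)

lemma unitary_comp: "unitary W \<Longrightarrow> unitary V \<Longrightarrow> unitary (\<lambda>x. W (V x))"
  unfolding unitary_def Vector_Spaces.linear_iff by simp

lemma unitary_inv: assumes "unitary W" shows "unitary (inv_into UNIV W)"
proof -
  interpret W: Vector_Spaces.linear scale scale W using assms by (simp add: unitary_def)
  have s: "W (inv_into UNIV W x) = x" for x using unitary_bij[OF assms] by (simp add: bij_is_surj surj_f_inv_f)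
  have "inv_into UNIV W (x + y) = inv_into UNIV W x + inv_into UNIV W y" for x y
    by (rule injD[OF unitary_inj[OF assms]]) (simp add: s W.add)
  moreover have "inv_into UNIV W (scale c x) = scale c (inv_into UNIV W x)" for x c
    by (rule injD[OF unitary_inj[OF assms]]) (simp add: s W.scale)
  moreover have "ip (inv_into UNIV W x) (inv_into UNIV W y) = ip x y" for x y
    using assms s unfolding unitary_def by metis
  ultimately show ?thesis unfolding unitary_def Vector_Spaces.linear_iff using vector_space_axioms by blast
qed

lemma unitary_id: "unitary (\<lambda>x. x)"
  unfolding unitary_def Vector_Spaces.linear_iff using vector_space_axioms by simp

text \<open>Preservation of the inner product gives the eigenvalues modulus 1 and, as they are
  nonzero, makes the complement of an eigenvector invariant.\<close>

lemma unitary_diag: assumes "unitary W" shows "\<exists>f w. diagonalized W f w \<and> (\<forall>j<N. cmod (w j) = 1)"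
proof -
  have lin: "Vector_Spaces.linear scale scale W" and iso: "\<And>x y. ip (W x) (W y) = ip x y"
    using assms by (auto simp: unitary_def)
  have unit: "cmod z = 1" if "W e = scale z e" "e \<noteq> 0" for e z
  proof -
    have "ip (scale z e) (scale z e) = ip e e" using iso[of e e] that(1) by simp
    hence "ip e e = z * cnj z * ip e e"
      by (simp only: ip_scale_left ip_scale_right mult.left_commute mult.assoc)
    moreover have "ip e e \<noteq> 0" using that(2) ip_self_eq_0 by blast
    ultimately have "z * cnj z = 1" by (metis mult_cancel_right1)
    hence "(cmod z)\<^sup>2 = 1" by (metis complex_norm_square of_real_eq_1_iff)
    thus ?thesis using power2_eq_imp_eq[of "cmod z" 1] by simp
  qed
  have "ip (W x) e = 0" if "W e = scale z e" "e \<noteq> 0" "ip x e = 0" for x e z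
  proof -
    have "cnj z * ip (W x) e = 0" using iso[of x e] that by (simp add: ip_simps)
    thus ?thesis using unit[OF that(1,2)] by auto
  qed
  hence "\<exists>f w. onb N UNIV f \<and> (\<forall>i<N. W (f i) = scale (w i) (f i))"
    using lin spectral[of W UNIV] by (simp add: subspace_UNIV)
  then obtain f w where fw: "onb N UNIV f" "\<forall>i<N. W (f i) = scale (w i) (f i)" by blast
  have "f i \<noteq> 0" if "i < N" for i using onb_ip[OF fw(1) that that] by force
  thus ?thesis using fw unit lin unfolding diagonalized_def by blast
qed

lemma prod_eigs_comp:
  assumes "unitary W" "unitary V"
  shows "prod_mset (eigs (\<lambda>x. W (V x))) = prod_mset (eigs W) * prod_mset (eigs V)"
proof -
  have "prod_mset (eigs T) = opdet T" if T: "unitary T" for T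
  proof -
    obtain f w where "diagonalized T f w" using unitary_diag[OF T] by blast
    thus ?thesis using eigs_eq[of T f w] opdet_diag[of T f w]
      by (simp add: diagonalized_def prod_unfold_prod_mset)
  qed
  thus ?thesis using assms unitary_comp opdet_comp[of W V] by (simp add: unitary_def)
qed

text \<open>The eigenbases \<open>f t\<close> are chosen pointwise, with no continuity. The lift
  exists because the characteristic product is continuous in \<open>t\<close>.\<close>

lemma ex_angle_lift_eigs:
  assumes U: "\<And>t. t \<in> {a..b} \<Longrightarrow> unitary (W t)"
    and cont: "\<And>x y. continuous_on {a..b} (\<lambda>t. ip (W t x) y)" and "a \<le> b"
  shows "\<exists>\<theta>. angle_lift N a b (\<lambda>t. eigs (W t)) \<theta>"
proof -
  have "\<forall>t\<in>{a..b}. \<exists>f w. diagonalized (W t) f w \<and> (\<forall>j<N. cmod (w j) = 1)"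
    using unitary_diag[OF U] by blast
  then obtain f w where fw: "\<And>t. t \<in> {a..b} \<Longrightarrow> diagonalized (W t) (f t) (w t)"
    "\<And>t j. t \<in> {a..b} \<Longrightarrow> j < N \<Longrightarrow> cmod (w t j) = 1" by metis
  have "continuous_on {a..b} (\<lambda>t. \<Prod>j<N. z - w t j)" for z
  proof (rule continuous_on_eq[OF continuous_on_opdet_resolvent[OF cont]])
    fix t assume "t \<in> {a..b}"
    thus "opdet (\<lambda>x. scale z x - W t x) = (\<Prod>j<N. z - w t j)"
      using opdet_resolvent[of "W t" "f t" "w t" z] fw(1) by (simp add: diagonalized_def)
  qed
  then obtain \<theta> where "angle_lift N a b (\<lambda>t. image_mset (w t) (mset_set {..<N})) \<theta>"
    using ex_angle_lift[of a b N w] fw(2) \<open>a \<le> b\<close> by blast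
  thus ?thesis using eigs_eq[OF fw(1)] unfolding angle_lift_def by auto
qed

text \<open>The projection \<open>H\<close> onto the eigenvectors with \<open>Im (w j) > 0\<close>
  is injective on \<open>U\<close>: for a vector in its kernel, \<open>Im (ip (W x) x)\<close> is a
  sum of nonpositive terms.\<close>

lemma dim_positive_le_eigs:
  assumes W: "unitary W" and U: "subspace U" and pos: "\<And>u. u \<in> U \<Longrightarrow> u \<noteq> 0 \<Longrightarrow> Im (ip (W u) u) > 0"
  shows "dim U \<le> size (filter_mset (\<lambda>z. Im z > 0) (eigs W))"
proof -
  obtain f w where d: "diagonalized W f w" using unitary_diag[OF W] by blast
  have f: "onb N UNIV f" using d by (simp add: diagonalized_def)
  let ?J = "{j. j < N \<and> Im (w j) > 0}"
  define H where "H x = (\<Sum>j<N. scale (ip x (f j)) (if j \<in> ?J then f j else 0))" for x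
  have linH: "Vector_Spaces.linear scale scale H" unfolding H_def by (rule linear_comb)
  interpret H: Vector_Spaces.linear scale scale H by fact
  interpret pr: finite_dimensional_vector_space_pair_1 scale Basis scale by unfold_locales
  have "x = 0" if x: "x \<in> U" "H x = 0" for x
  proof (rule ccontr)
    assume "x \<noteq> 0"
    have zero: "ip x (f j) = 0" if "j \<in> ?J" for j
    proof -
      have "0 = ip (H x) (f j)" using x by simp
      also have "\<dots> = (\<Sum>i<N. if i = j then ip x (f j) else 0)"
        unfolding H_def ip_sum_left using that
        by (intro sum.cong) (auto simp: ip_scale_left onb_ip[OF f])
      finally show ?thesis using that by simp
    qed
    have "ip (W x) x = (\<Sum>j<N. w j * complex_of_real ((cmod (ip x (f j)))\<^sup>2))"
      unfolding onb_ip_expand[OF f UNIV_I, of "W x" x]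
      by (intro sum.cong) (auto simp: diagonalized_coord[OF d] complex_norm_square ip_cnj simp del: of_real_power)
    hence "Im (ip (W x) x) = (\<Sum>j<N. Im (w j) * (cmod (ip x (f j)))\<^sup>2)"
      by (simp add: Im_sum)
    also have "\<dots> \<le> 0"
    proof (rule sum_nonpos)
      fix j assume "j \<in> {..<N}"
      thus "Im (w j) * (cmod (ip x (f j)))\<^sup>2 \<le> 0"
        using zero[of j] by (cases "Im (w j) > 0") (auto intro: mult_nonpos_nonneg)
    qed
    finally show False using pos[OF x(1) \<open>x \<noteq> 0\<close>] by simp
  qed
  hence "inj_on H (span U)"
    using H.inj_on_iff_eq_0[of "span U"] U by (simp add: span_eq_iff[THEN iffD2])
  hence "dim U = dim (H ` U)" using pr.dim_image_eq[OF linH] by metis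
  also have "H x \<in> span (f ` ?J)" for x
    unfolding H_def by (intro span_sum span_scale) (auto intro: span_base span_zero)
  hence "dim (H ` U) \<le> dim (f ` ?J)" by (intro dim_mono) auto
  also have "\<dots> = card ?J" using dim_span_onb[OF f, of ?J] by auto
  also have "\<dots> = size (filter_mset (\<lambda>z. Im z > 0) (eigs W))"
  proof -
    have "{j \<in> {..<N}. Im (w j) > 0} = ?J" by auto
    thus ?thesis by (simp add: eigs_eq[OF d] filter_mset_image_mset filter_mset_mset_set)
  qed
  finally show ?thesis .
qed

text \<open>Unitary operators preserve norms, so \<open>W s x\<close> and \<open>W s (p s)\<close>
  are exactly as far apart as \<open>x\<close> and \<open>p s\<close>. Hence it is enough to follow
  some vectors \<open>p s\<close> tending to \<open>x\<close> whose images tend to the image of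
  \<open>x\<close>. This suits operators given by parametrized graphs, where the images of moving
  vectors are explicit and inverses are not.\<close>

lemma unitary_continuous:
  assumes U: "\<And>t. t \<in> S \<Longrightarrow> unitary (W t)"
    and ex: "\<And>t x. t \<in> S \<Longrightarrow> \<exists>p. (\<forall>y. ((\<lambda>s. ip (p s) y) \<longlongrightarrow> ip x y) (at t within S)) \<and>
       (\<forall>y. ((\<lambda>s. ip (W s (p s)) y) \<longlongrightarrow> ip (W t x) y) (at t within S))"
  shows "continuous_on S (\<lambda>t. ip (W t x) y)"
  unfolding continuous_on_def
proof
  fix t assume t: "t \<in> S"
  obtain p where p: "\<And>y. ((\<lambda>s. ip (p s) y) \<longlongrightarrow> ip x y) (at t within S)"
    "\<And>y. ((\<lambda>s. ip (W s (p s)) y) \<longlongrightarrow> ip (W t x) y) (at t within S)" using ex[OF t, of x] by metis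
  have "((\<lambda>s. (nrm (p s - x) + nrm (W s (p s) - W t x)) * nrm y) \<longlongrightarrow> (0 + 0) * nrm y) (at t within S)"
    by (intro tendsto_intros nrm_tendsto_0 p)
  hence lim: "((\<lambda>s. (nrm (p s - x) + nrm (W s (p s) - W t x)) * nrm y) \<longlongrightarrow> 0) (at t within S)" by simp
  have bound: "cmod (ip (W s x) y - ip (W t x) y) \<le> (nrm (p s - x) + nrm (W s (p s) - W t x)) * nrm y"
    if s: "s \<in> S" for s
  proof -
    interpret Ws: Vector_Spaces.linear scale scale "W s" using U[OF s] by (simp add: unitary_def)
    have iso: "nrm (W s v) = nrm v" for v using U[OF s] by (simp add: unitary_def nrm_def)
    have e: "W s x - W t x = W s (x - p s) + (W s (p s) - W t x)" by (simp add: Ws.diff)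
    have "nrm (W s x - W t x) \<le> nrm (x - p s) + nrm (W s (p s) - W t x)"
      unfolding e using nrm_triangle[of "W s (x - p s)" "W s (p s) - W t x"] by (simp only: iso)
    moreover have "nrm (x - p s) = nrm (p s - x)" by (simp add: nrm_def ip_simps algebra_simps)
    ultimately have "nrm (W s x - W t x) * nrm y \<le> (nrm (p s - x) + nrm (W s (p s) - W t x)) * nrm y"
      by (intro mult_right_mono nrm_nonneg) simp
    thus ?thesis using cauchy_schwarz[of "W s x - W t x" y] by (simp add: ip_diff_left)
  qed
  have "((\<lambda>s. ip (W s x) y - ip (W t x) y) \<longlongrightarrow> 0) (at t within S)"
  proof (rule Lim_null_comparison[OF _ lim])
    have "eventually (\<lambda>s. s \<in> S) (at t within S)" by (simp add: eventually_at_filter)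
    thus "eventually (\<lambda>s. cmod (ip (W s x) y - ip (W t x) y)
        \<le> (nrm (p s - x) + nrm (W s (p s) - W t x)) * nrm y) (at t within S)"
      by eventually_elim (rule bound)
  qed
  thus "((\<lambda>t. ip (W t x) y) \<longlongrightarrow> ip (W t x) y) (at t within S)"
    by (simp add: LIM_zero_iff)
qed

text \<open>Follow the moving vectors \<open>V s v\<close> with \<open>V t v = x\<close>: the
  quotient sends them to \<open>W s v\<close>.\<close>

lemma unitary_continuous_quotient:
  assumes U: "\<And>t. t \<in> S \<Longrightarrow> unitary (W t)" and V: "\<And>t. t \<in> S \<Longrightarrow> unitary (V t)"
    and W: "\<And>x y. continuous_on S (\<lambda>t. ip (W t x) y)" and cV: "\<And>x y. continuous_on S (\<lambda>t. ip (V t x) y)"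
  shows "continuous_on S (\<lambda>t. ip (W t (inv_into UNIV (V t) x)) y)"
proof (rule unitary_continuous)
  fix t assume t: "t \<in> S"
  show "unitary (\<lambda>x. W t (inv_into UNIV (V t) x))" by (rule unitary_comp[OF U[OF t] unitary_inv[OF V[OF t]]])
  fix x
  let ?v = "inv_into UNIV (V t) x"
  have inv: "inv_into UNIV (V s) (V s v) = v" "V s (inv_into UNIV (V s) v) = v" if "s \<in> S" for s v
    using unitary_bij[OF V[OF that]] unitary_inj[OF V[OF that]] by (simp_all add: bij_is_surj surj_f_inv_f)
  have "((\<lambda>s. ip (V s ?v) y) \<longlongrightarrow> ip x y) (at t within S)" for y
    using cV[of ?v y] t inv(2)[OF t, of x] by (metis continuous_on_def)
  moreover have "((\<lambda>s. ip (W s (inv_into UNIV (V s) (V s ?v))) y) \<longlongrightarrow> ip (W t ?v) y) (at t within S)" for y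
  proof (rule Lim_transform_eventually)
    show "((\<lambda>s. ip (W s ?v) y) \<longlongrightarrow> ip (W t ?v) y) (at t within S)"
      using W[of ?v y] t by (simp add: continuous_on_def)
    have "eventually (\<lambda>s. s \<in> S) (at t within S)" by (simp add: eventually_at_filter)
    thus "eventually (\<lambda>s. ip (W s ?v) y = ip (W s (inv_into UNIV (V s) (V s ?v))) y) (at t within S)"
      by eventually_elim (simp add: inv(1))
  qed
  ultimately show "\<exists>p. (\<forall>y. ((\<lambda>s. ip (p s) y) \<longlongrightarrow> ip x y) (at t within S)) \<and>
      (\<forall>y. ((\<lambda>s. ip (W s (inv_into UNIV (V s) (p s))) y) \<longlongrightarrow> ip (W t (inv_into UNIV (V t) x)) y) (at t within S))"
    by (intro exI[of _ "\<lambda>s. V s ?v"]) blast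
qed

end

section \<open>The triple defect of two unitary operators\<close>

lemma one_minus_cis: "1 - cis x = -2 * \<i> * complex_of_real (sin (x / 2)) * cis (x / 2)"
  using cos_double_sin[of "x / 2"] sin_double[of "x / 2"]
  by (simp add: complex_eq_iff power2_eq_square)

lemma defect_1: "defect 1 = 0"
  by (simp add: defect_def)

text \<open>The ceilings of \<open>x\<close> and \<open>-x\<close> add up to 1 if \<open>x\<close>
  is not an integer and to 0 if it is; this is the exception at \<open>z = 1\<close>.\<close>

lemma defect_cnj:
  assumes "cmod z = 1" shows "defect (cnj z) = (if z = 1 then 0 else 1 - defect z)"
proof -
  have z: "z = cis (Arg z)" using assms cis_Arg[of z] by (force simp: sgn_div_norm)
  define x where "x = Arg z / (2 * pi)"
  have c: "defect (cnj z) = of_int \<lceil>- x\<rceil> + x" "defect z = of_int \<lceil>x\<rceil> - x"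
    using defect_cis[of "- Arg z"] defect_cis[of "Arg z"] z unfolding x_def
    by (metis cis_cnj minus_divide_left diff_minus_eq_add, metis)
  have b: "- (1 / 2) < x" "x \<le> 1 / 2" using Arg_bounded[of z] unfolding x_def by (simp_all add: field_simps)
  show ?thesis
  proof (cases "z = 1")
    case False
    hence "x \<noteq> 0" using z unfolding x_def by auto
    hence "\<lceil>x\<rceil> = (if x > 0 then 1 else 0)" "\<lceil>- x\<rceil> = (if x > 0 then 0 else 1)"
      using b by (auto simp: ceiling_eq_iff)
    thus ?thesis using c False by auto
  qed (simp add: defect_def)
qed

text \<open>No argument lies above 0 and up to \<open>\<epsilon>\<close>. Turning back by
  \<open>\<epsilon>\<close> therefore brings no positive argument down to 0, and the angle 0 itself
  goes to \<open>-\<epsilon>\<close>, whose ceiling is still 0. All ceilings stay, and the defect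
  grows by the rotation alone. A turn in the other direction would move the angle 0 past its
  ceiling.\<close>

lemma defect_rotate:
  assumes "cmod z = 1" and "z = 1 \<or> \<epsilon> < Arg2pi z" and "0 < \<epsilon>" "\<epsilon> < 2 * pi"
  shows "defect (cis (- \<epsilon>) * z) = defect z + \<epsilon> / (2 * pi)"
proof -
  define x where "x = (if z = 1 then 0 else Arg2pi z)"
  have z: "z = cis x"
    using assms(1) complex_norm_eq_1_exp[of z] by (auto simp: x_def cis_conv_exp)
  have x: "x = 0 \<or> (\<epsilon> < x \<and> x < 2 * pi)" using assms(2) Arg2pi_lt_2pi[of z] by (auto simp: x_def)
  have "\<lceil>(x - \<epsilon>) / (2 * pi)\<rceil> = \<lceil>x / (2 * pi)\<rceil>"
  proof (cases "x = 0")
    case True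
    hence "\<lceil>(x - \<epsilon>) / (2 * pi)\<rceil> = 0" using assms by (intro ceiling_unique) (simp_all add: field_simps)
    thus ?thesis using True by simp
  next
    case False
    hence "\<lceil>(x - \<epsilon>) / (2 * pi)\<rceil> = 1" "\<lceil>x / (2 * pi)\<rceil> = 1"
      using assms x by (intro ceiling_unique; simp add: field_simps)+
    thus ?thesis by simp
  qed
  moreover have "cis (- \<epsilon>) * z = cis (x - \<epsilon>)" by (simp add: z cis_mult add.commute)
  ultimately show ?thesis unfolding z by (simp add: defect_cis diff_divide_distrib)
qed

text \<open>The number \<open>l\<close> splits the pair \<open>(1, cis (- \<epsilon>))\<close> into
  \<open>1 - l\<close> times \<open>(1, cis (- \<epsilon>) * w)\<close> and \<open>l\<close> times
  \<open>(1, 1)\<close>; the second claim is this equation. The third carries the value of the form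
  through the change of splitting, and the fourth is the positivity gained by the rotation.\<close>

lemma rotation_multiplier:
  fixes w :: complex
  assumes "cmod w = 1" "w = 1 \<or> \<epsilon> < Arg2pi w" and "0 < \<epsilon>" "\<epsilon> < 2 * pi"
  defines "l \<equiv> (w - 1) / (w - cis \<epsilon>)"
  shows "w \<noteq> cis \<epsilon>" and "cis (- \<epsilon>) * w * (1 - l) + l = cis (- \<epsilon>)"
    and "(1 - cis (- \<epsilon>) * w) * cnj l = 1 - w" and "l = 0 \<or> Im ((1 - cis (- \<epsilon>)) * cnj l) > 0"
proof -
  show ne: "w \<noteq> cis \<epsilon>"
  proof
    assume w: "w = cis \<epsilon>"
    have "Arg2pi (cis \<epsilon>) = \<epsilon>" using assms by (intro Arg2pi_unique[of 1]) (auto simp: cis_conv_exp)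
    hence "cis \<epsilon> = cis 0" using assms(2) w by simp
    then obtain n :: int where "\<epsilon> = 0 + 2 * pi * n" using cis_eq_cis_iff by blast
    hence n: "\<epsilon> = 2 * pi * n" by simp
    hence "0 < real_of_int n" "real_of_int n < 1" using assms(3,4) pi_gt_zero by (simp_all add: zero_less_mult_iff)
    hence "0 < n" "n < 1" by simp_all
    thus False by simp
  qed
  have ce: "cis (- \<epsilon>) * cis \<epsilon> = 1" by (simp add: cis_mult)
  have l: "l * (w - cis \<epsilon>) = w - 1" using ne by (simp add: l_def)
  have "cis (- \<epsilon>) * w * (1 - l) + l - cis (- \<epsilon>) = cis (- \<epsilon>) * (w - 1) - l * (cis (- \<epsilon>) * w - 1)"
    by (simp add: algebra_simps)
  also have "cis (- \<epsilon>) * w - 1 = cis (- \<epsilon>) * (w - cis \<epsilon>)" using ce by (simp add: algebra_simps)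
  also have "l * (cis (- \<epsilon>) * (w - cis \<epsilon>)) = cis (- \<epsilon>) * (w - 1)"
    using l by (metis mult.left_commute)
  finally show "cis (- \<epsilon>) * w * (1 - l) + l = cis (- \<epsilon>)" by simp
  have ww: "w * cnj w = 1" using assms(1) by (simp add: complex_norm_square[symmetric])
  have "cnj l * (cnj w - cis (- \<epsilon>)) = cnj w - 1"
    using arg_cong[OF l, of cnj] by (simp add: cis_cnj)
  hence "w * (cnj l * (cnj w - cis (- \<epsilon>))) = w * (cnj w - 1)" by simp
  hence "cnj l * (w * cnj w - cis (- \<epsilon>) * w) = w * cnj w - w" by (simp add: algebra_simps)
  thus eq: "(1 - cis (- \<epsilon>) * w) * cnj l = 1 - w" unfolding ww by (simp add: mult.commute)
  show "l = 0 \<or> Im ((1 - cis (- \<epsilon>)) * cnj l) > 0"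
  proof (cases "w = 1")
    case False
    define x where "x = Arg2pi w"
    have x: "w = cis x" "\<epsilon> < x" "x < 2 * pi"
      using assms(1,2) False complex_norm_eq_1_exp[of w] Arg2pi_lt_2pi[of w] by (auto simp: x_def cis_conv_exp)
    \<comment> \<open>Half-angle sines, positive because \<open>\<epsilon> < x < 2 * pi\<close> puts
      all three arguments strictly between 0 and pi. The aim is
      \<open>cnj l = (b / d) cis (\<epsilon> / 2)\<close>, whose phase cancels that of
      \<open>1 - cis (- \<epsilon>)\<close> up to the factor \<open>i\<close>.\<close>
    define a b d where "a = sin (\<epsilon> / 2)" and "b = sin (x / 2)" and "d = sin ((x - \<epsilon>) / 2)"
    have pos: "a > 0" "b > 0" "d > 0"
      unfolding a_def b_def d_def using x assms(3,4) by (auto intro!: sin_gt_zero)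
    have 1: "1 - cis (- \<epsilon>) = 2 * \<i> * complex_of_real a * cis (- (\<epsilon> / 2))"
      using one_minus_cis[of "- \<epsilon>"] by (simp add: a_def)
    have 2: "1 - w = -2 * \<i> * complex_of_real b * cis (x / 2)" using one_minus_cis[of x] x by (simp add: b_def)
    have 3: "1 - cis (- \<epsilon>) * w = -2 * \<i> * complex_of_real d * cis ((x - \<epsilon>) / 2)"
      using one_minus_cis[of "x - \<epsilon>"] x by (simp add: d_def cis_mult add.commute)
    have "(-2 * \<i> * complex_of_real d * cis ((x - \<epsilon>) / 2)) * cnj l = -2 * \<i> * complex_of_real b * cis (x / 2)"
      using eq unfolding 2 3 .
    hence "complex_of_real d * cis ((x - \<epsilon>) / 2) * cnj l = complex_of_real b * cis (x / 2)"
      by (simp add: mult.assoc)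
    hence "cis (- (x - \<epsilon>) / 2) * (complex_of_real d * cis ((x - \<epsilon>) / 2) * cnj l)
       = cis (- (x - \<epsilon>) / 2) * (complex_of_real b * cis (x / 2))" by simp
    hence "complex_of_real d * (cis (- (x - \<epsilon>) / 2) * cis ((x - \<epsilon>) / 2)) * cnj l
       = complex_of_real b * (cis (- (x - \<epsilon>) / 2) * cis (x / 2))" by (simp only: ac_simps)
    hence "complex_of_real d * cnj l = complex_of_real b * cis (\<epsilon> / 2)"
      by (simp add: cis_mult diff_divide_distrib)
    hence cl: "cnj l = complex_of_real (b / d) * cis (\<epsilon> / 2)" using pos by (simp add: field_simps)
    have "(1 - cis (- \<epsilon>)) * cnj l = 2 * \<i> * complex_of_real (a * b / d) * (cis (- (\<epsilon> / 2)) * cis (\<epsilon> / 2))"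
      unfolding 1 cl by simp
    hence "(1 - cis (- \<epsilon>)) * cnj l = 2 * \<i> * complex_of_real (a * b / d)" by (simp add: cis_mult)
    thus ?thesis using pos by simp
  qed (simp add: l_def)
qed

lemma ex_uniform_constant:
  fixes \<tau> l :: "nat \<Rightarrow> real"
  assumes "\<And>j. j < n \<Longrightarrow> (l j = 0 \<and> \<tau> j = 0) \<or> \<tau> j > 0"
  shows "\<exists>c>0. \<forall>j<n. c * (l j)\<^sup>2 \<le> \<tau> j"
  using assms
proof (induction n)
  case (Suc n)
  then obtain c where c: "c > 0" "\<forall>j<n. c * (l j)\<^sup>2 \<le> \<tau> j" by auto
  show ?case
  proof (cases "l n = 0")
    case True
    hence "\<tau> n \<ge> 0" using Suc.prems[of n] by auto
    thus ?thesis using True c by (auto intro!: exI[of _ c] simp: less_Suc_eq)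
  next
    case False
    hence t: "\<tau> n > 0" using Suc.prems[of n] by auto
    define d where "d = min c (\<tau> n / (l n)\<^sup>2)"
    have "d > 0" using c t False by (simp add: d_def)
    moreover have "d * (l n)\<^sup>2 \<le> \<tau> n" using False by (simp add: d_def field_simps min_le_iff_disj) (simp add: min_def field_simps)
    moreover have "d * (l j)\<^sup>2 \<le> \<tau> j" if "j < n" for j
    proof -
      have "d * (l j)\<^sup>2 \<le> c * (l j)\<^sup>2" by (rule mult_right_mono) (simp_all add: d_def)
      thus ?thesis using c that by fastforce
    qed
    ultimately show ?thesis by (auto intro!: exI[of _ d] simp: less_Suc_eq)
  qed
qed (auto intro: exI[of _ 1])

section \<open>Total defects under inversion and rotation, and the estimate of the triple
  defect\<close>

context hermitian_space begin

lemma count_eigs_1: assumes "unitary W" shows "count (eigs W) 1 = dim {x. W x = x}"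
  using unitary_diag[OF assms] count_eigs(1)[of W _ _ 1] by force

lemma eigs_norm: assumes "unitary W" "z \<in># eigs W" shows "cmod z = 1"
  using unitary_diag[OF assms(1)] assms(2) eigs_eq[of W] by force

lemma total_defect_id: "total_defect (eigs (\<lambda>x. x)) = 0"
proof -
  have "diagonalized (\<lambda>x. x) bas (\<lambda>_. 1)"
    using unitary_id onb_bas by (simp add: diagonalized_def unitary_def)
  thus ?thesis by (simp add: eigs_eq total_defect_image defect_def)
qed

lemma total_defect_inv:
  assumes W: "unitary W"
  shows "total_defect (eigs (inv_into UNIV W)) = real N - real (dim {x. W x = x}) - total_defect (eigs W)"
proof -
  obtain f w where d: "diagonalized W f w" and u: "\<forall>j<N. cmod (w j) = 1" using unitary_diag[OF W] by blast
  interpret W: Vector_Spaces.linear scale scale "inv_into UNIV W"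
    using unitary_inv[OF W] by (simp add: unitary_def)
  have "inv_into UNIV W (f j) = scale (cnj (w j)) (f j)" if j: "j < N" for j
  proof -
    have "W (f j) = scale (w j) (f j)" using d j by (simp add: diagonalized_def)
    hence "f j = scale (w j) (inv_into UNIV W (f j))"
      by (metis W.scale inv_into_f_f unitary_inj[OF W] UNIV_I)
    hence "scale (cnj (w j)) (f j) = scale (cnj (w j) * w j) (inv_into UNIV W (f j))" by (metis scale_scale)
    moreover have "cnj (w j) * w j = 1" using u j complex_norm_square[of "w j"] by (simp add: mult.commute)
    ultimately show ?thesis by simp
  qed
  hence d': "diagonalized (inv_into UNIV W) f (\<lambda>j. cnj (w j))"
    using d unitary_inv[OF W] by (simp add: diagonalized_def unitary_def)
  have "total_defect (eigs (inv_into UNIV W)) = (\<Sum>j<N. (1 - defect (w j)) - (if w j = 1 then 1 else 0))"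
    unfolding eigs_eq[OF d'] total_defect_image
    using u by (intro sum.cong) (auto simp: defect_cnj defect_1)
  also have "\<dots> = real N - total_defect (eigs W) - real (card {j. j < N \<and> w j = 1})"
    by (simp add: sum_subtractf eigs_eq[OF d] total_defect_image sum.If_cases Int_def)
  also have "card {j. j < N \<and> w j = 1} = dim {x. W x = x}"
    using count_eigs_1[OF W] by (simp add: eigs_eq[OF d] count_image_mset_set)
  finally show ?thesis by simp
qed

lemma unitary_rotate:
  assumes "unitary W" shows "unitary (\<lambda>x. scale (cis t) (W x))"
proof -
  have "cis t * cnj (cis t) = 1" by (simp add: cis_cnj cis_mult)
  thus ?thesis using assms unfolding unitary_def Vector_Spaces.linear_iff
    by (simp add: ip_simps scale_right_distrib scale_left_commute mult.left_commute[of "cis t"] mult.assoc[symmetric] mult.commute)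
qed

lemma total_defect_rotate:
  assumes W: "unitary W" and \<epsilon>: "0 < \<epsilon>" "\<epsilon> < 2 * pi"
    and gap: "\<And>z. z \<in># eigs W \<Longrightarrow> z = 1 \<or> \<epsilon> < Arg2pi z"
  shows "total_defect (eigs (\<lambda>x. scale (cis (- \<epsilon>)) (W x))) = total_defect (eigs W) + real N * \<epsilon> / (2 * pi)"
proof -
  obtain f w where d: "diagonalized W f w" and u: "\<forall>j<N. cmod (w j) = 1" using unitary_diag[OF W] by blast
  have "diagonalized (\<lambda>x. scale (cis (- \<epsilon>)) (W x)) f (\<lambda>j. cis (- \<epsilon>) * w j)"
    using d unitary_rotate[OF W, of "- \<epsilon>"] by (simp add: diagonalized_def unitary_def)
  hence "total_defect (eigs (\<lambda>x. scale (cis (- \<epsilon>)) (W x))) = (\<Sum>j<N. defect (cis (- \<epsilon>) * w j))"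
    by (simp add: eigs_eq total_defect_image)
  also have "\<dots> = (\<Sum>j<N. defect (w j) + \<epsilon> / (2 * pi))"
    using u gap \<epsilon> by (intro sum.cong) (auto intro!: defect_rotate simp: eigs_eq[OF d])
  finally show ?thesis by (simp add: sum.distrib eigs_eq[OF d] total_defect_image)
qed

lemma ex_constant_lift:
  assumes "unitary W" shows "\<exists>\<alpha>. angle_lift N a b (\<lambda>_. eigs W) (\<lambda>j _. \<alpha> j)"
proof -
  obtain f w where d: "diagonalized W f w" and u: "\<forall>j<N. cmod (w j) = 1" using unitary_diag[OF assms] by blast
  have "cis (Arg (w j)) = w j" if "j < N" for j
    using u that cis_Arg[of "w j"] by (force simp: sgn_div_norm)
  hence "angle_lift N a b (\<lambda>_. eigs W) (\<lambda>j _. Arg (w j))"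
    unfolding angle_lift_def eigs_eq[OF d] by (auto intro!: image_mset_cong)
  thus ?thesis by (intro exI[of _ "\<lambda>j. Arg (w j)"])
qed

text \<open>The operators \<open>Q\<close> and \<open>R\<close> stand for the Lagrangians \<open>{(x, Q x)}\<close> and \<open>{(x, R x)}\<close>, both
  transversal to the diagonal; they are joined by the segment
  \<open>{(y + s z, Q y + s z)}\<close>, where \<open>(x, R x) = (y, Q y) + (z, z)\<close>. Along it no eigenvalue of
  \<open>R\<^sub>s\<close> meets \<open>1\<close>, and for small \<open>s > 0\<close> the eigenvalues of \<open>R\<^sub>s Q\<^sup>-\<^sup>1\<close> leave \<open>1\<close> in the direction
  given by the sign of the form \<open>Im \<langle>y - Q y, z\<rangle>\<close>.\<close>

lemma triple_defect_transversal:
  fixes sd :: "complex \<Rightarrow> 'd::ab_group_add \<Rightarrow> 'd"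
  assumes Q: "unitary Q" and R: "unitary R"
    and Q1: "\<And>x. Q x = x \<Longrightarrow> x = 0" and R1: "\<And>x. R x = x \<Longrightarrow> x = 0"
    and fd: "finite_dimensional_vector_space sd Bd" and D: "module.subspace sd D"
    and Y: "Vector_Spaces.linear sd scale Y" and Z: "Vector_Spaces.linear sd scale Z"
    and rel: "\<And>p. p \<in> D \<Longrightarrow> R (Y p + Z p) = Q (Y p) + Z p"
    and c: "c > 0"
    and pos: "\<And>p. p \<in> D \<Longrightarrow> p \<noteq> 0 \<Longrightarrow> Z p \<noteq> 0 \<and> Im (ip (Y p - Q (Y p)) (Z p)) \<ge> c * Re (ip (Z p) (Z p))"
  shows "real (vector_space.dim sd D) \<le>
     total_defect (eigs (\<lambda>x. R (inv_into UNIV Q x))) + total_defect (eigs Q) - total_defect (eigs R)"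
proof -
  interpret d: finite_dimensional_vector_space sd Bd by fact
  interpret Q: Vector_Spaces.linear scale scale Q using Q by (simp add: unitary_def)
  interpret R: Vector_Spaces.linear scale scale R using R by (simp add: unitary_def)
  interpret Y: Vector_Spaces.linear sd scale Y by fact
  interpret Z: Vector_Spaces.linear sd scale Z by fact
  interpret dp: finite_dimensional_vector_space_pair_1 sd Bd scale by unfold_locales
  have isoQ: "ip (Q x) (Q y) = ip x y" for x y using Q by (simp add: unitary_def)
  have isoR: "ip (R x) (R y) = ip x y" for x y using R by (simp add: unitary_def)
  have Qinv: "Q (inv_into UNIV Q x) = x" "inv_into UNIV Q (Q x) = x" for x
    using unitary_bij[OF Q] unitary_inj[OF Q] by (simp_all add: bij_is_surj surj_f_inv_f)
  define S where "S x = Q x - x" for x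
  have linS: "Vector_Spaces.linear scale scale S"
    unfolding Vector_Spaces.linear_iff S_def using vector_space_axioms
    by (simp add: Q.add Q.scale algebra_simps)
  interpret S: Vector_Spaces.linear scale scale S by fact
  have injS: "inj S" unfolding S.inj_iff_eq_0 using Q1 by (simp add: S_def)
  have surjS: "surj S" by (rule linear_inj_imp_surj[OF linS injS])
  \<comment> \<open>Solving \<open>x = y + z\<close> and \<open>R x = Q y + z\<close> gives
    \<open>(Q - 1) y = (R - 1) x\<close>, and \<open>S = Q - 1\<close> is invertible because
    \<open>Q\<close> fixes no nonzero vector.\<close>
  define y where "y x = inv_into UNIV S (R x - x)" for x
  define z where "z x = x - y x" for x
  have Sy: "S (y x) = R x - x" for x unfolding y_def using surjS by (simp add: surj_f_inv_f)
  have y_unique: "y x = v" if "S v = R x - x" for x v using that Sy[of x] injS by (metis injD)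
  have Rx: "R x = Q (y x) + z x" for x using Sy[of x] by (simp add: S_def z_def algebra_simps)
  have yz: "x = y x + z x" for x by (simp add: z_def)
  have y_add: "y (a + b) = y a + y b" for a b
    by (rule y_unique) (simp add: S.add Sy R.add algebra_simps)
  have y_scale: "y (scale k a) = scale k (y a)" for k a
    by (rule y_unique) (simp add: S.scale Sy R.scale scale_right_diff_distrib)
  have z_add: "z (a + b) = z a + z b" for a b by (simp add: z_def y_add)
  have z_scale: "z (scale k a) = scale k (z a)" for k a by (simp add: z_def y_scale scale_right_diff_distrib)
  have yD: "y (Y p + Z p) = Y p" "z (Y p + Z p) = Z p" if "p \<in> D" for p
  proof -
    show "y (Y p + Z p) = Y p"
      by (rule y_unique) (simp add: rel[OF that] S_def)
    thus "z (Y p + Z p) = Z p" by (simp add: z_def)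
  qed
  define A where "A s x = y x + scale (complex_of_real s) (z x)" for s x
  define C where "C s x = Q (y x) + scale (complex_of_real s) (z x)" for s x
  \<comment> \<open>\<open>A s x\<close> and \<open>C s x\<close> are the two components of a point
    of the segment. The difference of the two sides is linear in \<open>s\<close> without constant
    term, and its coefficient is zero because \<open>R\<close> is an isometry, which is the case
    \<open>s = 1\<close>.\<close>
  have AC: "ip (C s x) (C s x') = ip (A s x) (A s x')" for s x x'
  proof -
    have "ip (Q (y x) + z x) (Q (y x') + z x') = ip (y x + z x) (y x' + z x')"
      using isoR[of x x'] Rx yz by metis
    hence e: "ip (Q (y x)) (z x') + ip (z x) (Q (y x')) = ip (y x) (z x') + ip (z x) (y x')"
      by (simp add: ip_simps isoQ algebra_simps)
    have "ip (C s x) (C s x') - ip (A s x) (A s x') =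
       complex_of_real s * ((ip (Q (y x)) (z x') + ip (z x) (Q (y x'))) - (ip (y x) (z x') + ip (z x) (y x')))"
      unfolding A_def C_def by (simp add: ip_simps isoQ algebra_simps)
    thus ?thesis using e by simp
  qed
  have linA: "Vector_Spaces.linear scale scale (A s)" for s
    unfolding Vector_Spaces.linear_iff A_def using vector_space_axioms
    by (simp add: y_add y_scale z_add z_scale algebra_simps scale_left_commute)
  have linC: "Vector_Spaces.linear scale scale (C s)" for s
    unfolding Vector_Spaces.linear_iff C_def using vector_space_axioms
    by (simp add: y_add y_scale z_add z_scale Q.add Q.scale algebra_simps scale_left_commute)
  \<comment> \<open>The segment stays a graph: if the first component vanishes, so does the second
    by \<open>AC\<close>; then \<open>Q\<close> fixes \<open>y x\<close>, and after
    \<open>y x = 0\<close> the operator \<open>R\<close> fixes \<open>x\<close>.\<close>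
  have "x = 0" if "A s x = 0" for s x
  proof -
    have "ip (C s x) (C s x) = 0" using AC[of s x x] that by simp
    hence "C s x = 0" by (simp add: ip_self_eq_0)
    hence "Q (y x) = y x" using that by (simp add: A_def C_def) (metis add_right_cancel)
    hence "y x = 0" by (rule Q1)
    hence "R x = x" using Rx[of x] by (simp add: z_def Q.zero)
    thus ?thesis by (rule R1)
  qed
  hence injA: "inj (A s)" for s
    using linA[of s] by (metis Vector_Spaces.linear.axioms(3) module_hom.inj_iff_eq_0)
  hence surjA: "surj (A s)" for s using linear_inj_imp_surj[OF linA] by blast
  define W where "W s v = C s (inv_into UNIV (A s) v)" for s v
  have WA: "W s (A s x) = C s x" for s x using injA by (simp add: W_def)
  have AW: "\<exists>x. v = A s x" for s v using surjA by (metis surjD)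
  have UW: "unitary (W s)" for s
  proof -
    interpret A: Vector_Spaces.linear scale scale "A s" by (rule linA)
    interpret C: Vector_Spaces.linear scale scale "C s" by (rule linC)
    have "W s (u + v) = W s u + W s v" for u v
    proof -
      obtain a b where "u = A s a" "v = A s b" using AW by metis
      thus ?thesis by (simp add: A.add[symmetric] WA C.add)
    qed
    moreover have "W s (scale k u) = scale k (W s u)" for k u
    proof -
      obtain a where "u = A s a" using AW by metis
      thus ?thesis by (simp add: A.scale[symmetric] WA C.scale)
    qed
    moreover have "ip (W s u) (W s v) = ip u v" for u v
    proof -
      obtain a b where "u = A s a" "v = A s b" using AW by metis
      thus ?thesis by (simp add: WA AC)
    qed
    ultimately show ?thesis unfolding unitary_def Vector_Spaces.linear_iff using vector_space_axioms by blast
  qed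
  have A1: "A 1 x = x" and C1: "C 1 x = R x" for x
    unfolding A_def C_def using yz[of x] Rx[of x] by simp_all
  have W1: "W 1 = R" using WA[of 1] by (simp add: A1 C1 fun_eq_iff)
  have W0: "W 0 = Q"
  proof
    fix v obtain x where "v = A 0 x" using AW by metis
    thus "W 0 v = Q v" by (simp add: WA) (simp add: A_def C_def)
  qed
  have contW: "continuous_on {0..1} (\<lambda>s. ip (W s x) v)" for x v
  proof (rule unitary_continuous[OF UW])
    fix t x
    obtain a where a: "x = A t a" using AW by metis
    have "((\<lambda>s. ip (A s a) v) \<longlongrightarrow> ip x v) (at t within {0..1})"
      "((\<lambda>s. ip (W s (A s a)) v) \<longlongrightarrow> ip (W t x) v) (at t within {0..1})" for v
      unfolding a WA unfolding A_def C_def ip_add_left ip_scale_left by (intro tendsto_intros)+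
    thus "\<exists>p. (\<forall>y. ((\<lambda>s. ip (p s) y) \<longlongrightarrow> ip x y) (at t within {0..1})) \<and>
       (\<forall>y. ((\<lambda>s. ip (W s (p s)) y) \<longlongrightarrow> ip (W t x) y) (at t within {0..1}))"
      by (intro exI[of _ "\<lambda>s. A s a"]) blast
  qed
  \<comment> \<open>\<open>P\<close> runs from the identity to the quotient of \<open>R\<close> by
    \<open>Q\<close>. As \<open>P s\<close> composed with the constant \<open>Q\<close> is
    \<open>W s\<close>, its total angle moves exactly as that of \<open>W\<close>, which never meets
    the eigenvalue 1.\<close>
  define P where "P s v = W s (inv_into UNIV Q v)" for s v
  have UP: "unitary (P s)" for s unfolding P_def by (rule unitary_comp[OF UW unitary_inv[OF Q]])
  obtain \<rho> where \<rho>: "angle_lift N 0 1 (\<lambda>s. eigs (W s)) \<rho>"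
    using ex_angle_lift_eigs[of 0 1 W] UW contW by auto
  obtain \<pi> where \<pi>: "angle_lift N 0 1 (\<lambda>s. eigs (P s)) \<pi>"
    using ex_angle_lift_eigs[of 0 1 P] UP contW by (auto simp: P_def)
  obtain \<alpha> where \<alpha>: "angle_lift N 0 1 (\<lambda>s. eigs Q) (\<lambda>j _. \<alpha> j)" using ex_constant_lift[OF Q] by blast
  have PQ: "(\<lambda>x. P s (Q x)) = W s" for s by (simp add: P_def Qinv)
  have "prod_mset (eigs (P s)) * prod_mset (eigs Q) = prod_mset (eigs (W s))" for s
    using prod_eigs_comp[OF UP[of s] Q] PQ by simp
  from angle_sum_additive[OF \<pi> \<alpha> \<rho> this]
  have sums: "(\<Sum>j<N. \<pi> j 1) - (\<Sum>j<N. \<pi> j 0) = (\<Sum>j<N. \<rho> j 1) - (\<Sum>j<N. \<rho> j 0)" by simp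
  have "v = 0" if "W s v = v" for s v
  proof -
    obtain x where x: "v = A s x" using AW by metis
    hence "Q (y x) = y x" using that by (simp add: WA) (simp add: A_def C_def)
    hence "y x = 0" by (rule Q1)
    hence "R x = x" using Rx[of x] by (simp add: z_def Q.zero)
    hence "x = 0" by (rule R1)
    thus ?thesis using x linA[of s] by (metis Vector_Spaces.linear.axioms(3) module_hom.zero)
  qed
  hence "{v. W s v = v} \<subseteq> {0}" for s by blast
  hence "count (eigs (W s)) 1 = 0" for s by (simp add: count_eigs_1[OF UW])
  hence "\<lceil>\<rho> j 0 / (2 * pi)\<rceil> = \<lceil>\<rho> j 1 / (2 * pi)\<rceil>" if "j < N" for j
    using ceiling_angle_constant[OF \<rho> _ _ that, of 0] by simp
  hence "crossings N \<rho> 0 1 = 0" by (simp add: crossings_def)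
  hence "((\<Sum>j<N. \<rho> j 1) - (\<Sum>j<N. \<rho> j 0)) / (2 * pi) + total_defect (eigs R) - total_defect (eigs Q) = 0"
    using crossings_eq[OF \<rho>] by (simp add: W0 W1)
  moreover have P0: "P 0 = (\<lambda>x. x)" and P1: "P 1 = (\<lambda>x. R (inv_into UNIV Q x))"
    by (auto simp: P_def W0 W1 Qinv)
  moreover have "of_int (crossings N \<pi> 0 1) =
      ((\<Sum>j<N. \<pi> j 1) - (\<Sum>j<N. \<pi> j 0)) / (2 * pi) + total_defect (eigs (P 1)) - total_defect (eigs (P 0))"
    using crossings_eq[OF \<pi>] by simp
  ultimately have T: "of_int (crossings N \<pi> 0 1) =
      total_defect (eigs (\<lambda>x. R (inv_into UNIV Q x))) + total_defect (eigs Q) - total_defect (eigs R)"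
    using sums total_defect_id by simp
  have "eventually (\<lambda>s. \<forall>j\<in>{..<N}. dist (\<pi> j s) (\<pi> j 0) < pi) (at 0 within {0..1})"
  proof (subst eventually_ball_finite_distrib)
    show "\<forall>j\<in>{..<N}. eventually (\<lambda>s. dist (\<pi> j s) (\<pi> j 0) < pi) (at 0 within {0..1})"
      using \<pi> by (auto simp: angle_lift_def continuous_on_def intro!: tendstoD)
  qed simp
  then obtain \<delta> where \<delta>: "\<delta> > 0"
    "\<And>s. s \<in> {0..1} \<Longrightarrow> s \<noteq> 0 \<Longrightarrow> dist s 0 < \<delta> \<Longrightarrow> \<forall>j\<in>{..<N}. dist (\<pi> j s) (\<pi> j 0) < pi"
    unfolding eventually_at by blast
  \<comment> \<open>Below \<open>\<delta>\<close> the angles of \<open>P\<close> are still within pi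
    of their start; below \<open>c\<close> the term of the form that is quadratic in
    \<open>s\<close> is dominated by the linear one.\<close>
  define s where "s = Min {1, \<delta> / 2, c / 2}"
  have s: "0 < s" "s \<le> 1" "s < \<delta>" "s < c" using \<delta>(1) c by (auto simp: s_def min_def)
  have near: "\<bar>\<pi> j s - \<pi> j 0\<bar> < pi" if "j < N" for j
    using \<delta>(2)[of s] s that by (auto simp: dist_real_def)
  \<comment> \<open>For positive parameters the eigenspace of 1 is always the image under
    \<open>Q\<close> of the vectors on which \<open>R\<close> and \<open>Q\<close> agree, so no
    ceiling changes after the short time \<open>s\<close>.\<close>
  have fixP: "{v. P t v = v} = Q ` {x. R x = Q x}" if t: "t > 0" for t
  proof -
    have key: "W t (A t x) = Q (A t x) \<longleftrightarrow> z x = 0" for x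
    proof -
      have "W t (A t x) = Q (A t x) \<longleftrightarrow> scale (complex_of_real t) (z x) = scale (complex_of_real t) (Q (z x))"
        unfolding WA by (simp add: A_def C_def Q.add Q.scale)
      also have "\<dots> \<longleftrightarrow> Q (z x) = z x" using t by auto
      also have "\<dots> \<longleftrightarrow> z x = 0" using Q1 Q.zero by auto
      finally show ?thesis .
    qed
    have zR: "z x = 0 \<longleftrightarrow> R x = Q x" for x
    proof
      assume "z x = 0"
      thus "R x = Q x" using Rx[of x] yz[of x] by simp
    next
      assume "R x = Q x"
      hence "y x = x" by (intro y_unique) (simp add: S_def)
      thus "z x = 0" by (simp add: z_def)
    qed
    have Ax: "A t x = x" if "z x = 0" for x using that yz[of x] by (simp add: A_def)
    show ?thesis
    proof (intro equalityI subsetI)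
      fix v assume "v \<in> {v. P t v = v}"
      moreover obtain x where x: "inv_into UNIV Q v = A t x" using AW by metis
      ultimately have "W t (A t x) = Q (A t x)" using Qinv(1)[of v] by (simp add: P_def)
      hence "z x = 0" by (simp add: key)
      moreover from this have "v = Q x" using x Qinv(1)[of v] by (simp add: Ax)
      ultimately show "v \<in> Q ` {x. R x = Q x}" by (auto simp: zR)
    next
      fix v assume "v \<in> Q ` {x. R x = Q x}"
      then obtain x where x: "v = Q x" "z x = 0" by (auto simp: zR)
      hence "W t x = Q x" using key[of x] by (simp add: Ax)
      thus "v \<in> {v. P t v = v}" using x by (simp add: P_def Qinv)
    qed
  qed
  have ceil: "\<lceil>\<pi> j s / (2 * pi)\<rceil> = \<lceil>\<pi> j 1 / (2 * pi)\<rceil>" if "j < N" for j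
  proof (rule ceiling_angle_constant[of N s 1 "\<lambda>s. eigs (P s)" \<pi> _ j, OF _ _ _ that])
    show "angle_lift N s 1 (\<lambda>s. eigs (P s)) \<pi>" using angle_lift_subinterval[OF \<pi>] s by auto
    show "count (eigs (P t)) 1 = dim (Q ` {x. R x = Q x})" if "t \<in> {s..1}" for t
      using that s fixP[of t] by (simp add: count_eigs_1[OF UP])
  qed (use s in simp)
  have Ps: "eigs (P s) = image_mset (\<lambda>j. cis (\<pi> j s)) (mset_set {..<N})"
    and P0': "eigs (P 0) = image_mset (\<lambda>j. cis (\<pi> j 0)) (mset_set {..<N})"
    using \<pi> s by (simp_all add: angle_lift_def)
  \<comment> \<open>All angles start at multiples of 2 pi. At time \<open>s\<close> each is within
    pi of its start, so its ceiling has not dropped, and it has risen if the sine is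
    positive.\<close>
  have "(if Im (cis (\<pi> j s)) > 0 then 1 else 0) \<le> \<lceil>\<pi> j 1 / (2 * pi)\<rceil> - \<lceil>\<pi> j 0 / (2 * pi)\<rceil>" if j: "j < N" for j
  proof -
    have "cis (\<pi> j 0) \<in># eigs (P 0)" unfolding P0' using j by auto
    hence "cis (\<pi> j 0) = 1"
      using count_eigs(1)[of "\<lambda>x. x" bas "\<lambda>_. 1"] unitary_id onb_bas eigs_eq[of "\<lambda>x. x" bas "\<lambda>_. 1"]
      by (auto simp: P0 diagonalized_def unitary_def)
    then obtain n :: int where n: "\<pi> j 0 = 2 * pi * n" using cis_eq_cis_iff[of "\<pi> j 0" 0] by auto
    hence c0: "\<lceil>\<pi> j 0 / (2 * pi)\<rceil> = n" by simp
    have b: "2 * pi * n - pi < \<pi> j s" "\<pi> j s < 2 * pi * n + pi" using near[OF j] n by auto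
    have "2 * pi * of_int n - 2 * pi < \<pi> j s" using b(1) pi_gt_zero by linarith
    hence "of_int n - 1 < \<pi> j s / (2 * pi)" by (simp add: field_simps)
    hence "n \<le> \<lceil>\<pi> j s / (2 * pi)\<rceil>" by linarith
    moreover have "n + 1 \<le> \<lceil>\<pi> j s / (2 * pi)\<rceil>" if "Im (cis (\<pi> j s)) > 0"
    proof -
      have "\<not> \<pi> j s - 2 * pi * n \<le> 0"
      proof
        assume "\<pi> j s - 2 * pi * n \<le> 0"
        hence "0 \<le> sin (2 * pi * n - \<pi> j s)" using b by (intro sin_ge_zero) auto
        moreover have "sin (2 * pi * n - \<pi> j s) = - sin (\<pi> j s)" by (simp add: sin_diff)
        ultimately show False using that by simp
      qed
      hence "of_int n < \<pi> j s / (2 * pi)" by (simp add: field_simps)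
      thus ?thesis by linarith
    qed
    ultimately show ?thesis unfolding c0 ceil[OF j, symmetric] by auto
  qed
  hence "(\<Sum>j<N. if Im (cis (\<pi> j s)) > 0 then 1 else 0) \<le> crossings N \<pi> 0 1"
    unfolding crossings_def by (intro sum_mono) auto
  hence cr: "int (size (filter_mset (\<lambda>z. Im z > 0) (eigs (P s)))) \<le> crossings N \<pi> 0 1"
    by (simp add: Ps filter_mset_image_mset filter_mset_mset_set sum.If_cases Int_def)
  \<comment> \<open>The test vector \<open>Q (A s x)\<close> for \<open>x = Y p + Z p\<close>;
    \<open>P s\<close> sends it to \<open>C s x\<close>. The imaginary part of their inner product
    is \<open>s\<close> times the given form plus \<open>s * s\<close> times a term bounded by
    Cauchy-Schwarz.\<close>
  define G where "G p = Q (Y p + scale (complex_of_real s) (Z p))" for p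
  have linG: "Vector_Spaces.linear sd scale G"
    unfolding Vector_Spaces.linear_iff G_def using vector_space_axioms d.vector_space_axioms
    by (simp add: Y.add Y.scale Z.add Z.scale Q.add Q.scale algebra_simps scale_left_commute)
  interpret G: Vector_Spaces.linear sd scale G by fact
  have Gpos: "Im (ip (P s (G p)) (G p)) > 0" if p: "p \<in> D" "p \<noteq> 0" for p
  proof -
    have "A s (Y p + Z p) = Y p + scale (complex_of_real s) (Z p)"
      "C s (Y p + Z p) = Q (Y p) + scale (complex_of_real s) (Z p)"
      using yD[OF p(1)] by (simp_all add: A_def C_def)
    hence "P s (G p) = Q (Y p) + scale (complex_of_real s) (Z p)"
      using WA[of s "Y p + Z p"] by (simp add: P_def G_def Qinv)
    hence "ip (P s (G p)) (G p) = ip (Y p) (Y p) + s * ip (Y p) (Z p) + s * cnj (ip (Q (Y p)) (Z p)) + s * s * ip (Z p) (Q (Z p))"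
      by (simp add: G_def Q.add Q.scale ip_simps isoQ ip_cnj algebra_simps)
    hence "Im (ip (P s (G p)) (G p)) = Im (ip (Y p) (Y p)) + s * Im (ip (Y p - Q (Y p)) (Z p)) + s * s * Im (ip (Z p) (Q (Z p)))"
      by (simp add: ip_diff_left algebra_simps)
    moreover have "Im (ip (Y p) (Y p)) = 0" using ip_self_real[of "Y p"] by (metis Im_complex_of_real)
    moreover have "\<bar>Im (ip (Z p) (Q (Z p)))\<bar> \<le> Re (ip (Z p) (Z p))"
    proof -
      have "\<bar>Im (ip (Z p) (Q (Z p)))\<bar> \<le> nrm (Z p) * nrm (Q (Z p))"
        using abs_Im_le_cmod cauchy_schwarz order_trans by blast
      thus ?thesis using ip_self_nonneg[of "Z p"] by (simp add: nrm_def isoQ)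
    qed
    moreover have "s * (c * Re (ip (Z p) (Z p))) \<le> s * Im (ip (Y p - Q (Y p)) (Z p))"
      using s(1) pos[OF p] by (intro mult_left_mono) auto
    moreover have "s * s * - Re (ip (Z p) (Z p)) \<le> s * s * Im (ip (Z p) (Q (Z p)))"
      using calculation(3) s(1) by (intro mult_left_mono) auto
    ultimately have "Im (ip (P s (G p)) (G p)) \<ge> s * (c * Re (ip (Z p) (Z p))) - s * s * Re (ip (Z p) (Z p))"
      by linarith
    moreover have "0 < Re (ip (Z p) (Z p))" using pos[OF p] ip_self_pos by blast
    moreover have "s * (c * Re (ip (Z p) (Z p))) - s * s * Re (ip (Z p) (Z p)) = s * (c - s) * Re (ip (Z p) (Z p))"
      by (simp add: algebra_simps)
    moreover have "s * (c - s) * Re (ip (Z p) (Z p)) > 0" using calculation(2) s by simp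
    ultimately show ?thesis by linarith
  qed
  have "inj_on G (d.span D)"
    using G.inj_on_iff_eq_0[of "d.span D"] D Gpos
    by (metis d.span_eq_iff ip_0_right less_irrefl zero_complex.simps(2) d.subspace_span)
  hence "d.dim D = dim (G ` D)" using dp.dim_image_eq[OF linG] by simp
  also have "\<dots> \<le> size (filter_mset (\<lambda>z. Im z > 0) (eigs (P s)))"
  proof (rule dim_positive_le_eigs[OF UP G.subspace_image[OF D]])
    fix u assume "u \<in> G ` D" "u \<noteq> 0"
    then obtain p where "p \<in> D" "u = G p" "p \<noteq> 0" using G.zero by blast
    thus "Im (ip (P s u) u) > 0" using Gpos by simp
  qed
  finally show ?thesis using cr T by linarith
qed

text \<open>Rotating the diagonal by a small angle makes it transversal to both Lagrangians without
  changing the triple defect, and it turns a semidefinite form into a definite one.\<close>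

lemma triple_defect_ge:
  fixes sd :: "complex \<Rightarrow> 'd::ab_group_add \<Rightarrow> 'd"
  assumes Q: "unitary Q" and R: "unitary R"
    and fd: "finite_dimensional_vector_space sd Bd" and D: "module.subspace sd D"
    and Y: "Vector_Spaces.linear sd scale Y" and Z: "Vector_Spaces.linear sd scale Z"
    and rel: "\<And>p. p \<in> D \<Longrightarrow> R (Y p + Z p) = Q (Y p) + Z p"
    and pos: "\<And>p. p \<in> D \<Longrightarrow> Im (ip (Y p - Q (Y p)) (Z p)) \<ge> 0"
    and ne: "\<And>p. p \<in> D \<Longrightarrow> Q (Z p) = Z p \<Longrightarrow> p = 0"
  shows "real (vector_space.dim sd D) \<le>
     total_defect (eigs (\<lambda>x. R (inv_into UNIV Q x))) + total_defect (eigs Q) - total_defect (eigs R)"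
proof -
  interpret d: finite_dimensional_vector_space sd Bd by fact
  interpret Q: Vector_Spaces.linear scale scale Q using Q by (simp add: unitary_def)
  interpret R: Vector_Spaces.linear scale scale R using R by (simp add: unitary_def)
  interpret Y: Vector_Spaces.linear sd scale Y by fact
  interpret Z: Vector_Spaces.linear sd scale Z by fact
  let ?E = "Arg2pi ` (set_mset (eigs Q + eigs R) - {1})"
  \<comment> \<open>Half the least argument of the eigenvalues different from 1, so that the gap
    holds for both operators. The inserted 1 covers the case of no such eigenvalue and keeps
    \<open>\<epsilon>\<close> below 2 pi.\<close>
  define \<epsilon> where "\<epsilon> = Min (insert 1 ?E) / 2"
  have E: "0 < \<theta>" if "\<theta> \<in> ?E" for \<theta>
  proof -
    obtain z where z: "z \<in># eigs Q + eigs R" "z \<noteq> 1" "\<theta> = Arg2pi z" using \<open>\<theta> \<in> ?E\<close> by blast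
    have "cmod z = 1" using z(1) eigs_norm[OF Q] eigs_norm[OF R] by auto
    hence "exp (\<i> * complex_of_real (Arg2pi z)) = z" by (simp add: complex_norm_eq_1_exp)
    hence "Arg2pi z \<noteq> 0" using z(2) by auto
    thus ?thesis using z(3) Arg2pi_ge_0[of z] by simp
  qed
  have M: "0 < Min (insert 1 ?E)" using E by (subst Min_gr_iff) auto
  have \<epsilon>: "0 < \<epsilon>" "\<epsilon> < 2 * pi"
  proof -
    have "Min (insert 1 ?E) \<le> 1" by (rule Min_le) auto
    thus "0 < \<epsilon>" "\<epsilon> < 2 * pi" using M pi_gt_zero pi_ge_two unfolding \<epsilon>_def by linarith+
  qed
  have gap: "z = 1 \<or> \<epsilon> < Arg2pi z" if "z \<in># eigs Q + eigs R" for z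
  proof (rule disjCI)
    assume "\<not> \<epsilon> < Arg2pi z"
    show "z = 1"
    proof (rule ccontr)
      assume "z \<noteq> 1"
      hence "Min (insert 1 ?E) \<le> Arg2pi z" using that by (intro Min_le) auto
      thus False using \<open>\<not> \<epsilon> < Arg2pi z\<close> M unfolding \<epsilon>_def by linarith
    qed
  qed
  obtain f w where dq: "diagonalized Q f w" and u: "\<And>j. j < N \<Longrightarrow> cmod (w j) = 1" using unitary_diag[OF Q] by blast
  have f: "onb N UNIV f" using dq by (simp add: diagonalized_def)
  have gw: "w j = 1 \<or> \<epsilon> < Arg2pi (w j)" if "j < N" for j
    by (rule gap) (use that in \<open>auto simp: eigs_eq[OF dq]\<close>)
  define l where "l j = (w j - 1) / (w j - cis \<epsilon>)" for j
  note mult = rotation_multiplier[OF u gw \<epsilon>, folded l_def]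
  define L where "L x = (\<Sum>j<N. scale (ip x (f j)) (scale (l j) (f j)))" for x
  have linL: "Vector_Spaces.linear scale scale L" unfolding L_def by (rule linear_comb)
  interpret L: Vector_Spaces.linear scale scale L by fact
  have "diagonalized L f l"
    unfolding diagonalized_def
  proof (intro conjI allI impI linL f)
    fix j assume "j < N"
    thus "L (f j) = scale (l j) (f j)" unfolding L_def by (rule comb_onb[OF f])
  qed
  note cL = diagonalized_coord[OF this] and cQ = diagonalized_coord[OF dq]
  have coord: "x = y" if "\<And>j. j < N \<Longrightarrow> ip x (f j) = ip y (f j)" for x y
  proof -
    have "(\<Sum>j<N. scale (ip x (f j)) (f j)) = (\<Sum>j<N. scale (ip y (f j)) (f j))"
      by (rule sum.cong) (auto simp: that)
    thus ?thesis using onb_expand[OF f] by simp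
  qed
  let ?c = "cis (- \<epsilon>)"
  \<comment> \<open>The operator form of the scalar splitting: the pair of \<open>x\<close> and its
    rotation is the point over \<open>x - L x\<close> on the graph of the rotated \<open>Q\<close>,
    plus the diagonal point \<open>(L x, L x)\<close>.\<close>
  have claim: "scale ?c (Q (x - L x)) + L x = scale ?c x" for x
  proof (rule coord)
    fix j assume j: "j < N"
    have "ip (scale ?c (Q (x - L x)) + L x) (f j) = (?c * w j * (1 - l j) + l j) * ip x (f j)"
      by (simp add: ip_simps cQ[OF j] cL[OF j] algebra_simps)
    thus "ip (scale ?c (Q (x - L x)) + L x) (f j) = ip (scale ?c x) (f j)"
      using mult(2)[OF j j] by (simp add: ip_scale_left)
  qed
  obtain k where k: "k > 0" "\<And>j. j < N \<Longrightarrow> k * (cmod (l j))\<^sup>2 \<le> Im ((1 - ?c) * cnj (l j))"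
  proof -
    have "(cmod (l j) = 0 \<and> Im ((1 - ?c) * cnj (l j)) = 0) \<or> Im ((1 - ?c) * cnj (l j)) > 0" if "j < N" for j
      using mult(4)[OF that that] by auto
    from ex_uniform_constant[of N "\<lambda>j. cmod (l j)" "\<lambda>j. Im ((1 - ?c) * cnj (l j))", OF this]
    show ?thesis using that by blast
  qed
  define Q' where "Q' x = scale ?c (Q x)" for x
  define R' where "R' x = scale ?c (R x)" for x
  \<comment> \<open>After the rotation the second point is no longer diagonal, and
    \<open>claim\<close> splits it again: \<open>Z p - L (Z p)\<close> joins \<open>Y p\<close>,
    while \<open>L (Z p)\<close> is the new diagonal part.\<close>
  define Y' where "Y' p = Y p + (Z p - L (Z p))" for p
  define Z' where "Z' p = L (Z p)" for p
  have UQ': "unitary Q'" and UR': "unitary R'" unfolding Q'_def R'_def using unitary_rotate Q R by blast+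
  \<comment> \<open>A fixed vector of the rotated operator is an eigenvector of \<open>W\<close> for
    \<open>cis \<epsilon>\<close>, which the gap excludes.\<close>
  have noeig: "x = 0" if W: "unitary W" and g: "\<And>z. z \<in># eigs W \<Longrightarrow> z = 1 \<or> \<epsilon> < Arg2pi z" and x: "scale ?c (W x) = x" for W x
  proof (rule ccontr)
    assume "x \<noteq> 0"
    have "W x = scale (cis \<epsilon> * ?c) (W x)" by (simp add: cis_mult)
    also have "\<dots> = scale (cis \<epsilon>) x" using x by (metis scale_scale)
    finally have "x \<in> {x. W x = scale (cis \<epsilon>) x}" by simp
    obtain f w where "diagonalized W f w" using unitary_diag[OF W] by blast
    hence "count (eigs W) (cis \<epsilon>) = dim {x. W x = scale (cis \<epsilon>) x}" by (rule count_eigs(1))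
    moreover have "\<not> {x. W x = scale (cis \<epsilon>) x} \<subseteq> {0}" using \<open>x \<in> _\<close> \<open>x \<noteq> 0\<close> by blast
    ultimately have "count (eigs W) (cis \<epsilon>) \<noteq> 0" using dim_eq_0 by metis
    hence "cis \<epsilon> = 1 \<or> \<epsilon> < Arg2pi (cis \<epsilon>)" using g by (metis not_in_iff)
    thus False using rotation_multiplier(1)[of "cis \<epsilon>" \<epsilon>] \<epsilon> by simp
  qed
  have "real (vector_space.dim sd D) \<le>
     total_defect (eigs (\<lambda>x. R' (inv_into UNIV Q' x))) + total_defect (eigs Q') - total_defect (eigs R')"
  proof (rule triple_defect_transversal[OF UQ' UR' _ _ fd D, of Y' Z' k])
    show "Q' x = x \<Longrightarrow> x = 0" "R' x = x \<Longrightarrow> x = 0" for x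
      unfolding Q'_def R'_def using noeig[OF Q] noeig[OF R] gap by auto
    show "Vector_Spaces.linear sd scale Y'" "Vector_Spaces.linear sd scale Z'"
      unfolding Vector_Spaces.linear_iff Y'_def Z'_def using vector_space_axioms d.vector_space_axioms
      by (simp_all add: Y.add Y.scale Z.add Z.scale L.add L.scale algebra_simps)
    show "k > 0" by fact
    fix p assume p: "p \<in> D"
    have "R' (Y' p + Z' p) = scale ?c (Q (Y p) + Z p)" by (simp add: R'_def Y'_def Z'_def rel[OF p])
    also have "\<dots> = scale ?c (Q (Y p)) + (scale ?c (Q (Z p - L (Z p))) + L (Z p))"
      unfolding claim by (simp add: scale_right_distrib)
    also have "\<dots> = Q' (Y' p) + Z' p" by (simp add: Q'_def Y'_def Z'_def Q.add scale_right_distrib)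
    finally show "R' (Y' p + Z' p) = Q' (Y' p) + Z' p" .
    assume "p \<noteq> 0"
    have "Z' p \<noteq> 0"
    proof
      assume "Z' p = 0"
      hence "scale ?c (Q (Z p)) = scale ?c (Z p)" using claim[of "Z p"] by (simp add: Z'_def)
      hence "Q (Z p) = Z p" by simp
      thus False using ne[OF p] \<open>p \<noteq> 0\<close> by blast
    qed
    moreover have "Im (ip (Y' p - Q' (Y' p)) (Z' p)) \<ge> k * Re (ip (Z' p) (Z' p))"
    proof -
      let ?a = "\<lambda>j. ip (Y p) (f j)" and ?b = "\<lambda>j. ip (Z p) (f j)"
      have Qe: "scale ?c (Q (Z p - L (Z p))) = scale ?c (Z p) - L (Z p)"
        using claim[of "Z p"] by (simp only: eq_diff_eq)
      have "Q' (Y' p) = scale ?c (Q (Y p)) + (scale ?c (Z p) - L (Z p))"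
        unfolding Qe[symmetric] by (simp only: Q'_def Y'_def Q.add scale_right_distrib)
      hence e: "Y' p - Q' (Y' p) = (Y p - scale ?c (Q (Y p))) + scale (1 - ?c) (Z p)"
        by (simp add: Y'_def scale_left_diff_distrib algebra_simps)
      have cf: "ip (f j) (L (Z p)) = cnj (l j) * cnj (?b j)" if "j < N" for j
        using cL[OF that, of "Z p"] ip_cnj[of "L (Z p)" "f j"] by simp
      have ex: "ip x (L (Z p)) = (\<Sum>j<N. ip x (f j) * cnj (l j) * cnj (?b j))" for x
        by (subst onb_ip_expand[OF f UNIV_I, of x "L (Z p)"]) (simp add: cf mult.assoc)
      \<comment> \<open>The factor \<open>cnj (l j)\<close> turns \<open>1 - ?c * w j\<close> back
        into \<open>1 - w j\<close>. So this part reproduces the old form, and definiteness comes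
        from the other summand \<open>scale (1 - ?c) (Z p)\<close>.\<close>
      have "ip (Y p - scale ?c (Q (Y p))) (L (Z p)) = (\<Sum>j<N. ip (Y p - Q (Y p)) (f j) * cnj (?b j))"
        unfolding ex
      proof (rule sum.cong[OF refl])
        fix j assume "j \<in> {..<N}"
        hence j: "j < N" by simp
        have "ip (Y p - scale ?c (Q (Y p))) (f j) * cnj (l j) = (1 - ?c * w j) * cnj (l j) * ?a j"
          by (simp add: ip_simps cQ[OF j] algebra_simps)
        also have "\<dots> = ip (Y p - Q (Y p)) (f j)"
          unfolding mult(3)[OF j j] by (simp add: ip_simps cQ[OF j] algebra_simps)
        finally show "ip (Y p - scale ?c (Q (Y p))) (f j) * cnj (l j) * cnj (?b j) = ip (Y p - Q (Y p)) (f j) * cnj (?b j)"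
          by simp
      qed
      also have "\<dots> = ip (Y p - Q (Y p)) (Z p)"
        unfolding onb_ip_expand[OF f UNIV_I, of "Y p - Q (Y p)" "Z p"] by (simp add: ip_cnj)
      finally have 1: "ip (Y p - scale ?c (Q (Y p))) (L (Z p)) = ip (Y p - Q (Y p)) (Z p)" .
      have zl: "ip (scale (1 - ?c) (Z p)) (L (Z p)) = (\<Sum>j<N. ((1 - ?c) * cnj (l j)) * complex_of_real ((cmod (?b j))\<^sup>2))"
        unfolding ex by (intro sum.cong refl) (simp only: ip_scale_left complex_norm_square ac_simps)
      have imr: "Im (a * complex_of_real r) = Im a * r" for a r by simp
      from zl have 2: "Im (ip (scale (1 - ?c) (Z p)) (L (Z p))) = (\<Sum>j<N. Im ((1 - ?c) * cnj (l j)) * (cmod (?b j))\<^sup>2)"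
        by (simp only: Im_sum imr)
      have "ip (L (Z p)) (L (Z p)) = (\<Sum>j<N. complex_of_real ((cmod (l j))\<^sup>2 * (cmod (?b j))\<^sup>2))"
        unfolding ex by (intro sum.cong refl) (simp only: cL lessThan_iff complex_norm_square of_real_mult ac_simps)
      hence 3: "Re (ip (L (Z p)) (L (Z p))) = (\<Sum>j<N. (cmod (l j))\<^sup>2 * (cmod (?b j))\<^sup>2)"
        by (simp only: Re_sum Re_complex_of_real)
      have "k * Re (ip (L (Z p)) (L (Z p))) \<le> (\<Sum>j<N. Im ((1 - ?c) * cnj (l j)) * (cmod (?b j))\<^sup>2)"
        unfolding 3 sum_distrib_left
      proof (rule sum_mono)
        fix j assume "j \<in> {..<N}"
        hence "k * (cmod (l j))\<^sup>2 * (cmod (?b j))\<^sup>2 \<le> Im ((1 - ?c) * cnj (l j)) * (cmod (?b j))\<^sup>2"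
          by (intro mult_right_mono k(2)) auto
        thus "k * ((cmod (l j))\<^sup>2 * (cmod (?b j))\<^sup>2) \<le> Im ((1 - ?c) * cnj (l j)) * (cmod (?b j))\<^sup>2"
          by (simp only: mult.assoc)
      qed
      moreover have "Im (ip (Y' p - Q' (Y' p)) (Z' p)) = Im (ip (Y p - Q (Y p)) (Z p)) + Im (ip (scale (1 - ?c) (Z p)) (L (Z p)))"
        unfolding e Z'_def ip_add_left 1 by simp
      ultimately show ?thesis using pos[OF p] 2 by (simp add: Z'_def)
    qed
    ultimately show "Z' p \<noteq> 0 \<and> Im (ip (Y' p - Q' (Y' p)) (Z' p)) \<ge> k * Re (ip (Z' p) (Z' p))" by blast
  qed
  \<comment> \<open>The rotation cancels in the quotient, and the defects of the two rotated
    operators grow by equal amounts, so the triple defect is unchanged.\<close>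
  moreover have "(\<lambda>x. R' (inv_into UNIV Q' x)) = (\<lambda>x. R (inv_into UNIV Q x))"
  proof
    fix x
    obtain v where v: "x = Q' v" using unitary_bij[OF UQ'] by (metis bij_is_surj surjD)
    have "x = Q (scale ?c v)" by (simp add: v Q'_def Q.scale)
    hence "inv_into UNIV Q x = scale ?c v" using unitary_inj[OF Q] by simp
    moreover have "inv_into UNIV Q' x = v" using v unitary_inj[OF UQ'] by simp
    ultimately show "R' (inv_into UNIV Q' x) = R (inv_into UNIV Q x)" by (simp add: R'_def R.scale)
  qed
  moreover have "total_defect (eigs Q') = total_defect (eigs Q) + real N * \<epsilon> / (2 * pi)"
    "total_defect (eigs R') = total_defect (eigs R) + real N * \<epsilon> / (2 * pi)"
    unfolding Q'_def R'_def by (rule total_defect_rotate[OF Q \<epsilon>], use gap in force)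
      (rule total_defect_rotate[OF R \<epsilon>], use gap in force)
  ultimately show ?thesis by simp
qed

end

section \<open>Polarization of a symplectic space\<close>

lemma sesquilinearD:
  assumes "sesquilinear s B"
  shows "B (x + y) z = B x z + B y z" "B (s c x) z = c * B x z"
    and "B z (x + y) = B z x + B z y" "B z (s c x) = cnj c * B z x"
proof -
  show "B (x + y) z = B x z + B y z" "B (s c x) z = c * B x z"
    using assms unfolding sesquilinear_def Vector_Spaces.linear_iff by blast+
  have "cnj (B z (x + y)) = cnj (B z x) + cnj (B z y)" "cnj (B z (s c x)) = c * cnj (B z x)"
    using assms unfolding sesquilinear_def Vector_Spaces.linear_iff by blast+
  from this[THEN arg_cong[of _ _ cnj]]
  show "B z (x + y) = B z x + B z y" "B z (s c x) = cnj c * B z x" by simp_all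
qed

lemma ex_inner_product:
  assumes "finite_dimensional_vector_space s B"
  shows "\<exists>g. inner_product (s :: complex \<Rightarrow> 'x::ab_group_add \<Rightarrow> 'x) g"
proof -
  interpret finite_dimensional_vector_space s B by fact
  let ?r = "representation B"
  define g where "g x y = (\<Sum>b\<in>B. ?r x b * cnj (?r y b))" for x y
  have r: "?r (x + y) = (\<lambda>b. ?r x b + ?r y b)" "?r (s c x) = (\<lambda>b. c * ?r x b)" for x y c
    using representation_add[OF independent_Basis] representation_scale[OF independent_Basis] span_Basis by auto
  have cv: "vector_space ((*) :: complex \<Rightarrow> complex \<Rightarrow> complex)"
    by unfold_locales (simp_all add: algebra_simps)
  have "sesquilinear s g"
    unfolding sesquilinear_def Vector_Spaces.linear_iff g_def using vector_space_axioms cv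
    by (simp add: r sum.distrib sum_distrib_left algebra_simps)
  moreover have "g x y = cnj (g y x)" for x y by (simp add: g_def mult.commute)
  moreover have "0 < Re (g x x)" if "x \<noteq> 0" for x
  proof -
    have "x = (\<Sum>b\<in>B. s (?r x b) b)"
      using sum_representation_eq[OF independent_Basis _ finite_Basis order_refl, of x] span_Basis by simp
    with that obtain b where b: "b \<in> B" "?r x b \<noteq> 0" by (metis (no_types, lifting) scale_zero_left sum.neutral)
    have "Re (g x x) = (\<Sum>b\<in>B. (cmod (?r x b))\<^sup>2)"
      by (simp add: g_def complex_mult_cnj cmod_power2)
    also have "\<dots> > 0" using b finite_Basis by (intro sum_pos2[of _ b]) auto
    finally show ?thesis .
  qed
  ultimately show ?thesis unfolding inner_product_def by blast
qed

section \<open>The eigenspaces of \<open>iJ\<close> for the chosen inner product\<close>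

locale symplectic_fd = finite_dimensional_vector_space scale Basis
  for scale :: "complex \<Rightarrow> 'x::ab_group_add \<Rightarrow> 'x" and Basis :: "'x set" +
  fixes \<Omega> :: "'x \<Rightarrow> 'x \<Rightarrow> complex"
  assumes sympl: "symplectic_form scale \<Omega>"
begin

lemma \<Omega>_sesq: "sesquilinear scale \<Omega>" using sympl by (simp add: symplectic_form_def)

lemmas \<Omega>_simps = sesquilinearD[OF \<Omega>_sesq]

lemma \<Omega>_skew: "\<Omega> x y = - cnj (\<Omega> y x)"
  and \<Omega>_nondeg: "(\<And>y. \<Omega> x y = 0) \<Longrightarrow> x = 0"
  using sympl unfolding symplectic_form_def by blast+

lemma \<Omega>_0 [simp]: "\<Omega> 0 x = 0" "\<Omega> x 0 = 0"
  using \<Omega>_simps(2)[of 0 0 x] \<Omega>_simps(4)[of x 0 0] by simp_all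

lemma \<Omega>_sum: "\<Omega> (\<Sum>i\<in>A. f i) z = (\<Sum>i\<in>A. \<Omega> (f i) z)" "\<Omega> z (\<Sum>i\<in>A. f i) = (\<Sum>i\<in>A. \<Omega> z (f i))"
  by (induction A rule: infinite_finite_induct) (simp_all add: \<Omega>_simps)

lemma inner_chosen: "inner_product scale (chosen_inner scale)"
  unfolding chosen_inner_def
  by (rule someI_ex[OF ex_inner_product[OF finite_dimensional_vector_space_axioms]])

sublocale g: hermitian_space scale Basis "chosen_inner scale"
  by (intro hermitian_space.intro hermitian_space_axioms.intro finite_dimensional_vector_space_axioms inner_chosen)

text \<open>Riesz representation of the form in an orthonormal basis; nondegeneracy makes the
  representing operator injective.\<close>

lemma chosen_J:
  "Vector_Spaces.linear scale scale (chosen_J scale \<Omega>)" "bij (chosen_J scale \<Omega>)"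
  "\<Omega> x y = chosen_inner scale (chosen_J scale \<Omega> x) y"
proof -
  let ?g = "chosen_inner scale"
  define J where "J x = (\<Sum>j<card Basis. scale (\<Omega> x (g.bas j)) (g.bas j))" for x
  have lin: "Vector_Spaces.linear scale scale J"
    unfolding Vector_Spaces.linear_iff J_def using vector_space_axioms
    by (simp add: \<Omega>_simps scale_left_distrib sum.distrib scale_sum_right)
  have J: "\<Omega> x y = ?g (J x) y" for x y
  proof -
    have "\<Omega> x y = \<Omega> x (\<Sum>j<card Basis. scale (?g y (g.bas j)) (g.bas j))"
      using g.onb_expand[OF g.onb_bas] by simp
    also have "\<dots> = ?g (J x) y"
      by (simp add: \<Omega>_sum \<Omega>_simps J_def g.ip_sum_left g.ip_scale_left g.ip_cnj mult.commute)
    finally show ?thesis .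
  qed
  interpret J: Vector_Spaces.linear scale scale J by fact
  have "inj J" unfolding J.inj_iff_eq_0 using J \<Omega>_nondeg by (metis g.ip_0_left)
  hence "bij J" using linear_inj_imp_surj[OF lin] by (simp add: bij_def)
  hence "\<exists>J. Vector_Spaces.linear scale scale J \<and> bij J \<and> (\<forall>x y. \<Omega> x y = ?g (J x) y)"
    using lin J by blast
  from someI_ex[OF this] show "Vector_Spaces.linear scale scale (chosen_J scale \<Omega>)" "bij (chosen_J scale \<Omega>)"
    "\<Omega> x y = chosen_inner scale (chosen_J scale \<Omega> x) y"
    unfolding chosen_J_def by blast+
qed

text \<open>\<open>iJ\<close> is self-adjoint because \<open>\<Omega>\<close> is skew-Hermitian, and
  it has no kernel because \<open>J\<close> is injective. In its eigenbasis \<open>\<Omega>\<close>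
  is diagonal with entries \<open>- i a\<close>, so the sign of an eigenvalue is the sign of
  \<open>i \<Omega>\<close> on its vector.\<close>

lemma ex_J_eigenbasis:
  "\<exists>e a. g.onb (card Basis) UNIV e \<and> (\<forall>j<card Basis. a j \<noteq> (0::real) \<and>
     scale \<i> (chosen_J scale \<Omega> (e j)) = scale (complex_of_real (a j)) (e j)) \<and>
     (\<forall>i<card Basis. \<forall>j<card Basis. \<Omega> (e i) (e j) = (if i = j then - \<i> * a j else 0))"
proof -
  let ?g = "chosen_inner scale" and ?J = "chosen_J scale \<Omega>"
  let ?T = "\<lambda>x. scale \<i> (?J x)"
  interpret J: Vector_Spaces.linear scale scale ?J by (rule chosen_J)
  have lin: "Vector_Spaces.linear scale scale ?T"
    unfolding Vector_Spaces.linear_iff using vector_space_axioms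
    by (simp add: J.add J.scale scale_right_distrib scale_left_commute)
  have T: "?g (?T x) y = \<i> * \<Omega> x y" for x y by (simp add: g.ip_scale_left chosen_J(3))
  have sa: "?g (?T x) y = ?g x (?T y)" for x y
  proof -
    have "?g x (?T y) = cnj (?g (?T y) x)" by (simp only: g.ip_cnj)
    also have "\<dots> = - \<i> * cnj (\<Omega> y x)" by (simp add: T)
    also have "\<dots> = \<i> * \<Omega> x y" using \<Omega>_skew[of x y] by simp
    finally show ?thesis by (simp only: T)
  qed
  have "\<exists>e w. g.onb (dim UNIV) UNIV e \<and> (\<forall>i<dim UNIV. ?T (e i) = scale (w i) (e i))"
  proof (rule g.spectral[OF lin])
    fix e z x assume "?T e = scale z e" "?g x e = 0"
    thus "?g (?T x) e = 0" using sa[of x e] by (simp add: g.ip_scale_right)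
  qed (auto simp: subspace_UNIV)
  then obtain e w where e: "g.onb (card Basis) UNIV e" "\<And>i. i < card Basis \<Longrightarrow> ?T (e i) = scale (w i) (e i)"
    by auto
  have w: "w i = complex_of_real (Re (w i)) \<and> Re (w i) \<noteq> 0" if i: "i < card Basis" for i
  proof -
    have ee: "?g (e i) (e i) = 1" using g.onb_ip[OF e(1) i i] by simp
    have "w i = cnj (w i)" using sa[of "e i" "e i"] e(2)[OF i] ee by (simp add: g.ip_simps)
    hence r: "w i = complex_of_real (Re (w i))" by (simp add: complex_eq_iff)
    moreover have "w i \<noteq> 0"
    proof
      assume "w i = 0"
      hence "?J (e i) = 0" using e(2)[OF i] by simp
      hence "e i = 0" using chosen_J(2) J.zero by (metis bij_is_inj injD)
      thus False using ee by simp
    qed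
    ultimately show ?thesis by (metis of_real_0)
  qed
  have "\<Omega> (e i) (e j) = (if i = j then - \<i> * Re (w j) else 0)" if "i < card Basis" "j < card Basis" for i j
  proof -
    have "\<i> * \<Omega> (e i) (e j) = w i * (if i = j then 1 else 0)"
      using T[of "e i" "e j"] e(2)[OF that(1)] g.onb_ip[OF e(1) that] by (simp add: g.ip_scale_left)
    hence "\<Omega> (e i) (e j) = - \<i> * (w i * (if i = j then 1 else 0))"
      by (metis (no_types, lifting) complex_i_mult_minus mult_minus_left minus_minus)
    thus ?thesis using w[OF that(1)] by auto
  qed
  thus ?thesis using e w by (intro exI[of _ e] exI[of _ "\<lambda>i. Re (w i)"]) metis
qed

text \<open>An eigenvector for \<open>r\<close> has coordinates only along basis vectors with the
  same eigenvalue. The predicate \<open>R\<close> covers \<open>X_minus\<close> and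
  \<open>X_plus\<close> at once.\<close>

lemma X_span:
  assumes e: "g.onb (card Basis) UNIV e"
    and J: "\<And>j. j < card Basis \<Longrightarrow> scale \<i> (chosen_J scale \<Omega> (e j)) = scale (complex_of_real (a j)) (e j)"
  shows "span {x. \<exists>r::real. R r \<and> scale \<i> (chosen_J scale \<Omega> x) = scale (complex_of_real r) x}
     = span (e ` {j. j < card Basis \<and> R (a j)})"
proof
  let ?T = "\<lambda>x. scale \<i> (chosen_J scale \<Omega> x)"
  interpret J: Vector_Spaces.linear scale scale "chosen_J scale \<Omega>" by (rule chosen_J)
  have "Vector_Spaces.linear scale scale ?T"
    unfolding Vector_Spaces.linear_iff using vector_space_axioms
    by (simp add: J.add J.scale scale_right_distrib scale_left_commute)
  hence d: "g.diagonalized ?T e (\<lambda>j. complex_of_real (a j))"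
    using e J by (simp add: g.diagonalized_def)
  show "span {x. \<exists>r::real. R r \<and> ?T x = scale (complex_of_real r) x} \<subseteq> span (e ` {j. j < card Basis \<and> R (a j)})"
  proof (intro span_minimal subspace_span subsetI)
    fix x assume "x \<in> {x. \<exists>r::real. R r \<and> ?T x = scale (complex_of_real r) x}"
    then obtain r :: real where r: "R r" "?T x = scale (complex_of_real r) x" by blast
    have "scale (chosen_inner scale x (e j)) (e j) \<in> span (e ` {j. j < card Basis \<and> R (a j)})" if j: "j < card Basis" for j
    proof (cases "R (a j)")
      case False
      hence "a j \<noteq> r" using r by auto
      moreover have "complex_of_real r * chosen_inner scale x (e j) = complex_of_real (a j) * chosen_inner scale x (e j)"
        using g.diagonalized_coord[OF d j, of x] unfolding r(2) g.ip_scale_left .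
      ultimately have "chosen_inner scale x (e j) = 0" by (auto simp: mult_cancel_right)
      thus ?thesis by (simp add: span_zero)
    next
      case True
      thus ?thesis using j by (intro span_scale span_base) auto
    qed
    hence "(\<Sum>j<card Basis. scale (chosen_inner scale x (e j)) (e j)) \<in> span (e ` {j. j < card Basis \<and> R (a j)})"
      by (intro span_sum) auto
    thus "x \<in> span (e ` {j. j < card Basis \<and> R (a j)})" using g.onb_expand[OF e] by simp
  qed
  show "span (e ` {j. j < card Basis \<and> R (a j)}) \<subseteq> span {x. \<exists>r::real. R r \<and> ?T x = scale (complex_of_real r) x}"
    using J by (intro span_mono) blast
qed

text \<open>An isotropic subspace meets a definite one only in \<open>0\<close>, so an isotropic subspace of half the
  dimension forces the two definite parts to have equal dimension.\<close>

lemma card_definite_le: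
  assumes L: "subspace L" "\<And>x y. x \<in> L \<Longrightarrow> y \<in> L \<Longrightarrow> \<Omega> x y = 0" "card Basis = 2 * dim L"
    and e: "g.onb (card Basis) UNIV e" and K: "K \<subseteq> {..<card Basis}"
    and \<Omega>e: "\<And>i j. i < card Basis \<Longrightarrow> j < card Basis \<Longrightarrow> \<Omega> (e i) (e j) = (if i = j then - \<i> * complex_of_real (a j) else 0)"
    and sg: "\<And>j. j \<in> K \<Longrightarrow> \<sigma> * a j > (0::real)"
  shows "card K \<le> dim L"
proof -
  have fK: "finite K" using K finite_subset by blast
  have inj: "inj_on e {..<card Basis}"
    by (rule inj_onI) (metis lessThan_iff g.onb_ip[OF e] zero_neq_one)
  have "L \<inter> span (e ` K) \<subseteq> {0}"
  proof
    fix x assume "x \<in> L \<inter> span (e ` K)"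
    hence x: "x \<in> L" "x \<in> span (e ` K)" by auto
    obtain u where u: "x = (\<Sum>v\<in>e ` K. scale (u v) v)" using x(2) fK by (auto simp: span_finite)
    define c where "c j = u (e j)" for j
    have xs: "x = (\<Sum>j\<in>K. scale (c j) (e j))"
      unfolding u c_def using inj K by (subst sum.reindex) (auto intro: inj_on_subset)
    have "0 = \<Omega> x x" using L(2) x(1) by simp
    also have "\<dots> = (\<Sum>i\<in>K. c i * (\<Sum>j\<in>K. cnj (c j) * \<Omega> (e i) (e j)))"
      unfolding xs \<Omega>_sum(1)
      by (simp add: \<Omega>_sum(2) \<Omega>_simps sum_distrib_left mult.left_commute)
    also have "\<dots> = (\<Sum>i\<in>K. c i * (\<Sum>j\<in>K. if j = i then cnj (c i) * (- \<i> * complex_of_real (a i)) else 0))"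
      using K by (intro sum.cong refl arg_cong[of _ _ "(*) _"]) (auto simp: \<Omega>e subset_iff)
    also have "\<dots> = (\<Sum>i\<in>K. - \<i> * complex_of_real ((cmod (c i))\<^sup>2 * a i))"
      using fK by (intro sum.cong) (auto simp: complex_norm_square simp del: of_real_power)
    also have "\<dots> = - \<i> * complex_of_real (\<Sum>i\<in>K. (cmod (c i))\<^sup>2 * a i)" by (simp add: sum_distrib_left)
    finally have "complex_of_real (\<Sum>i\<in>K. (cmod (c i))\<^sup>2 * a i) = 0" by simp
    hence "\<sigma> * (\<Sum>i\<in>K. (cmod (c i))\<^sup>2 * a i) = 0" by (metis mult_zero_right of_real_eq_0_iff)
    hence "(\<Sum>i\<in>K. (cmod (c i))\<^sup>2 * (\<sigma> * a i)) = 0" by (simp add: sum_distrib_left mult.left_commute)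
    hence "\<forall>i\<in>K. (cmod (c i))\<^sup>2 * (\<sigma> * a i) = 0"
      using sg fK by (subst (asm) sum_nonneg_eq_0_iff) (auto intro!: mult_nonneg_nonneg simp: less_imp_le)
    hence "c i = 0" if "i \<in> K" for i using that sg[OF that] by auto
    thus "x \<in> {0}" by (simp add: xs)
  qed
  hence "dim (L \<inter> span (e ` K)) = 0" by simp
  moreover have "dim {x + y |x y. x \<in> L \<and> y \<in> span (e ` K)} + dim (L \<inter> span (e ` K)) = dim L + dim (span (e ` K))"
    by (rule dim_sums_Int[OF L(1) subspace_span])
  moreover have "dim {x + y |x y. x \<in> L \<and> y \<in> span (e ` K)} \<le> card Basis" by (rule dim_subset_UNIV[unfolded dimension_def])
  moreover have "dim (span (e ` K)) = card K" by (rule g.dim_span_onb[OF e K])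
  ultimately show ?thesis using L(3) by linarith
qed

end

text \<open>Each definite part is identified with a space that carries its own inner product
  \<open>ip\<close>, so that the operators of the Maslov index can be studied there. In these
  coordinates the symplectic form is \<open>- i\<close> times a difference of two inner products,
  and Lagrangian graphs become graphs of isometries.\<close>

lemma ex_polarization:
  fixes sx :: "complex \<Rightarrow> 'x::ab_group_add \<Rightarrow> 'x" and sv :: "complex \<Rightarrow> 'v::ab_group_add \<Rightarrow> 'v"
  assumes X: "symplectic_fd sx Bx \<Omega>" and V: "hermitian_space sv Bv ip"
    and L: "module.subspace sx L" "\<And>x y. x \<in> L \<Longrightarrow> y \<in> L \<Longrightarrow> \<Omega> x y = 0"
      "vector_space.dim sx L = card Bv" and card: "card Bx = 2 * card Bv"
  shows "\<exists>phm php prm prp. Vector_Spaces.linear sv sx phm \<and> Vector_Spaces.linear sv sx php \<and>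
     Vector_Spaces.linear sx sv prm \<and> Vector_Spaces.linear sx sv prp \<and>
     (\<forall>\<xi>. phm (prm \<xi>) + php (prp \<xi>) = \<xi>) \<and>
     (\<forall>x. prm (phm x) = x \<and> prp (phm x) = 0 \<and> prm (php x) = 0 \<and> prp (php x) = x) \<and>
     (\<forall>\<xi> \<eta>. \<Omega> \<xi> \<eta> = - \<i> * (ip (prm \<xi>) (prm \<eta>) - ip (prp \<xi>) (prp \<eta>))) \<and>
     X_minus sx \<Omega> = range phm \<and> X_plus sx \<Omega> = range php"
proof -
  interpret X: symplectic_fd sx Bx \<Omega> by fact
  interpret V: hermitian_space sv Bv ip by fact
  let ?n = "card Bx" and ?m = "card Bv"
  obtain e and a :: "nat \<Rightarrow> real" where e: "X.g.onb ?n UNIV e"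
    and a: "\<And>j. j < ?n \<Longrightarrow> a j \<noteq> 0"
    and J: "\<And>j. j < ?n \<Longrightarrow> sx \<i> (chosen_J sx \<Omega> (e j)) = sx (complex_of_real (a j)) (e j)"
    and \<Omega>e: "\<And>i j. i < ?n \<Longrightarrow> j < ?n \<Longrightarrow> \<Omega> (e i) (e j) = (if i = j then - \<i> * a j else 0)"
    using X.ex_J_eigenbasis by blast
  let ?P = "{j. j < ?n \<and> a j > 0}" and ?M = "{j. j < ?n \<and> a j < 0}"
  have "card ?P \<le> ?m" "card ?M \<le> ?m"
    using X.card_definite_le[OF L(1,2) _ e _ \<Omega>e, of ?P 1] X.card_definite_le[OF L(1,2) _ e _ \<Omega>e, of ?M "-1"] L(3) card
    by auto
  moreover have "card (?P \<union> ?M) = ?n"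
  proof -
    have "?P \<union> ?M = {..<?n}" using a by force
    thus ?thesis by simp
  qed
  moreover have "card (?P \<union> ?M) = card ?P + card ?M" by (rule card_Un_disjoint) auto
  ultimately have cP: "card ?P = ?m" and cM: "card ?M = ?m" using card by linarith+
  obtain p where p: "bij_betw p {0..<?m} ?P" using ex_bij_betw_nat_finite[of ?P] cP by auto
  obtain q where q: "bij_betw q {0..<?m} ?M" using ex_bij_betw_nat_finite[of ?M] cM by auto
  have pP: "p j < ?n" "a (p j) > 0" and qM: "q j < ?n" "a (q j) < 0" if "j < ?m" for j
    using p q that by (auto simp: bij_betw_def)
  have pq: "(p i = p j) = (i = j)" "(q i = q j) = (i = j)" if "i < ?m" "j < ?m" for i j
    using p q that by (auto simp: bij_betw_def inj_on_eq_iff)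
  \<comment> \<open>Dividing by the root of the absolute eigenvalue normalizes the form to
    \<open>- i\<close> on the first family and to \<open>i\<close> on the second.\<close>
  define bm where "bm j = sx (complex_of_real (1 / sqrt (a (p j)))) (e (p j))" for j
  define bp where "bp j = sx (complex_of_real (1 / sqrt (- a (q j)))) (e (q j))" for j
  have sq: "complex_of_real (1 / sqrt x) * (complex_of_real (1 / sqrt x) * complex_of_real x) = 1" if "x > 0" for x
  proof -
    have "1 / sqrt x * (1 / sqrt x * x) = 1" using that by (simp add: field_simps)
    thus ?thesis by (metis of_real_1 of_real_mult)
  qed
  have bb: "\<Omega> (bm i) (bm j) = (if i = j then - \<i> else 0)" "\<Omega> (bp i) (bp j) = (if i = j then \<i> else 0)"
      "\<Omega> (bm i) (bp j) = 0" "\<Omega> (bp i) (bm j) = 0" if ij: "i < ?m" "j < ?m" for i j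
  proof -
    have "\<Omega> (bm i) (bm j) = (if i = j then - \<i> * (complex_of_real (1 / sqrt (a (p j))) * (complex_of_real (1 / sqrt (a (p j))) * a (p j))) else 0)"
      using pP[OF ij(1)] pP[OF ij(2)] pq[OF ij] by (simp add: bm_def X.\<Omega>_simps \<Omega>e)
    thus "\<Omega> (bm i) (bm j) = (if i = j then - \<i> else 0)"
      unfolding sq[OF pP(2)[OF ij(2)]] by simp
    have "\<Omega> (bp i) (bp j) = (if i = j then \<i> * (complex_of_real (1 / sqrt (- a (q j))) * (complex_of_real (1 / sqrt (- a (q j))) * complex_of_real (- a (q j)))) else 0)"
      using qM[OF ij(1)] qM[OF ij(2)] pq[OF ij] by (simp add: bp_def X.\<Omega>_simps \<Omega>e)
    thus "\<Omega> (bp i) (bp j) = (if i = j then \<i> else 0)"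
      using qM(2)[OF ij(2)] by (subst (asm) sq) simp_all
    have "p i \<noteq> q j" "q i \<noteq> p j" using pP[OF ij(1)] pP[OF ij(2)] qM[OF ij(1)] qM[OF ij(2)] by auto
    thus "\<Omega> (bm i) (bp j) = 0" "\<Omega> (bp i) (bm j) = 0"
      using pP[OF ij(1)] pP[OF ij(2)] qM[OF ij(1)] qM[OF ij(2)] by (simp_all add: bm_def bp_def X.\<Omega>_simps \<Omega>e)
  qed
  define phm where "phm x = (\<Sum>j<?m. sx (ip x (V.bas j)) (bm j))" for x
  define php where "php x = (\<Sum>j<?m. sx (ip x (V.bas j)) (bp j))" for x
  \<comment> \<open>The factors \<open>i\<close> and \<open>- i\<close> invert the normalized values
    of the form, so \<open>prm\<close> and \<open>prp\<close> read off coordinates.\<close>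
  define prm where "prm \<xi> = (\<Sum>j<?m. sv (\<i> * \<Omega> \<xi> (bm j)) (V.bas j))" for \<xi>
  define prp where "prp \<xi> = (\<Sum>j<?m. sv (- \<i> * \<Omega> \<xi> (bp j)) (V.bas j))" for \<xi>
  have lin: "Vector_Spaces.linear sv sx phm" "Vector_Spaces.linear sv sx php"
    unfolding Vector_Spaces.linear_iff phm_def php_def using X.vector_space_axioms V.vector_space_axioms
    by (simp_all add: V.ip_simps X.scale_left_distrib sum.distrib X.scale_sum_right)
  have lin': "Vector_Spaces.linear sx sv prm" "Vector_Spaces.linear sx sv prp"
    unfolding Vector_Spaces.linear_iff prm_def prp_def using X.vector_space_axioms V.vector_space_axioms
    by (simp_all add: X.\<Omega>_simps V.scale_left_distrib V.scale_left_diff_distrib distrib_left sum.distrib sum_negf sum_subtractf V.scale_sum_right mult.left_commute)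
  have cm: "ip (prm \<xi>) (V.bas j) = \<i> * \<Omega> \<xi> (bm j)" "ip (prp \<xi>) (V.bas j) = - \<i> * \<Omega> \<xi> (bp j)"
    if "j < ?m" for \<xi> j
  proof -
    have k: "ip (\<Sum>i<?m. sv (c i) (V.bas i)) (V.bas j) = c j" for c
    proof -
      have "ip (\<Sum>i<?m. sv (c i) (V.bas i)) (V.bas j) = (\<Sum>i<?m. if i = j then c i else 0)"
        unfolding V.ip_sum_left using that by (intro sum.cong) (auto simp: V.ip_scale_left V.onb_ip[OF V.onb_bas])
      thus ?thesis using that by simp
    qed
    show "ip (prm \<xi>) (V.bas j) = \<i> * \<Omega> \<xi> (bm j)" "ip (prp \<xi>) (V.bas j) = - \<i> * \<Omega> \<xi> (bp j)"
      unfolding prm_def prp_def by (rule k)+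
  qed
  have \<Omega>ph: "\<Omega> (phm x) (bm j) = - \<i> * ip x (V.bas j)" "\<Omega> (phm x) (bp j) = 0"
      "\<Omega> (php x) (bp j) = \<i> * ip x (V.bas j)" "\<Omega> (php x) (bm j) = 0" if "j < ?m" for x j
  proof -
    have "(\<Sum>i<?m. f i * (if i = j then c else 0)) = c * f j" for f and c :: complex
      using that by (simp add: if_distrib[of "\<lambda>u. _ * u"] cong: if_cong)
    thus "\<Omega> (phm x) (bm j) = - \<i> * ip x (V.bas j)" "\<Omega> (phm x) (bp j) = 0"
      "\<Omega> (php x) (bp j) = \<i> * ip x (V.bas j)" "\<Omega> (php x) (bm j) = 0"
      using that by (simp_all add: phm_def php_def X.\<Omega>_sum X.\<Omega>_simps bb)
  qed
  have coord: "x = y" if "\<And>j. j < ?m \<Longrightarrow> ip x (V.bas j) = ip y (V.bas j)" for x y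
  proof -
    have "(\<Sum>j<?m. sv (ip x (V.bas j)) (V.bas j)) = (\<Sum>j<?m. sv (ip y (V.bas j)) (V.bas j))"
      by (rule sum.cong) (auto simp: that)
    thus ?thesis using V.onb_expand[OF V.onb_bas] by simp
  qed
  have retr: "prm (phm x) = x \<and> prp (phm x) = 0 \<and> prm (php x) = 0 \<and> prp (php x) = x" for x
    by (intro conjI coord) (simp_all add: cm \<Omega>ph)
  have spans: "X_minus sx \<Omega> = X.span (e ` ?P)" "X_plus sx \<Omega> = X.span (e ` ?M)"
    unfolding X_minus_def X_plus_def
    using X.X_span[OF e J, of "\<lambda>r. r > 0"] X.X_span[OF e J, of "\<lambda>r. r < 0"] by auto
  have ebm: "e (p j) = sx (complex_of_real (sqrt (a (p j)))) (bm j)" "e (q j) = sx (complex_of_real (sqrt (- a (q j)))) (bp j)"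
    if "j < ?m" for j
    using pP[OF that] qM[OF that] by (simp_all add: bm_def bp_def of_real_mult[symmetric] del: of_real_mult)
  have phb: "phm (V.bas j) = bm j" "php (V.bas j) = bp j" if "j < ?m" for j
  proof -
    have "(\<Sum>i<?m. sx (ip (V.bas j) (V.bas i)) (v i)) = (\<Sum>i<?m. if i = j then v i else 0)" for v
      using that by (intro sum.cong) (auto simp: V.onb_ip[OF V.onb_bas])
    thus "phm (V.bas j) = bm j" "php (V.bas j) = bp j" using that by (simp_all add: phm_def php_def)
  qed
  interpret phm: Vector_Spaces.linear sv sx phm by (rule lin)
  interpret php: Vector_Spaces.linear sv sx php by (rule lin)
  interpret prm: Vector_Spaces.linear sx sv prm by (rule lin')
  interpret prp: Vector_Spaces.linear sx sv prp by (rule lin')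
  have rm: "X.span (e ` ?P) = range phm"
  proof
    show "X.span (e ` ?P) \<subseteq> range phm"
    proof (rule X.span_minimal)
      show "X.subspace (range phm)" by (rule phm.subspace_image[OF V.subspace_UNIV])
      show "e ` ?P \<subseteq> range phm"
      proof clarify
        fix j assume "j < ?n" "0 < a j"
        hence "j \<in> p ` {0..<?m}" using bij_betw_imp_surj_on[OF p] by simp
        then obtain i where i: "i < ?m" "j = p i" by auto
        thus "e j \<in> range phm" using phm.scale[of _ "V.bas i"] phb(1)[of i] ebm(1)[of i] by (metis rangeI)
      qed
    qed
    show "range phm \<subseteq> X.span (e ` ?P)"
    proof clarify
      fix x
      have "bm j \<in> X.span (e ` ?P)" if "j < ?m" for j
        unfolding bm_def using pP[OF that] by (intro X.span_scale X.span_base) auto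
      thus "phm x \<in> X.span (e ` ?P)"
        unfolding phm_def by (intro X.span_sum X.span_scale) auto
    qed
  qed
  have rp: "X.span (e ` ?M) = range php"
  proof
    show "X.span (e ` ?M) \<subseteq> range php"
    proof (rule X.span_minimal)
      show "X.subspace (range php)" by (rule php.subspace_image[OF V.subspace_UNIV])
      show "e ` ?M \<subseteq> range php"
      proof clarify
        fix j assume "j < ?n" "a j < 0"
        hence "j \<in> q ` {0..<?m}" using bij_betw_imp_surj_on[OF q] by simp
        then obtain i where i: "i < ?m" "j = q i" by auto
        thus "e j \<in> range php" using php.scale[of _ "V.bas i"] phb(2)[of i] ebm(2)[of i] by (metis rangeI)
      qed
    qed
    show "range php \<subseteq> X.span (e ` ?M)"
    proof clarify
      fix x
      have "bp j \<in> X.span (e ` ?M)" if "j < ?m" for j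
        unfolding bp_def using qM[OF that] by (intro X.span_scale X.span_base) auto
      thus "php x \<in> X.span (e ` ?M)"
        unfolding php_def by (intro X.span_sum X.span_scale) auto
    qed
  qed
  have decomp: "phm (prm \<xi>) + php (prp \<xi>) = \<xi>" for \<xi>
  proof -
    define S where "S = {\<xi>. phm (prm \<xi>) + php (prp \<xi>) = \<xi>}"
    have "X.subspace S"
      unfolding S_def X.subspace_def
      by (auto simp: prm.zero prp.zero phm.zero php.zero prm.add prp.add phm.add php.add
        prm.scale prp.scale phm.scale php.scale X.scale_right_distrib[symmetric] algebra_simps)
    moreover have "range phm \<subseteq> S" "range php \<subseteq> S"
      using retr by (auto simp: S_def php.zero phm.zero)
    moreover have "e j \<in> S" if "j < ?n" for j
    proof (cases "a j > 0")
      case True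
      hence "e j \<in> X.span (e ` ?P)" using that by (intro X.span_base) auto
      thus ?thesis using calculation(2) rm by blast
    next
      case False
      hence "e j \<in> X.span (e ` ?M)" using that a[OF that] by (intro X.span_base) auto
      thus ?thesis using calculation(3) rp by blast
    qed
    ultimately have "(\<Sum>j<?n. sx (chosen_inner sx \<xi> (e j)) (e j)) \<in> S"
      by (intro X.subspace_sum X.subspace_scale) auto
    hence "\<xi> \<in> S" using X.g.onb_expand[OF e] by simp
    thus ?thesis by (simp add: S_def)
  qed
  have form: "\<Omega> \<xi> \<eta> = - \<i> * (ip (prm \<xi>) (prm \<eta>) - ip (prp \<xi>) (prp \<eta>))" for \<xi> \<eta>
  proof -
    have \<Omega>b: "\<Omega> \<xi> (bm j) = - \<i> * ip (prm \<xi>) (V.bas j)" "\<Omega> \<xi> (bp j) = \<i> * ip (prp \<xi>) (V.bas j)"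
      if "j < ?m" for j
      unfolding cm[OF that] by (simp_all add: mult.assoc[symmetric])
    have "\<Omega> \<xi> \<eta> = \<Omega> \<xi> (phm (prm \<eta>) + php (prp \<eta>))" by (simp add: decomp)
    also have "\<dots> = (\<Sum>j<?m. cnj (ip (prm \<eta>) (V.bas j)) * \<Omega> \<xi> (bm j)) + (\<Sum>j<?m. cnj (ip (prp \<eta>) (V.bas j)) * \<Omega> \<xi> (bp j))"
      by (simp add: X.\<Omega>_simps phm_def php_def X.\<Omega>_sum)
    also have "(\<Sum>j<?m. cnj (ip (prm \<eta>) (V.bas j)) * \<Omega> \<xi> (bm j)) = (\<Sum>j<?m. - \<i> * (ip (prm \<xi>) (V.bas j) * ip (V.bas j) (prm \<eta>)))"
      by (intro sum.cong) (auto simp: \<Omega>b V.ip_cnj mult_ac)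
    also have "\<dots> = - \<i> * ip (prm \<xi>) (prm \<eta>)"
      using V.onb_ip_expand[OF V.onb_bas UNIV_I, of "prm \<xi>" "prm \<eta>"] by (simp only: sum_distrib_left)
    also have "(\<Sum>j<?m. cnj (ip (prp \<eta>) (V.bas j)) * \<Omega> \<xi> (bp j)) = (\<Sum>j<?m. \<i> * (ip (prp \<xi>) (V.bas j) * ip (V.bas j) (prp \<eta>)))"
      by (intro sum.cong) (auto simp: \<Omega>b V.ip_cnj mult_ac)
    also have "\<dots> = \<i> * ip (prp \<xi>) (prp \<eta>)"
      using V.onb_ip_expand[OF V.onb_bas UNIV_I, of "prp \<xi>" "prp \<eta>"] by (simp only: sum_distrib_left)
    finally show ?thesis by (simp add: algebra_simps)
  qed
  show ?thesis
    by (intro exI[of _ phm] exI[of _ php] exI[of _ prm] exI[of _ prp] conjI lin lin' allI decomp retr form)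
       (use retr spans rm rp in auto)
qed

section \<open>Graphs of symplectic maps as unitary operators\<close>

text \<open>Comparison with a constant lift of ones shows that two lifts have the same change of
  total angle; the other terms of \<open>crossings_eq\<close> depend on the end multisets only. This
  removes the choice of angles from \<open>Mas\<close>.\<close>

lemma crossings_unique:
  assumes "angle_lift m a b E \<theta>" "angle_lift m a b E \<phi>" "a \<le> b"
  shows "crossings m \<theta> a b = crossings m \<phi> a b"
proof -
  have one: "angle_lift m a b (\<lambda>_. image_mset (\<lambda>_. 1) (mset_set {..<m})) (\<lambda>_ _. 0)"
    by (simp add: angle_lift_def)
  have "prod_mset (E t) * prod_mset (image_mset (\<lambda>_. 1) (mset_set {..<m})) = prod_mset (E t)" for t
    by (simp add: prod_mset.neutral)
  from angle_sum_additive[OF assms(1) one assms(2) this assms(3)]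
  have "(\<Sum>j<m. \<theta> j b) - (\<Sum>j<m. \<theta> j a) = (\<Sum>j<m. \<phi> j b) - (\<Sum>j<m. \<phi> j a)" by simp
  hence "real_of_int (crossings m \<theta> a b) = real_of_int (crossings m \<phi> a b)"
    unfolding crossings_eq[OF assms(1,3)] crossings_eq[OF assms(2,3)] by simp
  thus ?thesis by simp
qed

lemma SpD:
  assumes "A \<in> Sp s \<omega>"
  shows "Vector_Spaces.linear s s A" "bij A" "\<omega> (A x) (A y) = \<omega> x y"
  using assms by (auto simp: Sp_def)

lemma Sp_comp: assumes "A \<in> Sp s \<omega>" "B \<in> Sp s \<omega>" shows "A \<circ> B \<in> Sp s \<omega>"
proof -
  have "Vector_Spaces.linear s s (A \<circ> B)"
    using SpD(1)[OF assms(1)] SpD(1)[OF assms(2)] unfolding Vector_Spaces.linear_iff by simp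
  thus ?thesis using SpD[OF assms(1)] SpD[OF assms(2)] by (simp add: Sp_def bij_comp)
qed

lemma Sp_funpow: assumes "A \<in> Sp s \<omega>" "vector_space s" shows "A ^^ n \<in> Sp s \<omega>"
proof (induction n)
  case 0
  show ?case using assms(2) by (simp add: Sp_def Vector_Spaces.linear_iff bij_def)
next
  case (Suc n)
  thus ?case using Sp_comp[OF assms(1) Suc.IH] by (simp only: funpow.simps(2))
qed

locale polarized = hermitian_space scale Basis ip
  for scale :: "complex \<Rightarrow> 'v::ab_group_add \<Rightarrow> 'v" and Basis :: "'v set" and ip +
  fixes \<omega> :: "'v \<Rightarrow> 'v \<Rightarrow> complex" and phm php :: "'v \<Rightarrow> 'v \<times> 'v" and prm prp :: "'v \<times> 'v \<Rightarrow> 'v"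
  assumes sympl: "symplectic_form scale \<omega>"
    and lin_ph: "Vector_Spaces.linear scale (module_prod.scale scale scale) phm"
      "Vector_Spaces.linear scale (module_prod.scale scale scale) php"
    and lin_pr: "Vector_Spaces.linear (module_prod.scale scale scale) scale prm"
      "Vector_Spaces.linear (module_prod.scale scale scale) scale prp"
    and decomp: "\<And>\<xi>. phm (prm \<xi>) + php (prp \<xi>) = \<xi>"
    and retr: "\<And>x. prm (phm x) = x" "\<And>x. prp (phm x) = 0" "\<And>x. prm (php x) = 0" "\<And>x. prp (php x) = x"
    and form: "\<And>\<xi> \<eta>. double_form \<omega> \<xi> \<eta> = - \<i> * (ip (prm \<xi>) (prm \<eta>) - ip (prp \<xi>) (prp \<eta>))"
    and X_minus: "X_minus (module_prod.scale scale scale) (double_form \<omega>) = range phm"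
    and X_plus: "X_plus (module_prod.scale scale scale) (double_form \<omega>) = range php"
begin

sublocale pr: finite_dimensional_vector_space_prod scale scale Basis Basis
  by unfold_locales

abbreviation "sx \<equiv> module_prod.scale scale scale"

sublocale phm: Vector_Spaces.linear scale sx phm by (rule lin_ph)
sublocale php: Vector_Spaces.linear scale sx php by (rule lin_ph)
sublocale prm: Vector_Spaces.linear sx scale prm by (rule lin_pr)
sublocale prp: Vector_Spaces.linear sx scale prp by (rule lin_pr)

lemma sesq: "sesquilinear scale \<omega>"
  using sympl unfolding symplectic_form_def by blast

lemma coord_eq: "prm \<xi> = prm \<eta> \<Longrightarrow> prp \<xi> = prp \<eta> \<Longrightarrow> \<xi> = \<eta>"
  by (metis decomp)

definition gm :: "('v \<Rightarrow> 'v) \<Rightarrow> 'v \<Rightarrow> 'v" where "gm A v = prm (v, A v)"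
definition gp :: "('v \<Rightarrow> 'v) \<Rightarrow> 'v \<Rightarrow> 'v" where "gp A v = prp (v, A v)"
text \<open>The unitary whose graph is \<open>Gr A\<close> in the polarization: it takes the first
  component of \<open>(v, A v)\<close> to the second.\<close>

definition u :: "('v \<Rightarrow> 'v) \<Rightarrow> 'v \<Rightarrow> 'v" where "u A x = gp A (inv_into UNIV (gm A) x)"

context
  fixes A assumes A: "A \<in> Sp scale \<omega>"
begin

interpretation A: Vector_Spaces.linear scale scale A by (rule SpD(1)[OF A])

lemma linear_gm: "Vector_Spaces.linear scale scale (gm A)"
  and linear_gp: "Vector_Spaces.linear scale scale (gp A)"
proof -
  have e: "(v + w, A (v + w)) = (v, A v) + (w, A w)" "(scale c v, A (scale c v)) = sx c (v, A v)" for v w c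
    by (simp_all add: A.add A.scale pr.scale_prod)
  show "Vector_Spaces.linear scale scale (gm A)" "Vector_Spaces.linear scale scale (gp A)"
    unfolding Vector_Spaces.linear_iff gm_def gp_def e prm.add prm.scale prp.add prp.scale
    using vector_space_axioms by blast+
qed

text \<open>The doubled form vanishes on \<open>Gr A\<close>, and in the polarization it is a
  difference of inner products of components.\<close>

lemma ip_gm_gp: "ip (gm A v) (gm A w) = ip (gp A v) (gp A w)"
  using form[of "(v, A v)" "(w, A w)"] SpD(3)[OF A, of v w] by (simp add: double_form_def gm_def gp_def)

lemma inj_gm: "inj (gm A)"
proof -
  interpret gm: Vector_Spaces.linear scale scale "gm A" by (rule linear_gm)
  have "v = 0" if "gm A v = 0" for v
  proof -
    have "gp A v = 0" using ip_gm_gp[of v v] that by (simp add: ip_self_eq_0)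
    hence "(v, A v) = 0" using that by (intro coord_eq) (simp_all add: gm_def gp_def prm.zero prp.zero)
    thus ?thesis by (simp add: zero_prod_def)
  qed
  thus ?thesis unfolding gm.inj_iff_eq_0 by blast
qed

lemma gm_surj: "\<exists>v. x = gm A v"
  using linear_inj_imp_surj[OF linear_gm inj_gm] by (metis surjD)

lemma u_gm: "u A (gm A v) = gp A v"
  using inj_gm by (simp add: u_def)

lemma unitary_u: "unitary (u A)"
proof -
  interpret gm: Vector_Spaces.linear scale scale "gm A" by (rule linear_gm)
  interpret gp: Vector_Spaces.linear scale scale "gp A" by (rule linear_gp)
  have "u A (x + y) = u A x + u A y" for x y
  proof -
    obtain v w where "x = gm A v" "y = gm A w" using gm_surj by metis
    thus ?thesis by (simp add: gm.add[symmetric] u_gm gp.add)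
  qed
  moreover have "u A (scale c x) = scale c (u A x)" for c x
  proof -
    obtain v where "x = gm A v" using gm_surj by metis
    thus ?thesis by (simp add: gm.scale[symmetric] u_gm gp.scale)
  qed
  moreover have "ip (u A x) (u A y) = ip x y" for x y
  proof -
    obtain v w where "x = gm A v" "y = gm A w" using gm_surj by metis
    thus ?thesis by (simp add: u_gm ip_gm_gp)
  qed
  ultimately show ?thesis unfolding unitary_def Vector_Spaces.linear_iff using vector_space_axioms by blast
qed

lemma u_inj: "u A x = u A y \<Longrightarrow> x = y"
  using unitary_inj[OF unitary_u] by (rule injD)

lemma inv_u: "inv_into UNIV (u A) (u A x) = x" "u A (inv_into UNIV (u A) x) = x"
  using unitary_bij[OF unitary_u] unitary_inj[OF unitary_u] by (simp_all add: bij_is_surj surj_f_inv_f)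

lemma mem_Gr_iff: "\<xi> \<in> Gr A \<longleftrightarrow> prp \<xi> = u A (prm \<xi>)"
proof
  assume "\<xi> \<in> Gr A"
  then obtain v where "\<xi> = (v, A v)" by (auto simp: Gr_def)
  thus "prp \<xi> = u A (prm \<xi>)" using u_gm[of v] by (simp add: gm_def gp_def)
next
  assume h: "prp \<xi> = u A (prm \<xi>)"
  obtain v where v: "prm \<xi> = gm A v" using gm_surj by blast
  have "\<xi> = (v, A v)" using h v u_gm[of v] by (intro coord_eq) (simp_all add: gm_def gp_def)
  thus "\<xi> \<in> Gr A" by (auto simp: Gr_def)
qed

lemma graph_map_Gr: "graph_map sx (double_form \<omega>) (Gr A) (phm x) = php (u A x)"
  unfolding graph_map_def X_plus
proof (rule the_equality)
  show "php (u A x) \<in> range php \<and> phm x + php (u A x) \<in> Gr A"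
    by (simp add: mem_Gr_iff prm.add prp.add retr)
next
  fix y assume y: "y \<in> range php \<and> phm x + y \<in> Gr A"
  then obtain w where "y = php w" by blast
  thus "y = php (u A x)" using y by (simp add: mem_Gr_iff prm.add prp.add retr)
qed

end

text \<open>The operator \<open>relative_map\<close> of \<open>Gr A\<close> and \<open>Gr B\<close>,
  transported to the base space by \<open>php\<close>.\<close>

definition rel :: "('v \<Rightarrow> 'v) \<Rightarrow> ('v \<Rightarrow> 'v) \<Rightarrow> 'v \<Rightarrow> 'v" where
  "rel A B x = u A (inv_into UNIV (u B) x)"

lemma rel_u: "B \<in> Sp scale \<omega> \<Longrightarrow> rel A B (u B x) = u A x"
  by (simp add: rel_def inv_u)

lemma unitary_rel: "A \<in> Sp scale \<omega> \<Longrightarrow> B \<in> Sp scale \<omega> \<Longrightarrow> unitary (rel A B)"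
  unfolding rel_def[abs_def] by (rule unitary_comp[OF unitary_u unitary_inv[OF unitary_u]])

lemma u_surj: "B \<in> Sp scale \<omega> \<Longrightarrow> \<exists>x. y = u B x"
  using inv_u(2) by metis

lemma rel_trans:
  assumes "B \<in> Sp scale \<omega>" "C \<in> Sp scale \<omega>" shows "rel A B (rel B C x) = rel A C x"
proof -
  obtain y where "x = u C y" using u_surj[OF assms(2)] by blast
  thus ?thesis by (simp add: rel_u assms)
qed

lemma rel_self: "A \<in> Sp scale \<omega> \<Longrightarrow> rel A A x = x"
  by (simp add: rel_def inv_u)

lemma inv_rel:
  assumes "A \<in> Sp scale \<omega>" "B \<in> Sp scale \<omega>" shows "inv_into UNIV (rel A B) = rel B A"
proof
  fix x
  have "rel A B (rel B A x) = x" by (simp add: rel_trans rel_self assms)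
  thus "inv_into UNIV (rel A B) x = rel B A x"
    using unitary_inj[OF unitary_rel[OF assms]] by (metis inv_f_f)
qed

lemma relative_map_Gr:
  assumes "A \<in> Sp scale \<omega>" "B \<in> Sp scale \<omega>"
  shows "relative_map sx (double_form \<omega>) (Gr A) (Gr B) (php x) = php (rel A B x)"
proof -
  let ?G = "graph_map sx (double_form \<omega>) (Gr B)"
  have inj: "inj_on ?G (range phm)"
  proof (rule inj_onI)
    fix \<xi> \<eta> assume "\<xi> \<in> range phm" "\<eta> \<in> range phm" "?G \<xi> = ?G \<eta>"
    then obtain v w where "\<xi> = phm v" "\<eta> = phm w" "php (u B v) = php (u B w)"
      using graph_map_Gr[OF assms(2)] by auto
    thus "\<xi> = \<eta>" using u_inj[OF assms(2)] retr(4) by metis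
  qed
  have "?G (phm (inv_into UNIV (u B) x)) = php x"
    by (simp add: graph_map_Gr[OF assms(2)] inv_u[OF assms(2)])
  hence "inv_into (range phm) ?G (php x) = phm (inv_into UNIV (u B) x)"
    using inv_into_f_f[OF inj] by (metis rangeI)
  thus ?thesis unfolding relative_map_def X_minus by (simp add: graph_map_Gr[OF assms(1)] rel_def)
qed

text \<open>\<open>php\<close> is injective and conjugates \<open>rel A B\<close> to
  \<open>relative_map\<close>, so generalized eigenspaces have equal dimensions. This replaces
  \<open>alg_mult\<close> by the multiset \<open>eigs\<close>.\<close>

lemma alg_mult_relative_map:
  assumes "A \<in> Sp scale \<omega>" "B \<in> Sp scale \<omega>"
  shows "alg_mult sx (X_plus sx (double_form \<omega>)) (relative_map sx (double_form \<omega>) (Gr A) (Gr B)) z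
     = count (eigs (rel A B)) z"
proof -
  let ?T = "relative_map sx (double_form \<omega>) (Gr A) (Gr B)"
  let ?S = "{x. \<exists>n. ((\<lambda>x. rel A B x - scale z x) ^^ n) x = 0}"
  have pow: "((\<lambda>y. ?T y - sx z y) ^^ n) (php x) = php (((\<lambda>x. rel A B x - scale z x) ^^ n) x)" for n x
    by (induction n) (simp_all add: relative_map_Gr[OF assms] php.diff php.scale)
  have inj: "inj php" by (metis injI retr(4))
  have "php x = 0 \<longleftrightarrow> x = 0" for x using inj php.zero by (metis injD)
  hence S: "{x. \<exists>n. ((\<lambda>y. ?T y - sx z y) ^^ n) (php x) = 0} = ?S" by (simp add: pow)
  have "{y \<in> range php. \<exists>n. ((\<lambda>y. ?T y - sx z y) ^^ n) y = 0}
      = php ` {x. \<exists>n. ((\<lambda>y. ?T y - sx z y) ^^ n) (php x) = 0}" by blast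
  hence "alg_mult sx (X_plus sx (double_form \<omega>)) ?T z = pr.p.dim (php ` ?S)"
    unfolding alg_mult_def X_plus S by simp
  also have "\<dots> = dim ?S"
  proof -
    interpret pp: finite_dimensional_vector_space_pair_1 scale Basis sx by unfold_locales
    show ?thesis by (rule pp.dim_image_eq[OF lin_ph(2)]) (rule inj_on_subset[OF inj subset_UNIV])
  qed
  also have "\<dots> = count (eigs (rel A B)) z"
  proof -
    obtain f w where "diagonalized (rel A B) f w" using unitary_diag[OF unitary_rel[OF assms]] by blast
    thus ?thesis by (rule count_eigs(2)[symmetric])
  qed
  finally show ?thesis .
qed

section \<open>The Maslov index of a pair of symplectic paths\<close>

lemma card_Basis_pair: "card pr.Basis_pair = 2 * N"
  using pr.dim_Times[OF subspace_UNIV subspace_UNIV] by simp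

lemma half_dim: "half_dim sx = N"
  by (simp add: half_dim_def card_Basis_pair)

lemma eigen_angles_iff:
  assumes "\<And>t. t \<in> {a..b} \<Longrightarrow> \<alpha> t \<in> Sp scale \<omega>" "\<And>t. t \<in> {a..b} \<Longrightarrow> \<beta> t \<in> Sp scale \<omega>"
  shows "eigen_angles sx (double_form \<omega>) a b (\<lambda>t. Gr (\<alpha> t)) (\<lambda>t. Gr (\<beta> t)) \<theta>
     \<longleftrightarrow> angle_lift N a b (\<lambda>t. eigs (rel (\<alpha> t) (\<beta> t))) \<theta>"
proof -
  have "(\<forall>z. card {j. j < N \<and> exp (\<i> * complex_of_real (\<theta> j t)) = z} =
       alg_mult sx (X_plus sx (double_form \<omega>)) (relative_map sx (double_form \<omega>) (Gr (\<alpha> t)) (Gr (\<beta> t))) z)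
     \<longleftrightarrow> image_mset (\<lambda>j. cis (\<theta> j t)) (mset_set {..<N}) = eigs (rel (\<alpha> t) (\<beta> t))"
    if "t \<in> {a..b}" for t
    unfolding alg_mult_relative_map[OF assms(1)[OF that] assms(2)[OF that]] multiset_eq_iff
    by (simp add: count_image_mset_set cis_conv_exp)
  thus ?thesis unfolding eigen_angles_def angle_lift_def half_dim by auto
qed

text \<open>No initial value is prescribed, so constant paths and right translates by a fixed map
  are included.\<close>

definition sp_path_on :: "real \<Rightarrow> real \<Rightarrow> (real \<Rightarrow> 'v \<Rightarrow> 'v) \<Rightarrow> bool" where
  "sp_path_on a b \<alpha> \<longleftrightarrow> (\<forall>t\<in>{a..b}. \<alpha> t \<in> Sp scale \<omega>) \<and>
     (\<forall>v f. Vector_Spaces.linear scale (*) f \<longrightarrow> continuous_on {a..b} (\<lambda>t. f (\<alpha> t v)))"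

lemma sp_path_on_const: "A \<in> Sp scale \<omega> \<Longrightarrow> sp_path_on a b (\<lambda>_. A)"
  by (simp add: sp_path_on_def)

lemma sp_path_on_comp: "sp_path_on a b \<alpha> \<Longrightarrow> A \<in> Sp scale \<omega> \<Longrightarrow> sp_path_on a b (\<lambda>t. \<alpha> t \<circ> A)"
  by (simp add: sp_path_on_def Sp_comp)

text \<open>Follow the moving vector \<open>gm (\<alpha> s) v\<close>: its image
  \<open>gp (\<alpha> s) v\<close> is explicit, and both are continuous in \<open>s\<close>.\<close>

lemma continuous_on_u:
  assumes \<alpha>: "sp_path_on a b \<alpha>" shows "continuous_on {a..b} (\<lambda>t. ip (u (\<alpha> t) x) y)"
proof (rule unitary_continuous)
  have Sp: "\<alpha> t \<in> Sp scale \<omega>" if "t \<in> {a..b}" for t using \<alpha> that by (simp add: sp_path_on_def)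
  show "unitary (u (\<alpha> t))" if "t \<in> {a..b}" for t by (rule unitary_u[OF Sp[OF that]])
  have cont: "continuous_on {a..b} (\<lambda>t. ip (pj (v, \<alpha> t v)) y)"
    if pj: "Vector_Spaces.linear sx scale pj" for v y and pj :: "'v \<times> 'v \<Rightarrow> 'v"
  proof -
    interpret pj: Vector_Spaces.linear sx scale pj by fact
    \<comment> \<open>Continuity of a symplectic path is tested on linear functionals of
      \<open>\<alpha> t v\<close>; this is the functional to which the hypothesis is
      applied.\<close>
    have "Vector_Spaces.linear scale (*) (\<lambda>w. ip (pj (0, w)) y)"
    proof -
      have "vector_space ((*) :: complex \<Rightarrow> complex \<Rightarrow> complex)" by unfold_locales (simp_all add: algebra_simps)
      moreover have "pj (0, v + w) = pj (0, v) + pj (0, w)" "pj (0, scale c w) = scale c (pj (0, w))" for v w c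
        by (simp_all add: pj.add[symmetric] pj.scale[symmetric] pr.scale_prod)
      ultimately show ?thesis unfolding Vector_Spaces.linear_iff using vector_space_axioms
        by (simp add: ip_simps)
    qed
    hence c: "continuous_on {a..b} (\<lambda>t. ip (pj (v, 0)) y + ip (pj (0, \<alpha> t v)) y)"
      using \<alpha> unfolding sp_path_on_def by (intro continuous_on_add continuous_on_const) blast
    have e: "pj (v, w) = pj (v, 0) + pj (0, w)" for w by (simp add: pj.add[symmetric])
    have "(\<lambda>t. ip (pj (v, \<alpha> t v)) y) = (\<lambda>t. ip (pj (v, 0)) y + ip (pj (0, \<alpha> t v)) y)"
      by (rule ext, subst e) (rule ip_add_left)
    thus ?thesis using c by (simp only:)
  qed
  fix t x assume t: "t \<in> {a..b}"
  obtain v where v: "x = gm (\<alpha> t) v" using gm_surj[OF Sp[OF t]] by blast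
  have "((\<lambda>s. ip (gm (\<alpha> s) v) y) \<longlongrightarrow> ip x y) (at t within {a..b})" for y
    using cont[OF lin_pr(1), of v y] t unfolding v by (simp add: gm_def continuous_on_def)
  moreover have "((\<lambda>s. ip (u (\<alpha> s) (gm (\<alpha> s) v)) y) \<longlongrightarrow> ip (u (\<alpha> t) x) y) (at t within {a..b})" for y
  proof (rule Lim_transform_eventually)
    show "((\<lambda>s. ip (gp (\<alpha> s) v) y) \<longlongrightarrow> ip (u (\<alpha> t) x) y) (at t within {a..b})"
      using cont[OF lin_pr(2), of v y] t unfolding v u_gm[OF Sp[OF t]] by (simp add: gp_def continuous_on_def)
    have "eventually (\<lambda>s. s \<in> {a..b}) (at t within {a..b})" by (simp add: eventually_at_filter)
    thus "eventually (\<lambda>s. ip (gp (\<alpha> s) v) y = ip (u (\<alpha> s) (gm (\<alpha> s) v)) y) (at t within {a..b})"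
      by eventually_elim (simp add: u_gm Sp)
  qed
  ultimately show "\<exists>p. (\<forall>y. ((\<lambda>s. ip (p s) y) \<longlongrightarrow> ip x y) (at t within {a..b})) \<and>
      (\<forall>y. ((\<lambda>s. ip (u (\<alpha> s) (p s)) y) \<longlongrightarrow> ip (u (\<alpha> t) x) y) (at t within {a..b}))"
    by (intro exI[of _ "\<lambda>s. gm (\<alpha> s) v"]) blast
qed

lemma ex_lift_rel:
  assumes "sp_path_on a b \<alpha>" "sp_path_on a b \<beta>" "a \<le> b"
  shows "\<exists>\<theta>. angle_lift N a b (\<lambda>t. eigs (rel (\<alpha> t) (\<beta> t))) \<theta>"
proof (rule ex_angle_lift_eigs)
  have Sp: "\<alpha> t \<in> Sp scale \<omega>" "\<beta> t \<in> Sp scale \<omega>" if "t \<in> {a..b}" for t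
    using assms that by (auto simp: sp_path_on_def)
  show "unitary (rel (\<alpha> t) (\<beta> t))" if "t \<in> {a..b}" for t by (rule unitary_rel[OF Sp[OF that]])
  show "continuous_on {a..b} (\<lambda>t. ip (rel (\<alpha> t) (\<beta> t) x) y)" for x y
    unfolding rel_def
    by (rule unitary_continuous_quotient[OF unitary_u[OF Sp(1)] unitary_u[OF Sp(2)]
        continuous_on_u[OF assms(1)] continuous_on_u[OF assms(2)]])
qed fact

lemma Mas_eq_crossings:
  assumes "sp_path_on a b \<alpha>" "sp_path_on a b \<beta>" "a \<le> b"
    and \<theta>: "angle_lift N a b (\<lambda>t. eigs (rel (\<alpha> t) (\<beta> t))) \<theta>"
  shows "Mas sx (double_form \<omega>) a b (\<lambda>t. Gr (\<alpha> t)) (\<lambda>t. Gr (\<beta> t)) = crossings N \<theta> a b"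
proof -
  have iff: "eigen_angles sx (double_form \<omega>) a b (\<lambda>t. Gr (\<alpha> t)) (\<lambda>t. Gr (\<beta> t)) \<phi>
     \<longleftrightarrow> angle_lift N a b (\<lambda>t. eigs (rel (\<alpha> t) (\<beta> t))) \<phi>" for \<phi>
    by (rule eigen_angles_iff) (use assms in \<open>auto simp: sp_path_on_def\<close>)
  define \<phi> where "\<phi> = (SOME \<phi>. eigen_angles sx (double_form \<omega>) a b (\<lambda>t. Gr (\<alpha> t)) (\<lambda>t. Gr (\<beta> t)) \<phi>)"
  have "angle_lift N a b (\<lambda>t. eigs (rel (\<alpha> t) (\<beta> t))) \<phi>"
    unfolding \<phi>_def iff by (rule someI[of _ \<theta>]) (rule \<theta>)
  from crossings_unique[OF this \<theta> assms(3)] show ?thesis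
    unfolding Mas_def Let_def half_dim crossings_def \<phi>_def by simp
qed

section \<open>Total defects of pairs and triples of graphs\<close>

definition Edef :: "('v \<Rightarrow> 'v) \<Rightarrow> ('v \<Rightarrow> 'v) \<Rightarrow> real" where
  "Edef A B = total_defect (eigs (rel A B))"

text \<open>A fixed vector of \<open>rel A B\<close> is the second component of a common point of
  the two graphs, and common points correspond to solutions of \<open>A v = B v\<close>.\<close>

lemma fixed_rel:
  assumes A: "A \<in> Sp scale \<omega>" and B: "B \<in> Sp scale \<omega>"
  shows "dim {x. rel A B x = x} = dim {v. A v = B v}"
proof -
  interpret gp: Vector_Spaces.linear scale scale "gp B" by (rule linear_gp[OF B])
  have "{x. rel A B x = x} = gp B ` {v. A v = B v}"
  proof (intro equalityI subsetI)
    fix x assume x: "x \<in> {x. rel A B x = x}"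
    obtain v where v: "x = u B (gm B v)" using u_surj[OF B] gm_surj[OF B] by metis
    have "u A (gm B v) = gp B v" using x v rel_u[OF B, of A "gm B v"] u_gm[OF B, of v] by simp
    hence "(v, B v) \<in> Gr A" by (simp add: mem_Gr_iff[OF A] gm_def gp_def)
    hence "A v = B v" by (auto simp: Gr_def)
    thus "x \<in> gp B ` {v. A v = B v}" using v u_gm[OF B] by auto
  next
    fix x assume "x \<in> gp B ` {v. A v = B v}"
    then obtain v where v: "x = gp B v" "A v = B v" by blast
    have "rel A B (gp B v) = u A (gm B v)" using rel_u[OF B] u_gm[OF B] by metis
    also have "gm B v = gm A v" by (simp add: gm_def v)
    also have "u A (gm A v) = gp A v" by (rule u_gm[OF A])
    also have "\<dots> = gp B v" by (simp add: gp_def v)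
    finally show "x \<in> {x. rel A B x = x}" using v by simp
  qed
  moreover have "inj (gp B)"
    unfolding gp.inj_iff_eq_0 using ip_gm_gp[OF B] inj_gm[OF B] linear_gm[OF B]
    by (metis ip_0_left ip_self_eq_0 Vector_Spaces.linear.axioms(3) module_hom.inj_iff_eq_0)
  ultimately show ?thesis
    using pr.dim_image_eq[OF linear_gp[OF B]] by (metis inj_on_subset subset_UNIV)
qed

lemma Edef_swap:
  assumes A: "A \<in> Sp scale \<omega>" and B: "B \<in> Sp scale \<omega>"
  shows "Edef B A = real N - real (dim {v. A v = B v}) - Edef A B"
  using total_defect_inv[OF unitary_rel[OF assms]] fixed_rel[OF assms] inv_rel[OF assms]
  by (simp add: Edef_def)

lemma Edef_self: "A \<in> Sp scale \<omega> \<Longrightarrow> Edef A A = 0"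
proof -
  assume A: "A \<in> Sp scale \<omega>"
  have "rel A A = (\<lambda>x. x)" using rel_self[OF A] by blast
  thus ?thesis by (simp add: Edef_def total_defect_id)
qed

text \<open>\<open>(y p, A2 (y p))\<close> and \<open>(z p, A3 (z p))\<close> are points of the
  second and third graph whose sum lies on the first. By \<open>iso\<close> the doubled form of this
  pair is zero, so the Kashiwara-type form vanishes on \<open>D\<close>; \<open>ne\<close> keeps the
  point of the third graph off the second for nonzero \<open>p\<close>.\<close>

lemma triple_ge:
  assumes A1: "A1 \<in> Sp scale \<omega>" and A2: "A2 \<in> Sp scale \<omega>" and A3: "A3 \<in> Sp scale \<omega>"
    and D: "pr.p.subspace D" and y: "Vector_Spaces.linear sx scale y" and z: "Vector_Spaces.linear sx scale z"
    and rel: "\<And>p. p \<in> D \<Longrightarrow> A1 (y p + z p) = A2 (y p) + A3 (z p)"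
    and iso: "\<And>p. p \<in> D \<Longrightarrow> \<omega> (A2 (y p)) (A3 (z p)) = \<omega> (y p) (z p)"
    and ne: "\<And>p. p \<in> D \<Longrightarrow> A2 (z p) = A3 (z p) \<Longrightarrow> p = 0"
  shows "real (pr.p.dim D) \<le> Edef A1 A2 + Edef A2 A3 - Edef A1 A3"
proof -
  interpret A2: Vector_Spaces.linear scale scale A2 by (rule SpD(1)[OF A2])
  interpret A3: Vector_Spaces.linear scale scale A3 by (rule SpD(1)[OF A3])
  interpret y: Vector_Spaces.linear sx scale y by fact
  interpret z: Vector_Spaces.linear sx scale z by fact
  interpret gm2: Vector_Spaces.linear scale scale "gm A2" by (rule linear_gm[OF A2])
  interpret gp3: Vector_Spaces.linear scale scale "gp A3" by (rule linear_gp[OF A3])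
  interpret u3: Vector_Spaces.linear scale scale "u A3" using unitary_u[OF A3] by (simp add: unitary_def)
  \<comment> \<open>Applying \<open>u A3\<close> to the first component of the polarization turns
    \<open>Gr A3\<close> into the diagonal and \<open>Gr A2\<close> into the graph of
    \<open>rel A2 A3\<close>; \<open>Y p\<close> and \<open>Z p\<close> are the first components of
    the two points after this change.\<close>
  define Y where "Y p = u A3 (gm A2 (y p))" for p
  define Z where "Z p = gp A3 (z p)" for p
  have linYZ: "Vector_Spaces.linear sx scale Y" "Vector_Spaces.linear sx scale Z"
    unfolding Vector_Spaces.linear_iff Y_def Z_def using vector_space_axioms pr.p.vector_space_axioms
    by (simp_all add: y.add y.scale z.add z.scale gm2.add gm2.scale gp3.add gp3.scale u3.add u3.scale)
  have QY: "rel A2 A3 (Y p) = gp A2 (y p)" for p by (simp add: Y_def rel_u[OF A3] u_gm[OF A2])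
  have Zu: "Z p = u A3 (gm A3 (z p))" for p by (simp add: Z_def u_gm[OF A3])
  have "real (pr.p.dim D) \<le> total_defect (eigs (\<lambda>x. rel A1 A3 (inv_into UNIV (rel A2 A3) x)))
      + total_defect (eigs (rel A2 A3)) - total_defect (eigs (rel A1 A3))"
  proof (rule triple_defect_ge[OF unitary_rel[OF A2 A3] unitary_rel[OF A1 A3] pr.p.finite_dimensional_vector_space_axioms D linYZ])
    fix p assume p: "p \<in> D"
    let ?q = "(y p, A2 (y p))" and ?r = "(z p, A3 (z p))"
    have "?q + ?r \<in> Gr A1" using rel[OF p] by (auto simp: Gr_def)
    hence "prp ?q + prp ?r = u A1 (prm ?q + prm ?r)" by (simp only: mem_Gr_iff[OF A1] prm.add prp.add)
    moreover have "Y p + Z p = u A3 (prm ?q + prm ?r)"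
      unfolding Y_def Zu u3.add by (simp add: gm_def)
    ultimately show "rel A1 A3 (Y p + Z p) = rel A2 A3 (Y p) + Z p"
      unfolding QY by (simp add: rel_u[OF A3] Z_def gp_def)
    have "double_form \<omega> ?q ?r = 0" using iso[OF p] by (simp add: double_form_def)
    hence "ip (prm ?q) (prm ?r) - ip (prp ?q) (prp ?r) = 0" using form[of ?q ?r] by simp
    moreover have "ip (Y p) (Z p) = ip (prm ?q) (prm ?r)"
      using unitary_u[OF A3] by (simp add: Y_def Zu unitary_def gm_def)
    ultimately show "Im (ip (Y p - rel A2 A3 (Y p)) (Z p)) \<ge> 0"
      unfolding ip_diff_left QY by (simp add: Z_def gp_def)
    assume "rel A2 A3 (Z p) = Z p"
    hence "u A2 (gm A3 (z p)) = gp A3 (z p)"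
      using rel_u[OF A3, of A2 "gm A3 (z p)"] by (simp add: Zu u_gm[OF A3])
    hence "?r \<in> Gr A2" by (simp add: mem_Gr_iff[OF A2] gm_def gp_def)
    thus "p = 0" by (intro ne[OF p]) (auto simp: Gr_def)
  qed
  moreover have "(\<lambda>x. rel A1 A3 (inv_into UNIV (rel A2 A3) x)) = rel A1 A2"
    by (simp add: inv_rel[OF A2 A3] rel_trans A2 A3 fun_eq_iff)
  ultimately show ?thesis by (simp add: Edef_def)
qed

section \<open>Iterated paths\<close>

lemma path_iterate_segment:
  assumes "\<tau> > 0" "k > 0" "t \<in> {0..real k * \<tau>}"
  shows "\<exists>l. 1 \<le> l \<and> l \<le> k \<and> (real l - 1) * \<tau> \<le> t \<and> t \<le> real l * \<tau>"
  using assms(2,3)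
proof (induction k)
  case (Suc k)
  show ?case
  proof (cases "k > 0 \<and> t \<le> real k * \<tau>")
    case True
    thus ?thesis using Suc by (metis atLeastAtMost_iff le_SucI)
  next
    case False
    hence "real k * \<tau> \<le> t" using Suc.prems by (cases "k = 0") auto
    thus ?thesis using Suc.prems by (intro exI[of _ "Suc k"]) auto
  qed
qed simp

context
  fixes \<tau> :: real and \<gamma> :: "real \<Rightarrow> 'v \<Rightarrow> 'v"
  assumes \<tau>: "\<tau> > 0" and \<gamma>: "\<gamma> \<in> sp_paths scale \<omega> \<tau>"
begin

lemma \<gamma>0: "\<gamma> 0 = id" using \<gamma> by (simp add: sp_paths_def)

lemmas iterate_eq = path_iterate_eq[where \<tau> = \<tau> and \<gamma> = \<gamma>, OF \<tau> \<gamma>0]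

lemma M_Sp: "\<gamma> \<tau> \<in> Sp scale \<omega>" using \<gamma> \<tau> by (simp add: sp_paths_def)

lemma Mk_Sp: "\<gamma> \<tau> ^^ k \<in> Sp scale \<omega>" by (rule Sp_funpow[OF M_Sp vector_space_axioms])

lemma sp_path_iterate:
  assumes "k > 0" shows "sp_path_on 0 (real k * \<tau>) (path_iterate \<tau> \<gamma> k)"
  unfolding sp_path_on_def
proof (intro conjI ballI allI impI)
  fix t assume "t \<in> {0..real k * \<tau>}"
  then obtain l where l: "1 \<le> l" "l \<le> k" "(real l - 1) * \<tau> \<le> t" "t \<le> real l * \<tau>"
    using path_iterate_segment[OF \<tau> assms] by blast
  have "t - (real l - 1) * \<tau> \<in> {0..\<tau>}" using l by (auto simp: algebra_simps)
  hence "\<gamma> (t - (real l - 1) * \<tau>) \<in> Sp scale \<omega>" using \<gamma> by (simp add: sp_paths_def)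
  thus "path_iterate \<tau> \<gamma> k t \<in> Sp scale \<omega>"
    unfolding iterate_eq[OF l] using Sp_comp Mk_Sp by blast
next
  fix v and f :: "'v \<Rightarrow> complex" assume f: "Vector_Spaces.linear scale (*) f"
  let ?I = "\<lambda>l. {(real l - 1) * \<tau>..real l * \<tau>}"
  have "continuous_on (\<Union>l\<in>{1..k}. ?I l) (\<lambda>t. f (path_iterate \<tau> \<gamma> k t v))"
  proof (rule continuous_on_closed_Union)
    fix l assume l: "l \<in> {1..k}"
    have "continuous_on {0..\<tau>} (\<lambda>t. f (\<gamma> t ((\<gamma> \<tau> ^^ (l - 1)) v)))"
      using \<gamma> f by (simp add: sp_paths_def)
    hence "continuous_on (?I l) (\<lambda>t. f (\<gamma> (t - (real l - 1) * \<tau>) ((\<gamma> \<tau> ^^ (l - 1)) v)))"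
      by (rule continuous_on_compose2) (auto intro!: continuous_intros simp: algebra_simps)
    thus "continuous_on (?I l) (\<lambda>t. f (path_iterate \<tau> \<gamma> k t v))"
      by (rule continuous_on_eq) (use l iterate_eq[of l k] in auto)
  qed auto
  thus "continuous_on {0..real k * \<tau>} (\<lambda>t. f (path_iterate \<tau> \<gamma> k t v))"
    by (rule continuous_on_subset) (use path_iterate_segment[OF \<tau> assms] in fastforce)
qed

lemma path_iterate_0: "k > 0 \<Longrightarrow> path_iterate \<tau> \<gamma> k 0 = id"
  using iterate_eq[of 1 k 0] \<tau> by (simp add: \<gamma>0)

lemma path_iterate_end: "k > 0 \<Longrightarrow> path_iterate \<tau> \<gamma> k (real k * \<tau>) = \<gamma> \<tau> ^^ k"
  using iterate_eq[of k k "real k * \<tau>"] \<tau>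
  by (cases k) (simp_all add: algebra_simps)

lemma path_iterate_prefix:
  assumes "k > 0" "k \<le> n" "t \<in> {0..real k * \<tau>}"
  shows "path_iterate \<tau> \<gamma> n t = path_iterate \<tau> \<gamma> k t"
proof -
  obtain l where l: "1 \<le> l" "l \<le> k" "(real l - 1) * \<tau> \<le> t" "t \<le> real l * \<tau>"
    using path_iterate_segment[OF \<tau> assms(1,3)] by blast
  show ?thesis using iterate_eq[OF l] iterate_eq[OF l(1) _ l(3,4), of n] l assms by simp
qed

text \<open>After \<open>n\<close> periods the iteration starts again, composed on the right with
  the \<open>n\<close>-th power of the end map; this is the source of the factor \<open>A\<close> in
  the comparison of indices.\<close>

lemma path_iterate_suffix:
  assumes "k > 0" "t \<in> {0..real k * \<tau>}"
  shows "path_iterate \<tau> \<gamma> (n + k) (real n * \<tau> + t) = path_iterate \<tau> \<gamma> k t \<circ> (\<gamma> \<tau> ^^ n)"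
proof -
  obtain l where l: "1 \<le> l" "l \<le> k" "(real l - 1) * \<tau> \<le> t" "t \<le> real l * \<tau>"
    using path_iterate_segment[OF \<tau> assms] by blast
  have "path_iterate \<tau> \<gamma> (n + k) (real n * \<tau> + t)
      = \<gamma> (real n * \<tau> + t - (real (n + l) - 1) * \<tau>) \<circ> (\<gamma> \<tau> ^^ (n + l - 1))"
    by (rule iterate_eq) (use l in \<open>auto simp: algebra_simps\<close>)
  also have "real n * \<tau> + t - (real (n + l) - 1) * \<tau> = t - (real l - 1) * \<tau>" by (simp add: algebra_simps)
  also have "\<gamma> \<tau> ^^ (n + l - 1) = (\<gamma> \<tau> ^^ (l - 1)) \<circ> (\<gamma> \<tau> ^^ n)"
    using l(1) by (metis Nat.add_diff_assoc add.commute funpow_add)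
  finally show ?thesis unfolding iterate_eq[OF l] by (simp only: o_assoc)
qed

text \<open>The path \<open>Gr (\<beta> A)\<close> meets \<open>Gr \<beta>\<close> in a space of constant dimension, so its crossings with
  \<open>Gr \<beta>\<close> cancel and the difference of the two indices is a difference of defects.\<close>

lemma i1_difference:
  assumes "k1 > 0" "k2 > 0"
  defines "A \<equiv> \<gamma> \<tau> ^^ k1" and "B \<equiv> \<gamma> \<tau> ^^ k2"
  shows "real_of_int (i1 scale \<omega> (real (k1 + k2) * \<tau>) (path_iterate \<tau> \<gamma> (k1 + k2))
      - i1 scale \<omega> (real k1 * \<tau>) (path_iterate \<tau> \<gamma> k1) - i1 scale \<omega> (real k2 * \<tau>) (path_iterate \<tau> \<gamma> k2))
    = Edef (B \<circ> A) id - Edef (B \<circ> A) B - Edef B id"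
proof -
  let ?K = "k1 + k2" and ?a = "real k1 * \<tau>" and ?b = "real k2 * \<tau>"
  have Kab: "real ?K * \<tau> = ?a + ?b" by (simp add: algebra_simps)
  have idS: "id \<in> Sp scale \<omega>" using Mk_Sp[of 0] by (simp add: id_def)
  have AS: "A \<in> Sp scale \<omega>" and BS: "B \<in> Sp scale \<omega>" unfolding A_def B_def by (rule Mk_Sp)+
  define \<beta> where "\<beta> = path_iterate \<tau> \<gamma> k2"
  have ab: "0 \<le> ?a" "0 \<le> ?b" using \<tau> by simp_all
  have spK: "sp_path_on 0 (?a + ?b) (path_iterate \<tau> \<gamma> ?K)" using sp_path_iterate[of ?K] assms(1) Kab by simp
  have sp1: "sp_path_on 0 ?a (path_iterate \<tau> \<gamma> k1)" and sp2: "sp_path_on 0 ?b \<beta>"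
    unfolding \<beta>_def using sp_path_iterate assms by auto
  obtain \<theta> where \<theta>: "angle_lift N 0 (?a + ?b) (\<lambda>t. eigs (rel (path_iterate \<tau> \<gamma> ?K t) id)) \<theta>"
    using ex_lift_rel[OF spK sp_path_on_const[OF idS]] ab by auto
  obtain \<phi> where \<phi>: "angle_lift N 0 ?b (\<lambda>t. eigs (rel (\<beta> t) id)) \<phi>"
    using ex_lift_rel[OF sp2 sp_path_on_const[OF idS]] ab by auto
  obtain \<psi> where \<psi>: "angle_lift N 0 ?b (\<lambda>t. eigs (rel (\<beta> t \<circ> A) (\<beta> t))) \<psi>"
    using ex_lift_rel[OF sp_path_on_comp[OF sp2 AS] sp2] ab by auto
  have iK: "i1 scale \<omega> (real ?K * \<tau>) (path_iterate \<tau> \<gamma> ?K) = crossings N \<theta> 0 (?a + ?b)"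
    unfolding i1_def Kab using Mas_eq_crossings[OF spK sp_path_on_const[OF idS] _ \<theta>] ab by simp
  have "angle_lift N 0 ?a (\<lambda>t. eigs (rel (path_iterate \<tau> \<gamma> k1 t) id)) \<theta>"
    using angle_lift_subinterval[OF \<theta>, of 0 ?a] ab path_iterate_prefix[OF assms(1), of ?K]
    by (simp add: angle_lift_def)
  hence ik1: "i1 scale \<omega> ?a (path_iterate \<tau> \<gamma> k1) = crossings N \<theta> 0 ?a"
    unfolding i1_def using Mas_eq_crossings[OF sp1 sp_path_on_const[OF idS]] ab by simp
  have ik2: "i1 scale \<omega> ?b (path_iterate \<tau> \<gamma> k2) = crossings N \<phi> 0 ?b"
    unfolding i1_def using Mas_eq_crossings[OF sp2 sp_path_on_const[OF idS] _ \<phi>] ab by (simp add: \<beta>_def)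
  \<comment> \<open>The second stretch of the lift \<open>\<theta>\<close>, shifted in time: with
    one lift for the whole path its crossings simply split at the junction.\<close>
  define \<eta> where "\<eta> j t = \<theta> j (?a + t)" for j t
  have \<eta>: "angle_lift N 0 ?b (\<lambda>t. eigs (rel (\<beta> t \<circ> A) id)) \<eta>"
    unfolding angle_lift_def
  proof (intro conjI allI impI ballI)
    fix j assume "j < N"
    hence "continuous_on {0..?a + ?b} (\<theta> j)" using \<theta> by (simp add: angle_lift_def)
    thus "continuous_on {0..?b} (\<eta> j)"
      unfolding \<eta>_def[abs_def] by (rule continuous_on_compose2) (use ab in \<open>auto intro!: continuous_intros\<close>)
  next
    fix t assume t: "t \<in> {0..?b}"
    hence "image_mset (\<lambda>j. cis (\<theta> j (?a + t))) (mset_set {..<N}) = eigs (rel (path_iterate \<tau> \<gamma> ?K (?a + t)) id)"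
      using \<theta> ab by (simp add: angle_lift_def)
    thus "image_mset (\<lambda>j. cis (\<eta> j t)) (mset_set {..<N}) = eigs (rel (\<beta> t \<circ> A) id)"
      unfolding path_iterate_suffix[OF assms(2) t] by (simp add: \<eta>_def \<beta>_def A_def)
  qed
  have "crossings N \<theta> ?a (?a + ?b) = crossings N \<eta> 0 ?b" by (simp add: crossings_def \<eta>_def)
  hence diff: "i1 scale \<omega> (real ?K * \<tau>) (path_iterate \<tau> \<gamma> ?K) - i1 scale \<omega> ?a (path_iterate \<tau> \<gamma> k1)
      - i1 scale \<omega> ?b (path_iterate \<tau> \<gamma> k2) = crossings N \<eta> 0 ?b - crossings N \<phi> 0 ?b"
    unfolding iK ik1 ik2 using crossings_trans[of N \<theta> 0 ?a "?a + ?b"] by simp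
  have \<beta>S: "\<beta> t \<in> Sp scale \<omega>" "\<beta> t \<circ> A \<in> Sp scale \<omega>" if "t \<in> {0..?b}" for t
    using sp2 that Sp_comp[OF _ AS] by (auto simp: sp_path_on_def)
  have \<beta>0: "\<beta> 0 = id" and \<beta>1: "\<beta> ?b = B"
    unfolding \<beta>_def B_def using path_iterate_0 path_iterate_end assms by auto
  have sums: "(\<Sum>j<N. \<psi> j ?b) - (\<Sum>j<N. \<psi> j 0) + ((\<Sum>j<N. \<phi> j ?b) - (\<Sum>j<N. \<phi> j 0))
     = (\<Sum>j<N. \<eta> j ?b) - (\<Sum>j<N. \<eta> j 0)"
  proof (rule angle_sum_additive[OF \<psi> \<phi> \<eta> _ ab(2)])
    fix t assume t: "t \<in> {0..?b}"
    \<comment> \<open>Inserting \<open>Gr (\<beta> t)\<close> as an intermediate Lagrangian factors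
      the relative unitary.\<close>
    have "rel (\<beta> t \<circ> A) id = (\<lambda>x. rel (\<beta> t \<circ> A) (\<beta> t) (rel (\<beta> t) id x))"
      using rel_trans[OF \<beta>S(1)[OF t] idS] by auto
    thus "prod_mset (eigs (rel (\<beta> t \<circ> A) (\<beta> t))) * prod_mset (eigs (rel (\<beta> t) id)) = prod_mset (eigs (rel (\<beta> t \<circ> A) id))"
      using prod_eigs_comp[OF unitary_rel[OF \<beta>S(2)[OF t] \<beta>S(1)[OF t]] unitary_rel[OF \<beta>S(1)[OF t] idS]] by simp
  qed
  have "\<lceil>\<psi> j 0 / (2 * pi)\<rceil> = \<lceil>\<psi> j ?b / (2 * pi)\<rceil>" if "j < N" for j
  proof (rule ceiling_angle_constant[OF \<psi> _ ab(2) that])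
    fix t assume t: "t \<in> {0..?b}"
    have "{v. (\<beta> t \<circ> A) v = \<beta> t v} = {v. A v = v}"
      using SpD(2)[OF \<beta>S(1)[OF t]] by (auto simp: bij_def inj_eq)
    thus "count (eigs (rel (\<beta> t \<circ> A) (\<beta> t))) 1 = dim {v. A v = v}"
      using count_eigs_1[OF unitary_rel[OF \<beta>S(2)[OF t] \<beta>S(1)[OF t]]] fixed_rel[OF \<beta>S(2)[OF t] \<beta>S(1)[OF t]] by simp
  qed
  hence "crossings N \<psi> 0 ?b = 0" by (simp add: crossings_def)
  \<comment> \<open>At time 0 the path \<open>\<beta>\<close> is the identity, so
    \<open>Edef A id\<close> is the initial defect both here and for \<open>\<eta>\<close>, and it
    cancels.\<close>
  hence "((\<Sum>j<N. \<psi> j ?b) - (\<Sum>j<N. \<psi> j 0)) / (2 * pi) + Edef (B \<circ> A) B - Edef A id = 0"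
    using crossings_eq[OF \<psi> ab(2)] by (simp add: Edef_def \<beta>0 \<beta>1)
  moreover have "real_of_int (crossings N \<eta> 0 ?b) = ((\<Sum>j<N. \<eta> j ?b) - (\<Sum>j<N. \<eta> j 0)) / (2 * pi) + Edef (B \<circ> A) id - Edef A id"
    using crossings_eq[OF \<eta> ab(2)] by (simp add: Edef_def \<beta>0 \<beta>1)
  moreover have "real_of_int (crossings N \<phi> 0 ?b) = ((\<Sum>j<N. \<phi> j ?b) - (\<Sum>j<N. \<phi> j 0)) / (2 * pi) + Edef B id"
    using crossings_eq[OF \<phi> ab(2)] Edef_self[OF idS] by (simp add: Edef_def \<beta>0 \<beta>1)
  moreover have "((\<Sum>j<N. \<psi> j ?b) - (\<Sum>j<N. \<psi> j 0)) / (2 * pi) + ((\<Sum>j<N. \<phi> j ?b) - (\<Sum>j<N. \<phi> j 0)) / (2 * pi)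
     = ((\<Sum>j<N. \<eta> j ?b) - (\<Sum>j<N. \<eta> j 0)) / (2 * pi)"
    unfolding sums[symmetric] add_divide_distrib ..
  ultimately show ?thesis unfolding diff of_int_diff by linarith
qed

end

section \<open>The hyperbolic part\<close>

context
  fixes M assumes M: "M \<in> Sp scale \<omega>"
begin

interpretation M: complex_endo scale Basis M
  by (intro complex_endo.intro complex_endo_axioms.intro finite_dimensional_vector_space_axioms SpD(1)[OF M])

lemma Mk_linear: "Vector_Spaces.linear scale scale (M ^^ k)"
  by (rule SpD(1)[OF Sp_funpow[OF M vector_space_axioms]])

lemma Mk_pres: "\<omega> ((M ^^ k) x) ((M ^^ k) y) = \<omega> x y"
  by (rule SpD(3)[OF Sp_funpow[OF M vector_space_axioms]])

text \<open>Induction on the total length of the lists. With \<open>M x = a x + x'\<close> and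
  \<open>M y = b y + y'\<close>, where \<open>x'\<close> and \<open>y'\<close> are killed by shorter
  lists, invariance of \<open>\<omega>\<close> reduces to
  \<open>a * cnj b * \<omega> x y = \<omega> x y\<close>, and the factor is not 1.\<close>

lemma kill_isotropic:
  assumes C: "\<And>z w. C z \<Longrightarrow> C w \<Longrightarrow> z * cnj w \<noteq> 1"
  shows "\<forall>w\<in>set ws. C w \<Longrightarrow> \<forall>w\<in>set vs. C w \<Longrightarrow> M.kill ws x = 0 \<Longrightarrow> M.kill vs y = 0 \<Longrightarrow> \<omega> x y = 0"
proof (induction "length ws + length vs" arbitrary: ws vs x y rule: less_induct)
  case less
  note s = sesquilinearD[OF sesq]
  consider "x = 0" | "y = 0" | a ws' b vs' where "ws = a # ws'" "vs = b # vs'"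
    using less.prems(3,4) by (cases ws; cases vs) simp_all
  thus ?case
  proof cases
    case 1
    thus ?thesis using s(2)[of 0 0 y] by simp
  next
    case 2
    thus ?thesis using s(4)[of x 0 0] by simp
  next
    case (3 a ws' b vs')
    note e = 3
    let ?x = "M.shift a x" and ?y = "M.shift b y"
    have "\<omega> x ?y = 0" "\<omega> ?x y = 0" "\<omega> ?x ?y = 0"
      using less.prems less.hyps[of ws vs' x ?y] less.hyps[of ws' vs ?x y] less.hyps[of ws' vs' ?x ?y] by (auto simp: e)
    moreover have "M x = scale a x + ?x" "M y = scale b y + ?y" by (simp_all add: M.shift_def)
    moreover have "\<omega> (M x) (M y) = \<omega> x y" by (rule SpD(3)[OF M])
    ultimately have "a * cnj b * \<omega> x y = \<omega> x y" by (simp add: s mult.left_commute)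
    moreover have "a * cnj b \<noteq> 1" using C less.prems(1,2) by (simp add: e)
    ultimately show "\<omega> x y = 0" by (metis mult_cancel_right1)
  qed
qed

text \<open>The products \<open>z * cnj w\<close> have modulus below 1 for two points inside the
  circle and above 1 for two points outside, so both spaces are isotropic. A nonzero fixed vector of
  a power of \<open>M\<close> would produce an eigenvalue that is a root of unity, hence on the
  circle.\<close>

lemma ex_hyperbolic:
  "\<exists>V. real N - real (elliptic_height scale M) \<le> 2 * real (dim V) \<and> subspace V \<and>
     (\<forall>k. \<forall>x\<in>V. (M ^^ k) x \<in> V) \<and> (\<forall>x\<in>V. \<forall>y\<in>V. \<omega> x y = 0) \<and>
     (\<forall>k>0. \<forall>x\<in>V. (M ^^ k) x = x \<longrightarrow> x = 0)"
proof -
  have props: "subspace V \<and> (\<forall>k. \<forall>x\<in>V. (M ^^ k) x \<in> V) \<and> (\<forall>x\<in>V. \<forall>y\<in>V. \<omega> x y = 0) \<and>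
     (\<forall>k>0. \<forall>x\<in>V. (M ^^ k) x = x \<longrightarrow> x = 0)"
    if V: "V = M.gen_eig C" and C: "\<And>z w. C z \<Longrightarrow> C w \<Longrightarrow> z * cnj w \<noteq> 1" and C1: "\<And>z. C z \<Longrightarrow> cmod z \<noteq> 1" for V C
  proof (intro conjI allI ballI impI)
    show "subspace V" unfolding V by (rule M.gen_eig_subspace)
    show "(M ^^ k) x \<in> V" if "x \<in> V" for k x using that unfolding V by (rule M.gen_eig_funpow)
    show "\<omega> x y = 0" if "x \<in> V" "y \<in> V" for x y
      using that kill_isotropic[OF C] unfolding V M.gen_eig_def by blast
    fix k :: nat and x assume k: "k > 0" and x: "x \<in> V" "(M ^^ k) x = x"
    show "x = 0"
    proof (rule ccontr)
      assume "x \<noteq> 0"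
      interpret Mk: Vector_Spaces.linear scale scale "M ^^ k" by (rule Mk_linear)
      let ?Y = "{x \<in> V. (M ^^ k) x = x}"
      have "subspace ?Y"
        using M.gen_eig_subspace[of C] unfolding V subspace_def by (auto simp: Mk.zero Mk.add Mk.scale)
      moreover have "M ` ?Y \<subseteq> ?Y"
        unfolding V by (auto simp: M.gen_eig_T funpow_swap1[symmetric])
      ultimately obtain e z where e: "e \<in> ?Y" "e \<noteq> 0" "M e = scale z e"
        using M.ex_eigenvector[of ?Y x] x \<open>x \<noteq> 0\<close> by blast
      have "(M ^^ n) e = scale (z ^ n) e" for n
        by (induction n) (simp_all add: e(3) M.T.scale mult.commute)
      hence "scale (z ^ k) e = scale 1 e" using e(1) by simp
      hence "z ^ k = 1" using e(2) scale_right_imp_eq by blast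
      hence "cmod z ^ k = 1" by (metis norm_one norm_power)
      hence "cmod z = 1" using power_eq_imp_eq_base[of "cmod z" k 1] k by simp
      moreover have "C z" using M.gen_eig_eigen[OF e(2,3), of C] e(1) V by blast
      ultimately show False using C1 by blast
    qed
  qed
  have lt: "z * cnj w \<noteq> 1" if "cmod z < 1" "cmod w < 1" for z w
  proof
    assume "z * cnj w = 1"
    hence "cmod z * cmod w = 1" by (metis norm_mult norm_one complex_mod_cnj)
    moreover have "cmod z * cmod w < 1 * 1" using that by (intro mult_strict_mono') auto
    ultimately show False by simp
  qed
  have gt: "z * cnj w \<noteq> 1" if "cmod z > 1" "cmod w > 1" for z w
  proof
    assume "z * cnj w = 1"
    hence "cmod z * cmod w = 1" by (metis norm_mult norm_one complex_mod_cnj)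
    moreover have "1 * 1 < cmod z * cmod w" using that by (intro mult_strict_mono') auto
    ultimately show False by simp
  qed
  let ?S = "M.gen_eig (\<lambda>z. cmod z < 1)" and ?U = "M.gen_eig (\<lambda>z. cmod z > 1)"
  have "N \<le> dim ?S + dim ?U + elliptic_height scale M" using M.dim_UNIV_le_gen_eig by simp
  hence "real N - real (elliptic_height scale M) \<le> 2 * real (dim ?S) \<or> real N - real (elliptic_height scale M) \<le> 2 * real (dim ?U)"
    by linarith
  thus ?thesis
  proof
    assume h: "real N - real (elliptic_height scale M) \<le> 2 * real (dim ?S)"
    show ?thesis by (rule exI[of _ ?S], rule conjI[OF h props[OF refl lt]]) auto
  next
    assume h: "real N - real (elliptic_height scale M) \<le> 2 * real (dim ?U)"
    show ?thesis by (rule exI[of _ ?U], rule conjI[OF h props[OF refl gt]]) auto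
  qed
qed

text \<open>\<open>M ^^ k - I\<close> is injective on \<open>V\<close>, hence onto \<open>V\<close>.
  Writing \<open>x = (M ^^ k) x' - x'\<close>, the two terms pair equally with the fixed vector
  \<open>v\<close>.\<close>

lemma fixed_orthogonal:
  assumes V: "subspace V" "\<forall>x\<in>V. (M ^^ k) x \<in> V" "\<forall>x\<in>V. (M ^^ k) x = x \<longrightarrow> x = 0"
    and x: "x \<in> V" and v: "(M ^^ k) v = v"
  shows "\<omega> x v = 0"
proof -
  interpret Mk: Vector_Spaces.linear scale scale "M ^^ k" by (rule Mk_linear)
  have "Vector_Spaces.linear scale scale (\<lambda>x. (M ^^ k) x - x)"
    unfolding Vector_Spaces.linear_iff using vector_space_axioms
    by (simp add: Mk.add Mk.scale scale_right_diff_distrib)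
  hence "(\<lambda>x. (M ^^ k) x - x) ` V = V"
    using V by (intro inj_on_subspace_imp_surj) (auto intro: subspace_diff)
  then obtain x' where "x = (M ^^ k) x' - x'" using x by blast
  hence "(M ^^ k) x' = x + x'" by (metis diff_add_cancel)
  hence "\<omega> x v + \<omega> x' v = \<omega> x' v"
    using Mk_pres[of k x' v] v sesquilinearD(1)[OF sesq, of x x' v] by simp
  thus ?thesis by simp
qed

end

text \<open>The complement is the kernel, within \<open>F\<close>, of the orthogonal projection
  \<open>P\<close> onto \<open>K\<close>.\<close>

lemma ex_complement:
  assumes "subspace K" "subspace F" "K \<subseteq> F"
  shows "\<exists>K'. subspace K' \<and> K' \<subseteq> F \<and> K' \<inter> K \<subseteq> {0} \<and> dim K' + dim K = dim F"
proof -
  obtain e where e: "onb (dim K) K e" using ex_onb[OF assms(1)] by blast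
  define P where "P x = (\<Sum>j<dim K. scale (ip x (e j)) (e j))" for x
  have PK: "P x \<in> K" for x
    unfolding P_def using e by (intro subspace_sum subspace_scale assms(1)) (auto simp: onb_def)
  have Pid: "P x = x" if "x \<in> K" for x using onb_expand[OF e that] by (simp add: P_def)
  interpret P: Vector_Spaces.linear scale scale P unfolding P_def by (rule linear_comb)
  define K' where "K' = {x \<in> F. P x = 0}"
  have sK': "subspace K'" using assms(2) unfolding K'_def subspace_def by (auto simp: P.zero P.add P.scale)
  have int: "K' \<inter> K \<subseteq> {0}" using Pid by (auto simp: K'_def)
  have "{x + y |x y. x \<in> K' \<and> y \<in> K} = F"
  proof (intro equalityI subsetI)
    fix x assume "x \<in> F"
    moreover have "P x \<in> F" using PK assms(3) by blast
    ultimately have "x - P x \<in> K'" using assms(2) PK Pid by (auto simp: K'_def P.diff intro: subspace_diff)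
    moreover have "x = (x - P x) + P x" by simp
    ultimately show "x \<in> {x + y |x y. x \<in> K' \<and> y \<in> K}" using PK by blast
  qed (use assms K'_def in \<open>auto intro: subspace_add\<close>)
  hence "dim F + dim (K' \<inter> K) = dim K' + dim K" using dim_sums_Int[OF sK' assms(1)] by simp
  moreover have "dim (K' \<inter> K) = 0" using int by simp
  ultimately have "dim K' + dim K = dim F" by linarith
  thus ?thesis using sK' int K'_def by blast
qed

text \<open>Bezout in the subtraction-free form \<open>k1 * x = k2 * y + gcd k1 k2\<close> suits
  powers with natural exponents, as \<open>M\<close> is here an arbitrary function.\<close>

lemma fixed_gcd:
  fixes M :: "'v \<Rightarrow> 'v"
  assumes "k1 > 0"
  shows "{v. (M ^^ k1) v = v \<and> (M ^^ (k1 + k2)) v = v} = {v. (M ^^ gcd k1 k2) v = v}"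
proof -
  have mult: "(M ^^ (k * n)) v = v" if "(M ^^ k) v = v" for k n v
    using that by (induction n) (simp_all add: funpow_add)
  show ?thesis
  proof (intro equalityI subsetI)
    fix v assume "v \<in> {v. (M ^^ k1) v = v \<and> (M ^^ (k1 + k2)) v = v}"
    hence 1: "(M ^^ k1) v = v" and "(M ^^ (k2 + k1)) v = v" by (simp_all add: add.commute)
    hence 2: "(M ^^ k2) v = v" by (simp add: funpow_add)
    obtain x y where "k1 * x = k2 * y + gcd k1 k2" using bezout_nat[of k1 k2] assms by blast
    hence "v = (M ^^ (gcd k1 k2 + k2 * y)) v" using mult[OF 1, of x] by (simp add: add.commute)
    also have "\<dots> = (M ^^ gcd k1 k2) v" using mult[OF 2, of y] by (simp add: funpow_add)
    finally show "v \<in> {v. (M ^^ gcd k1 k2) v = v}" by simp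
  next
    fix v assume "v \<in> {v. (M ^^ gcd k1 k2) v = v}"
    hence g: "(M ^^ gcd k1 k2) v = v" by simp
    obtain a where a: "k1 = gcd k1 k2 * a" using gcd_dvd1 by (rule dvdE)
    obtain b where b: "k1 + k2 = gcd k1 k2 * b" using dvd_add[OF gcd_dvd1 gcd_dvd2] by (rule dvdE)
    have "(M ^^ k1) v = v" by (subst a) (rule mult[OF g])
    moreover have "(M ^^ (k1 + k2)) v = v" by (subst b) (rule mult[OF g])
    ultimately show "v \<in> {v. (M ^^ k1) v = v \<and> (M ^^ (k1 + k2)) v = v}" by simp
  qed
qed

section \<open>The iteration inequalities\<close>

lemma triple_defect_bounds:
  assumes M: "M \<in> Sp scale \<omega>" and k: "k1 > 0" "k2 > 0"
  defines "A \<equiv> M ^^ k1" and "B \<equiv> M ^^ k2"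
  defines "T \<equiv> Edef (B \<circ> A) B + Edef B id - Edef (B \<circ> A) id"
  defines "fix \<equiv> \<lambda>n. real (dim {v. (M ^^ n) v = v})"
  shows "(real N - real (elliptic_height scale M)) / 2 + fix (k1 + k2) - fix (gcd k1 k2) \<le> T"
    and "T \<le> (real N + real (elliptic_height scale M)) / 2 - fix k1 - fix k2 + fix (gcd k1 k2)"
proof -
  have AS: "A \<in> Sp scale \<omega>" and BS: "B \<in> Sp scale \<omega>" and CS: "B \<circ> A \<in> Sp scale \<omega>" and idS: "id \<in> Sp scale \<omega>"
    using Sp_funpow[OF M vector_space_axioms, of k1] Sp_funpow[OF M vector_space_axioms, of k2]
      Sp_comp[of B scale \<omega> A] Sp_funpow[OF M vector_space_axioms, of 0] by (simp_all add: A_def B_def id_def)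
  interpret A: Vector_Spaces.linear scale scale A by (rule SpD(1)[OF AS])
  interpret B: Vector_Spaces.linear scale scale B by (rule SpD(1)[OF BS])
  have BA: "B (A x) = (M ^^ (k1 + k2)) x" for x by (simp add: A_def B_def funpow_add add.commute[of k1])
  have AB: "A (B x) = B (A x)" for x
    using BA[of x] by (simp add: A_def B_def funpow_add)
  obtain V where V': "real N - real (elliptic_height scale M) \<le> 2 * real (dim V)" "subspace V"
    "\<forall>k. \<forall>x\<in>V. (M ^^ k) x \<in> V" "\<forall>x\<in>V. \<forall>y\<in>V. \<omega> x y = 0"
    "\<forall>k>0. \<forall>x\<in>V. (M ^^ k) x = x \<longrightarrow> x = 0"
    using ex_hyperbolic[OF M] by (elim exE conjE) (rule that)
  note V = V'(2,1) V'(3-5)[rule_format]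
  have VA: "A x \<in> V" and VB: "B x \<in> V" if "x \<in> V" for x
    using V(3)[OF that] by (simp_all add: A_def B_def)
  have A1: "x = 0" if "x \<in> V" "A x = x" for x using V(5)[OF k(1) that(1)] that(2) by (simp add: A_def)
  have B1: "x = 0" if "x \<in> V" "B x = x" for x using V(5)[OF k(2) that(1)] that(2) by (simp add: B_def)
  let ?F = "{v. B (A v) = v}" and ?G = "{v. A v = v \<and> B (A v) = v}"
  have sF: "subspace ?F" "subspace ?G"
    unfolding subspace_def by (auto simp: A.zero B.zero A.add B.add A.scale B.scale)
  obtain K where K: "subspace K" "K \<subseteq> ?F" "K \<inter> ?G \<subseteq> {0}" "dim K + dim ?G = dim ?F"
    using ex_complement[OF sF(2,1)] by blast
  have dF: "real (dim ?F) = fix (k1 + k2)" by (simp add: fix_def BA)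
  have dF0: "real (dim ?G) = fix (gcd k1 k2)"
    using fixed_gcd[OF k(1), of M k2] by (simp add: fix_def BA) (simp add: A_def)
  have VF: "x = 0" if "x \<in> V" "B (A x) = x" for x using V(5)[of "k1 + k2" x] k that by (simp add: BA)
  have orth: "\<omega> x v = 0" if "x \<in> V" "B (A v) = v" for x v
    using fixed_orthogonal[OF M V(1), of "k1 + k2" x v] V(3) V(5)[of "k1 + k2"] k that by (simp add: BA)
  let ?D = "V \<times> K"
  have D: "pr.p.subspace ?D" using V(1) K(1) by (rule pr.subspace_Times)
  have dimD: "real (pr.p.dim ?D) = real (dim V) + fix (k1 + k2) - fix (gcd k1 k2)"
    using pr.dim_Times[OF V(1) K(1)] K(4) dF dF0 by simp
  \<comment> \<open>For the triple \<open>B A\<close>, \<open>B\<close>, \<open>I\<close> the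
    relation reads \<open>B A (y + z) = B y + z\<close>, that is
    \<open>(B A - 1) z = (B - B A) y\<close>. Since powers of \<open>M\<close> commute,
    \<open>y = (B A - 1) w\<close> and \<open>z = (B - B A) w\<close> solve it, and a vector
    \<open>v\<close> fixed by \<open>B A\<close> may be added to \<open>z\<close>. For the reversed
    triple, \<open>y + z = B y + B A z\<close> is solved by \<open>y = (1 - B A) w\<close> and
    \<open>z = (B - 1) w + v\<close>.\<close>
  have lin: "Vector_Spaces.linear sx scale (\<lambda>p. B (A (fst p)) - fst p)"
    "Vector_Spaces.linear sx scale (\<lambda>p. B (fst p) - B (A (fst p)) + snd p)"
    "Vector_Spaces.linear sx scale (\<lambda>p. fst p - B (A (fst p)))"
    "Vector_Spaces.linear sx scale (\<lambda>p. B (fst p) - fst p + snd p)"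
    unfolding Vector_Spaces.linear_iff using vector_space_axioms pr.p.vector_space_axioms
    by (simp_all add: pr.scale_def A.add B.add A.scale B.scale algebra_simps)
  note s = sesquilinearD[OF sesq]
  have s_diff: "\<omega> (x - y) v = \<omega> x v - \<omega> y v" for x y v by (metis s(1) add_diff_cancel_right' diff_add_cancel)
  have injB: "x = 0" if "B x = 0" for x
    using SpD(2)[OF BS] that B.zero by (metis bij_is_inj injD)
  have cross: "a - c = d - b" if "a + b = c + d" for a b c d :: 'v
    using that by (simp add: algebra_simps)
  have k0: "v = 0" if "v \<in> K" "A v = v" for v using K(2,3) that by blast
  have "real (pr.p.dim ?D) \<le> Edef (B \<circ> A) B + Edef B id - Edef (B \<circ> A) id"
  proof (rule triple_ge[OF CS BS idS D lin(1,2)])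
    fix p assume "p \<in> ?D"
    then obtain w v where p: "p = (w, v)" "w \<in> V" "v \<in> K" by blast
    have Fv: "B (A v) = v" using K(2) p(3) by blast
    let ?y = "B (A w) - w" and ?z = "B w - B (A w)"
    show "(B \<circ> A) (B (A (fst p)) - fst p + (B (fst p) - B (A (fst p)) + snd p)) =
        B (B (A (fst p)) - fst p) + id (B (fst p) - B (A (fst p)) + snd p)"
      by (simp add: p A.add A.diff B.add B.diff Fv AB)
    have yV: "?y \<in> V" and zV: "?z \<in> V" using p(2) VA VB V(1) by (auto intro!: subspace_diff)
    \<comment> \<open>\<open>V\<close> is isotropic and orthogonal to the fixed vectors of
      \<open>B A\<close>, so both values of \<open>\<omega>\<close> to be compared are zero.\<close>
    have "\<omega> x (?z + v) = 0" if "x \<in> V" for x unfolding s(3) using V(4)[OF that zV] orth[OF that Fv] by simp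
    thus "\<omega> (B (B (A (fst p)) - fst p)) (id (B (fst p) - B (A (fst p)) + snd p)) =
        \<omega> (B (A (fst p)) - fst p) (B (fst p) - B (A (fst p)) + snd p)"
      using VB[OF yV] yV by (simp add: p)
    assume "B (B (fst p) - B (A (fst p)) + snd p) = id (B (fst p) - B (A (fst p)) + snd p)"
    hence "B (?z + v) = ?z + v" by (simp add: p)
    \<comment> \<open>The left side lies in \<open>V\<close> and the right side is fixed by
      \<open>B A\<close>, so both are zero. Then \<open>B\<close> fixes \<open>?z\<close>, which
      must vanish and gives \<open>w = 0\<close>; and \<open>v\<close> is fixed by \<open>B\<close>
      and \<open>B A\<close>, hence by \<open>A\<close>, so it lies in \<open>?G\<close>, which
      meets \<open>K\<close> only in 0.\<close>
    hence e: "B ?z - ?z = v - B v" unfolding B.add by (rule cross)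
    have "B ?z - ?z \<in> V" by (rule subspace_diff[OF V(1) VB[OF zV] zV])
    moreover have "B (A (v - B v)) = v - B v" unfolding A.diff B.diff AB Fv by (rule refl)
    hence "B (A (B ?z - ?z)) = B ?z - ?z" unfolding e .
    ultimately have z: "B ?z - ?z = 0" by (rule VF)
    have "?z = 0" by (rule B1[OF zV]) (use z in simp)
    hence "B (w - A w) = 0" by (simp add: B.diff)
    hence "w - A w = 0" by (rule injB)
    hence "A w = w" by simp
    hence "w = 0" using A1 p(2) by blast
    moreover have "B v = v" using z e by simp
    hence "A v = v" using Fv AB[of v] by simp
    hence "v = 0" by (rule k0[OF p(3)])
    ultimately show "p = 0" by (simp add: p zero_prod_def)
  qed
  hence "real (dim V) + fix (k1 + k2) - fix (gcd k1 k2) \<le> T" unfolding dimD T_def .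
  thus "(real N - real (elliptic_height scale M)) / 2 + fix (k1 + k2) - fix (gcd k1 k2) \<le> T"
    using V(2) by (simp add: field_simps)
  \<comment> \<open>In the reversed triple every relative unitary is inverted, so its triple defect
    is determined by \<open>T\<close> and the dimensions of the three pairwise
    intersections.\<close>
  have "real (pr.p.dim ?D) \<le> Edef id B + Edef B (B \<circ> A) - Edef id (B \<circ> A)"
  proof (rule triple_ge[OF idS BS CS D lin(3,4)])
    fix p assume "p \<in> ?D"
    then obtain w v where p: "p = (w, v)" "w \<in> V" "v \<in> K" by blast
    have Fv: "B (A v) = v" using K(2) p(3) by blast
    let ?y = "w - B (A w)" and ?z = "B w - w"
    show "id (fst p - B (A (fst p)) + (B (fst p) - fst p + snd p)) =
        B (fst p - B (A (fst p))) + (B \<circ> A) (B (fst p) - fst p + snd p)"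
      by (simp add: p A.add A.diff B.add B.diff Fv AB)
    have yV: "?y \<in> V" and zV: "?z \<in> V" using p(2) VA VB V(1) by (auto intro!: subspace_diff)
    have "\<omega> x (u + v) = 0" if "x \<in> V" "u \<in> V" for x u unfolding s(3) using V(4)[OF that] orth[OF that(1) Fv] by simp
    moreover have "(B \<circ> A) (?z + v) = B (A ?z) + v" by (simp add: A.add B.add Fv)
    ultimately show "\<omega> (B (fst p - B (A (fst p)))) ((B \<circ> A) (B (fst p) - fst p + snd p)) =
        \<omega> (fst p - B (A (fst p))) (B (fst p) - fst p + snd p)"
      using VB[OF yV] yV zV VB[OF VA[OF zV]] by (simp only: p fst_conv snd_conv)
    assume "B (B (fst p) - fst p + snd p) = (B \<circ> A) (B (fst p) - fst p + snd p)"
    hence "?z + v = A (?z + v)" using SpD(2)[OF BS] by (auto simp: p bij_def inj_eq)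
    hence "A (?z + v) = ?z + v" by simp
    hence e: "A ?z - ?z = v - A v" unfolding A.add by (rule cross)
    have "A ?z - ?z \<in> V" by (rule subspace_diff[OF V(1) VA[OF zV] zV])
    moreover have "B (A (v - A v)) = v - A v" using AB[of "A v"] by (simp add: A.diff B.diff Fv)
    hence "B (A (A ?z - ?z)) = A ?z - ?z" unfolding e .
    ultimately have z: "A ?z - ?z = 0" by (rule VF)
    have "?z = 0" by (rule A1[OF zV]) (use z in simp)
    hence "w = 0" using B1[OF p(2)] by simp
    moreover have "A v = v" using z e by simp
    hence "v = 0" by (rule k0[OF p(3)])
    ultimately show "p = 0" by (simp add: p zero_prod_def)
  qed
  moreover have "Edef id B = real N - fix k2 - Edef B id"
    using Edef_swap[OF BS idS] by (simp add: fix_def B_def)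
  moreover have "Edef B (B \<circ> A) = real N - fix k1 - Edef (B \<circ> A) B"
  proof -
    have "{v. (B \<circ> A) v = B v} = {v. A v = v}" using SpD(2)[OF BS] by (auto simp: bij_def inj_eq)
    thus ?thesis using Edef_swap[OF CS BS] by (simp add: fix_def A_def)
  qed
  moreover have "Edef id (B \<circ> A) = real N - fix (k1 + k2) - Edef (B \<circ> A) id"
    using Edef_swap[OF CS idS] dF by simp
  ultimately have "real (dim V) + fix (k1 + k2) - fix (gcd k1 k2) \<le> real N - fix k1 - fix k2 + fix (k1 + k2) - T"
    unfolding dimD T_def by linarith
  thus "T \<le> (real N + real (elliptic_height scale M)) / 2 - fix k1 - fix k2 + fix (gcd k1 k2)"
    using V(2) by (simp add: field_simps)
qed

end

text \<open>\<open>Gr id\<close> is an isotropic subspace of half the dimension of the double; it is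
  the one fed to \<open>ex_polarization\<close> to balance the two definite parts.\<close>

lemma ex_polarized:
  fixes scale :: "complex \<Rightarrow> 'v::ab_group_add \<Rightarrow> 'v" and \<omega> :: "'v \<Rightarrow> 'v \<Rightarrow> complex"
  assumes "complex_symplectic_space scale \<omega>"
  shows "\<exists>Basis ip phm php prm prp. polarized scale Basis ip \<omega> phm php prm prp"
proof -
  interpret cs: complex_symplectic_space scale \<omega> by fact
  obtain B where B: "finite B" "cs.span B = UNIV" using cs.finite_dim by blast
  obtain Basis where Basis: "Basis \<subseteq> B" "cs.independent Basis" "B \<subseteq> cs.span Basis"
    using cs.maximal_independent_subset[of B] by blast
  have "cs.span Basis = UNIV" using B(2) Basis(3) by (metis cs.span_mono cs.span_span top.extremum_uniqueI)
  hence fd: "finite_dimensional_vector_space scale Basis"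
    using Basis B(1) finite_subset by unfold_locales auto
  obtain ip where ip: "inner_product scale ip" using ex_inner_product[OF fd] by blast
  interpret hermitian_space scale Basis ip
    by (intro hermitian_space.intro fd hermitian_space_axioms.intro ip)
  interpret pr: finite_dimensional_vector_space_prod scale scale Basis Basis by unfold_locales
  let ?sx = "module_prod.scale scale scale" and ?\<Omega> = "double_form \<omega>"
  have sympl: "symplectic_form scale \<omega>" by (rule cs.symplectic)
  hence sesq: "sesquilinear scale \<omega>" and skew: "\<And>x y. \<omega> x y = - cnj (\<omega> y x)"
    and nondeg: "\<And>x. (\<And>y. \<omega> x y = 0) \<Longrightarrow> x = 0" unfolding symplectic_form_def by blast+
  note s = sesquilinearD[OF sesq]
  have \<omega>0: "\<omega> x 0 = 0" for x using s(4)[of x 0 0] by simp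
  have cv: "vector_space ((*) :: complex \<Rightarrow> complex \<Rightarrow> complex)" by unfold_locales (simp_all add: algebra_simps)
  have "sesquilinear ?sx ?\<Omega>"
    unfolding sesquilinear_def Vector_Spaces.linear_iff using pr.p.vector_space_axioms cv
    by (simp add: double_form_def s pr.scale_def algebra_simps)
  moreover have "?\<Omega> p q = - cnj (?\<Omega> q p)" for p q
    unfolding double_form_def using skew[of "fst p" "fst q"] skew[of "snd p" "snd q"] by simp
  moreover have "p = 0" if p: "\<forall>q. ?\<Omega> p q = 0" for p
  proof -
    have "\<omega> (fst p) y = 0" "\<omega> (snd p) y = 0" for y
      using p[rule_format, of "(y, 0)"] p[rule_format, of "(0, y)"] by (simp_all add: double_form_def \<omega>0)
    hence "fst p = 0" "snd p = 0" using nondeg by blast+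
    thus ?thesis by (simp add: prod_eq_iff)
  qed
  ultimately have "symplectic_form ?sx ?\<Omega>" unfolding symplectic_form_def by blast
  hence X: "symplectic_fd ?sx pr.Basis_pair ?\<Omega>"
    by (intro symplectic_fd.intro symplectic_fd_axioms.intro pr.p.finite_dimensional_vector_space_axioms)
  have idS: "id \<in> Sp scale \<omega>"
    using cs.vector_space_axioms by (simp add: Sp_def Vector_Spaces.linear_iff bij_def)
  have L: "pr.p.subspace (Gr id)" using lagrangian_Gr[OF assms idS] by (simp add: lagrangian_def)
  have iso: "?\<Omega> p q = 0" if "p \<in> Gr id" "q \<in> Gr id" for p q
    using that by (auto simp: Gr_def double_form_def)
  have lin: "Vector_Spaces.linear scale ?sx (\<lambda>x. (x, x))"
    unfolding Vector_Spaces.linear_iff using cs.vector_space_axioms pr.p.vector_space_axioms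
    by (simp add: pr.scale_prod)
  interpret pp: finite_dimensional_vector_space_pair_1 scale Basis ?sx by unfold_locales
  have "pr.p.dim (range (\<lambda>x. (x, x))) = cs.dim (UNIV :: 'v set)"
    by (rule pp.dim_image_eq[OF lin]) (simp add: inj_on_def)
  moreover have "(Gr id :: ('v \<times> 'v) set) = range (\<lambda>x. (x, x))" by (auto simp: Gr_def)
  ultimately have dimL: "pr.p.dim (Gr id) = card Basis" by simp
  have card: "card pr.Basis_pair = 2 * card Basis"
    using pr.dim_Times[OF cs.subspace_UNIV cs.subspace_UNIV] by simp
  obtain phm php prm prp where *: "Vector_Spaces.linear scale ?sx phm" "Vector_Spaces.linear scale ?sx php"
     "Vector_Spaces.linear ?sx scale prm" "Vector_Spaces.linear ?sx scale prp"
     "\<And>\<xi>. phm (prm \<xi>) + php (prp \<xi>) = \<xi>"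
     "\<And>x. prm (phm x) = x \<and> prp (phm x) = 0 \<and> prm (php x) = 0 \<and> prp (php x) = x"
     "\<And>\<xi> \<eta>. ?\<Omega> \<xi> \<eta> = - \<i> * (ip (prm \<xi>) (prm \<eta>) - ip (prp \<xi>) (prp \<eta>))"
     "X_minus ?sx ?\<Omega> = range phm" "X_plus ?sx ?\<Omega> = range php"
    using ex_polarization[OF X hermitian_space_axioms L iso dimL card] by metis
  have "polarized scale Basis ip \<omega> phm php prm prp"
    by (intro polarized.intro hermitian_space_axioms polarized_axioms.intro sympl) (use * in simp_all)
  thus ?thesis by blast
qed

theorem theorem4p3:
  fixes scale :: "complex \<Rightarrow> 'v::ab_group_add \<Rightarrow> 'v"
    and \<omega> :: "'v \<Rightarrow> 'v \<Rightarrow> complex"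
    and m k1 k2 :: nat and \<tau> :: real
    and \<gamma> :: "real \<Rightarrow> 'v \<Rightarrow> 'v" and M :: "'v \<Rightarrow> 'v"
  assumes "complex_symplectic_space scale \<omega>"
    and "vector_space.dim scale (UNIV :: 'v set) = m"
    and "\<tau> > 0"
    and "\<gamma> \<in> sp_paths scale \<omega> \<tau>"
    and "M = \<gamma> \<tau>"
    and "k1 > 0" and "k2 > 0"
  shows "real (nu1 scale (M ^^ k1)) + real (nu1 scale (M ^^ k2))
           - real (nu1 scale (M ^^ gcd k1 k2))
           - (real (elliptic_height scale M) + real m) / 2
         \<le> real_of_int (i1 scale \<omega> (real (k1 + k2) * \<tau>) (path_iterate \<tau> \<gamma> (k1 + k2))
             - i1 scale \<omega> (real k1 * \<tau>) (path_iterate \<tau> \<gamma> k1)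
             - i1 scale \<omega> (real k2 * \<tau>) (path_iterate \<tau> \<gamma> k2)) \<and>
         real_of_int (i1 scale \<omega> (real (k1 + k2) * \<tau>) (path_iterate \<tau> \<gamma> (k1 + k2))
             - i1 scale \<omega> (real k1 * \<tau>) (path_iterate \<tau> \<gamma> k1)
             - i1 scale \<omega> (real k2 * \<tau>) (path_iterate \<tau> \<gamma> k2))
         \<le> real (nu1 scale (M ^^ gcd k1 k2)) - real (nu1 scale (M ^^ (k1 + k2)))
           + (real (elliptic_height scale M) - real m) / 2"
proof -
  interpret cs: complex_symplectic_space scale \<omega> by fact
  obtain Basis ip phm php prm prp where "polarized scale Basis ip \<omega> phm php prm prp"
    using ex_polarized[OF assms(1)] by blast
  then interpret polarized scale Basis ip \<omega> phm php prm prp .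
  have M: "M \<in> Sp scale \<omega>" using M_Sp[OF assms(3,4)] assms(5) by simp
  have N: "real N = real m" using assms(2) by simp
  have nu: "real (nu1 scale (M ^^ n)) = real (cs.dim {v. (M ^^ n) v = v})" for n
    by (simp add: nu1_def)
  \<comment> \<open>The index difference is minus the triple defect \<open>T\<close>, so the lower
    bound on \<open>T\<close> gives the upper inequality and conversely.\<close>
  show ?thesis
    using i1_difference[OF assms(3,4,6,7)] triple_defect_bounds[OF M assms(6,7)]
    unfolding nu N assms(5)[symmetric] by (simp add: field_simps)
qed

end
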